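(* Let $\Omega\subset\mathbb{R}^N$ be a uniformly convex domain. The operator $\mathcal{I}^+_k(\cdot)+\mu\,\cdot$ satisfies the maximum principle in $\Omega$ if and only if $\mu<\mu_k^+<+\infty$, and correspondingly the operator $\mathcal{I}_k^-(\cdot)+\mu\,\cdot$ satisfies the maximum principle in $\Omega$ for any $\mu\in\mathbb{R}$.
   Context: Fix $s\in(0,1)$ and an integer $k$ with $1\le k\le N$. A uniformly convex domain is a bounded domain $\Omega\subset\mathbb{R}^N$ of the form $\Omega=\bigcap_{y\in Y}B_R(y)$ for some $R>0$ and some set $Y\subset\mathbb{R}^N$, where $B_R(y)$ is the ball of center $y$ and radius $R$. $LSC$/$USC$ denote lower/upper semicontinuous functions. Set $\delta(u,x,y)=u(x+y)+u(x-y)-2u(x)$, let $C_s=C_{1,s}>0$ be the normalizing constant of the one-dimensional fractional Laplacian, and let $\mathcal{V}_k$ be the family of $k$-dimensional orthonormal sets in $\mathbb{R}^N$. The operators are $\mathcal{I}_k^+u(x)=\sup_{\{\xi_i\}\in\mathcal{V}_k}\sum_{i=1}^k\mathcal{I}_{\xi_i}u(x)$ and $\mathcal{I}_k^-u(x)=\inf_{\{\xi_i\}\in\mathcal{V}_k}\sum_{i=1}^k\mathcal{I}_{\xi_i}u(x)$, where $\mathcal{I}_\xi u(x)=C_s\int_0^{+\infty}\delta(u,x,\tau\xi)\tau^{-1-2s}\,d\tau$. Inequalities are in the viscosity sense: $u\in L^\infty(\mathbb{R}^N)\cap LSC(\Omega)$ (resp. $USC(\Omega)$) satisfies $\mathcal{I}_k^+u+\mu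 u\le0$ (resp. $\ge0$) in $\Omega$ if for every $x_0\in\Omega$, $\rho>0$ and $\varphi\in C^2(B_\rho(x_0))$ such that $x_0$ is a minimum (resp. maximum) point of $u-\varphi$ in $B_\rho(x_0)$, $$C_s\sup_{\{\xi_i\}\in\mathcal{V}_k}\sum_{i=1}^k\left(\int_0^\rho\frac{\delta(\varphi,x_0,\tau\xi_i)}{\tau^{1+2s}}\,d\tau+\int_\rho^{+\infty}\frac{\delta(u,x_0,\tau\xi_i)}{\tau^{1+2s}}\,d\tau\right)+\mu u(x_0)\le 0\quad(\text{resp. }\ge 0).$$ For $\mathcal{I}_k^-$ replace $\sup$ by $\inf$. An operator $\mathcal{J}$ satisfies the (weak) maximum principle in $\Omega$ if for every $u\in USC(\overline\Omega)\cap L^\infty(\mathbb{R}^N)$: $\mathcal{J}u\ge0$ in $\Omega$ and $u\le0$ in $\mathbb{R}^N\setminus\Omega$ imply $u\le0$ in $\Omega$. Define $$\mu_k^+=\sup\left\{\mu\in\mathbb{R}:\ \exists v\in LSC(\Omega)\cap L^\infty(\mathbb{R}^N),\ v>0\text{ in }\Omega,\ v\ge0\text{ in }\mathbb{R}^N,\ \mathcal{I}_k^+v+\mu v\le0\text{ in }\Omega\right\}.$$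
   Formalization: The claim for I_k^- is proved for k < N only; for k = N it is false, since a smooth bump supported in a ball inside Ω is a positive subsolution for large μ (and for k = N = 1 it contradicts μ_1^+ < +∞). *)

theory Defs
  imports "HOL-Analysis.Analysis"
begin

text \<open>
  The ambient space is a Euclidean space \<open>'a\<close>, whose dimension \<open>DIM('a)\<close> is the \<open>N\<close> of the
  literature.
\<close>

definition uniformly_convex_domain :: "'a::euclidean_space set \<Rightarrow> bool" where
  "uniformly_convex_domain \<Omega> \<longleftrightarrow>
     open \<Omega> \<and> connected \<Omega> \<and> \<Omega> \<noteq> {} \<and> bounded \<Omega> \<and>
     (\<exists>R>0. \<exists>Y. \<Omega> = (\<Inter>y\<in>Y. ball y R))"

definition lsc_on :: "'a::topological_space set \<Rightarrow> ('a \<Rightarrow> real) \<Rightarrow> bool" where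
  "lsc_on S u \<longleftrightarrow> (\<forall>x\<in>S. \<forall>c<u x. \<forall>\<^sub>F y in at x within S. c < u y)"

definition usc_on :: "'a::topological_space set \<Rightarrow> ('a \<Rightarrow> real) \<Rightarrow> bool" where
  "usc_on S u \<longleftrightarrow> (\<forall>x\<in>S. \<forall>c>u x. \<forall>\<^sub>F y in at x within S. u y < c)"

text \<open>
  The nonlocal terms below integrate \<open>u\<close> along individual lines, so \<open>u\<close> is a function and not a
  class modulo null sets, and its restriction to every line has to be measurable.
  We therefore read \<open>L\<^sup>\<infinity>\<close> as the space of bounded Borel functions.
\<close>

definition L_infty :: "('a::euclidean_space \<Rightarrow> real) \<Rightarrow> bool" where
  "L_infty u \<longleftrightarrow> u \<in> borel_measurable borel \<and> bounded (range u)"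

text \<open>\<open>C\<^sup>2\<close> regularity on an open set, through a gradient \<open>g\<close> and a continuous Hessian \<open>H\<close>.\<close>

definition C2_on :: "'a::euclidean_space set \<Rightarrow> ('a \<Rightarrow> real) \<Rightarrow> bool" where
  "C2_on S \<phi> \<longleftrightarrow>
     (\<exists>(g :: 'a \<Rightarrow> 'a) (H :: 'a \<Rightarrow> 'a \<Rightarrow>\<^sub>L 'a).
        (\<forall>x\<in>S. (\<phi> has_derivative (\<lambda>h. g x \<bullet> h)) (at x)) \<and>
        (\<forall>x\<in>S. (g has_derivative blinfun_apply (H x)) (at x)) \<and>
        continuous_on S H)"

text \<open>
  The constant \<open>C\<^bsub>1,s\<^esub>\<close> of the one-dimensional fractional Laplacian
  \<open>(-\<Delta>)\<^sup>s u(x) = C\<^bsub>1,s\<^esub> PV \<integral> (u(x) - u(y)) / |x - y| powr (1 + 2 s) dy\<close>, i.e. the one for which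
  its Fourier symbol is \<open>|\<xi>| powr (2 s)\<close>.
\<close>

definition frac_const :: "real \<Rightarrow> real" where
  "frac_const s = 4 powr s * s * Gamma (s + 1/2) / (sqrt pi * Gamma (1 - s))"

definition second_diff :: "('a::real_vector \<Rightarrow> real) \<Rightarrow> 'a \<Rightarrow> 'a \<Rightarrow> real" where
  "second_diff u x y = u (x + y) + u (x - y) - 2 * u x"

text \<open>
  Extended-valued Lebesgue integral. A test function is only \<open>C\<^sup>2\<close> in an open ball and may be
  unbounded near its boundary, so the local term in the viscosity inequality can be infinite
  (\<open>+\<infinity>\<close> if the test function touches from above, \<open>-\<infinity>\<close> if it touches from below);
  the indeterminate case \<open>\<infinity> - \<infinity>\<close> does not arise for admissible test functions.
\<close>

definition ext_integral :: "real set \<Rightarrow> (real \<Rightarrow> real) \<Rightarrow> ereal" where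
  "ext_integral A f =
     enn2ereal (\<integral>\<^sup>+\<tau>\<in>A. ennreal (f \<tau>) \<partial>lborel) - enn2ereal (\<integral>\<^sup>+\<tau>\<in>A. ennreal (- f \<tau>) \<partial>lborel)"

definition orthonormal_sets :: "nat \<Rightarrow> 'a::euclidean_space set set" where
  "orthonormal_sets k =
     {V. finite V \<and> card V = k \<and> (\<forall>\<xi>\<in>V. norm \<xi> = 1) \<and> pairwise orthogonal V}"

definition visc_directional ::
    "real \<Rightarrow> real \<Rightarrow> ('a::euclidean_space \<Rightarrow> real) \<Rightarrow> ('a \<Rightarrow> real) \<Rightarrow> 'a \<Rightarrow> 'a \<Rightarrow> ereal" where
  "visc_directional s \<rho> \<phi> u x \<xi> =
     ext_integral {0<..<\<rho>} (\<lambda>\<tau>. second_diff \<phi> x (\<tau> *\<^sub>R \<xi>) / \<tau> powr (1 + 2 * s)) +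
     ext_integral {\<rho>..} (\<lambda>\<tau>. second_diff u x (\<tau> *\<^sub>R \<xi>) / \<tau> powr (1 + 2 * s))"

text \<open>
  An operator enters viscosity inequalities through its value at \<open>x\<close> when \<open>u\<close> is replaced by the
  test function \<open>\<phi>\<close> inside the ball of radius \<open>\<rho>\<close>; the arguments are \<open>\<rho>\<close>, \<open>\<phi>\<close>, \<open>u\<close>, \<open>x\<close>.
  The operators \<open>I\<^sub>k\<^sup>+ + \<mu>\<close> and \<open>I\<^sub>k\<^sup>- + \<mu>\<close> are given in this form.
\<close>

type_synonym 'a visc_op = "real \<Rightarrow> ('a \<Rightarrow> real) \<Rightarrow> ('a \<Rightarrow> real) \<Rightarrow> 'a \<Rightarrow> ereal"

definition I_plus :: "real \<Rightarrow> nat \<Rightarrow> real \<Rightarrow> 'a::euclidean_space visc_op" where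
  "I_plus s k \<mu> \<rho> \<phi> u x =
     ereal (frac_const s) *
       (SUP V\<in>orthonormal_sets k. \<Sum>\<xi>\<in>V. visc_directional s \<rho> \<phi> u x \<xi>) + ereal (\<mu> * u x)"

text \<open>
  For \<open>k < DIM('a)\<close> some orthonormal set of size \<open>k\<close> lies in the orthogonal complement of any given
  vector. For \<open>k = DIM('a)\<close> this is lost, and \<open>I\<^sub>k\<^sup>- + \<mu>\<close> does not satisfy the maximum principle when
  \<open>\<mu>\<close> is large: a smooth bump supported in a ball inside the domain is a positive subsolution.
\<close>

definition I_minus :: "real \<Rightarrow> nat \<Rightarrow> real \<Rightarrow> 'a::euclidean_space visc_op" where
  "I_minus s k \<mu> \<rho> \<phi> u x =
     ereal (frac_const s) *
       (INF V\<in>orthonormal_sets k. \<Sum>\<xi>\<in>V. visc_directional s \<rho> \<phi> u x \<xi>) + ereal (\<mu> * u x)"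

definition visc_supersolution ::
    "'a::euclidean_space visc_op \<Rightarrow> 'a set \<Rightarrow> ('a \<Rightarrow> real) \<Rightarrow> bool" where
  "visc_supersolution J \<Omega> u \<longleftrightarrow>
     L_infty u \<and> lsc_on \<Omega> u \<and>
     (\<forall>x0\<in>\<Omega>. \<forall>\<rho>>0. \<forall>\<phi>. C2_on (ball x0 \<rho>) \<phi> \<longrightarrow>
        (\<forall>x\<in>ball x0 \<rho>. u x0 - \<phi> x0 \<le> u x - \<phi> x) \<longrightarrow> J \<rho> \<phi> u x0 \<le> 0)"

definition visc_subsolution ::
    "'a::euclidean_space visc_op \<Rightarrow> 'a set \<Rightarrow> ('a \<Rightarrow> real) \<Rightarrow> bool" where
  "visc_subsolution J \<Omega> u \<longleftrightarrow>
     L_infty u \<and> usc_on \<Omega> u \<and>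
     (\<forall>x0\<in>\<Omega>. \<forall>\<rho>>0. \<forall>\<phi>. C2_on (ball x0 \<rho>) \<phi> \<longrightarrow>
        (\<forall>x\<in>ball x0 \<rho>. u x - \<phi> x \<le> u x0 - \<phi> x0) \<longrightarrow> 0 \<le> J \<rho> \<phi> u x0)"

definition maximum_principle :: "'a::euclidean_space visc_op \<Rightarrow> 'a set \<Rightarrow> bool" where
  "maximum_principle J \<Omega> \<longleftrightarrow>
     (\<forall>u. usc_on (closure \<Omega>) u \<longrightarrow> L_infty u \<longrightarrow> visc_subsolution J \<Omega> u \<longrightarrow>
        (\<forall>x. x \<notin> \<Omega> \<longrightarrow> u x \<le> 0) \<longrightarrow> (\<forall>x\<in>\<Omega>. u x \<le> 0))"

text \<open>An extended real: finiteness is part of what has to be proved.\<close>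

definition mu_plus :: "real \<Rightarrow> nat \<Rightarrow> 'a::euclidean_space set \<Rightarrow> ereal" where
  "mu_plus s k \<Omega> =
     (SUP \<mu>\<in>{\<mu>. \<exists>v. L_infty v \<and> lsc_on \<Omega> v \<and> (\<forall>x\<in>\<Omega>. 0 < v x) \<and> (\<forall>x. 0 \<le> v x) \<and>
                 visc_supersolution (I_plus s k \<mu>) \<Omega> v}. ereal \<mu>)"

end

theory Submission
  imports Defs
begin

text \<open>
  Write \<open>\<Omega> = {d > 0}\<close> with the strongly concave function
  \<open>d x = INF y. R\<^sup>2 - |x - y|\<^sup>2\<close>. Concavity along lines makes \<open>d powr (s / 2)\<close> a strict
  supersolution of \<open>I\<^sub>k\<^sup>+\<close> that vanishes on the boundary.

  If \<open>\<mu> < \<mu>\<^sub>k\<^sup>+\<close>, a multiple of this barrier dominates any subsolution \<open>u\<close>, and a small multiple of it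
  added to a positive supersolution for some \<open>\<mu>' > \<mu>\<close> gives a strict supersolution \<open>z\<close>. The smallest
  \<open>\<theta>\<close> with \<open>u \<le> \<theta> z\<close> must vanish. Since the order is below \<open>2\<close>, doubling of variables with
  paraboloids as test functions suffices for comparison: their local contribution tends to \<open>0\<close> with
  the radius, and the nonlocal contributions are ordered at the maximum point.

  If the maximum principle holds for \<open>\<mu>\<close>, one solves \<open>I\<^sub>k\<^sup>+ U + \<mu> U = - 1\<close> for the operator truncated
  to jumps of length at least \<open>h\<close>, with the obstacle \<open>U \<le> M\<close>. If for some \<open>M\<close> the obstacle is inactive
  for arbitrarily small \<open>h\<close>, the lower half-relaxed limit is a positive bounded supersolution with
  right-hand side \<open>- 1\<close>, so \<open>\<mu> < \<mu>\<^sub>k\<^sup>+\<close>. Otherwise the upper half-relaxed limit of \<open>U / M\<close> as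
  \<open>M\<close> grows is a subsolution with maximum \<open>1\<close> that vanishes outside \<open>\<Omega>\<close> by the barrier,
  contradicting the maximum principle.

  Finiteness of \<open>\<mu>\<^sub>k\<^sup>+\<close> follows since a truncated paraboloid is a subsolution for large \<open>\<mu>\<close>.
  For \<open>I\<^sub>k\<^sup>-\<close> the subsolution is touched by Gaussians centred at the origin, which are concave enough
  in the directions orthogonal to the contact point.
\<close>

section \<open>The Levy measure and extended integrals\<close>

text \<open>The operator acts along \<open>k\<close> lines only and the proof draws no regularity
  from it. A positive supersolution \<open>v\<close> may tend to 0 at the boundary, and then nothing
  bounds \<open>u / v\<close>. The barrier repairs this: its image tends to -\<infinity> at least
  like \<open>- d powr (- s / 2)\<close>, which outweighs a zero-order term of any sign near the
  boundary, while in the interior the gap between \<open>\<mu>\<close> and \<open>\<mu>'\<close>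
  times a positive minimum of \<open>v\<close> does so. The strict inequality
  \<open>\<mu> < \<mu>\<^sub>k\<^sup>+\<close> comes from the right-hand side -1: for a limit
  \<open>v \<le> M\<close> half of it can be traded for \<open>v / (2 * M)\<close>, that is, for a
  larger zero-order coefficient. In the other alternative division by \<open>M\<close> makes the
  same right-hand side vanish. Truncation turns the equation into a fixed point problem for a
  monotone map, so existence is a matter of order alone, and the obstacle keeps the candidates
  bounded whatever \<mu> is. Throughout \<open>\<mu> = C * m\<close>, so that the normalizing
  constant cancels.\<close>

locale fractional_order =
  fixes s :: real
  assumes s_pos: "0 < s" and s_less_1: "s < 1"
begin

text \<open>As a measure the kernel admits dominated convergence and Bochner integrals of second
  differences directly. Its mass is infinite at 0 and finite on every \<open>{h..}\<close> with
  \<open>0 < h\<close>.\<close>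

definition levy :: "real measure" where
  "levy = density lborel (\<lambda>\<tau>. ennreal (indicator {0<..} \<tau> * \<tau> powr (- (1 + 2 * s))))"

lemma sets_levy [simp, measurable_cong]: "sets levy = sets borel"
  and space_levy [simp]: "space levy = UNIV"
  by (simp_all add: levy_def)

lemma AE_levy_pos: "AE \<tau> in levy. 0 < \<tau>"
  unfolding levy_def by (subst AE_density) (auto simp: indicator_def)

lemma nn_integral_levy:
  assumes "f \<in> borel_measurable borel"
  shows "(\<integral>\<^sup>+\<tau>. f \<tau> \<partial>levy) = (\<integral>\<^sup>+\<tau>. ennreal (\<tau> powr (- (1 + 2 * s))) * f \<tau> * indicator {0<..} \<tau> \<partial>lborel)"
  unfolding levy_def using assms
  by (subst nn_integral_density) (auto intro!: nn_integral_cong simp: indicator_def)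

lemma nn_integral_levy_powr:
  assumes A: "A \<in> sets borel" "A \<subseteq> {0<..}"
    and I: "((\<lambda>\<tau>. \<tau> powr (\<beta> - (1 + 2 * s))) has_integral I) A"
  shows "(\<integral>\<^sup>+\<tau>. ennreal (\<tau> powr \<beta> * indicator A \<tau>) \<partial>levy) = ennreal I"
proof -
  have "(\<integral>\<^sup>+\<tau>. ennreal (\<tau> powr \<beta> * indicator A \<tau>) \<partial>levy) =
      (\<integral>\<^sup>+\<tau>. ennreal (\<tau> powr (\<beta> - (1 + 2 * s))) * indicator A \<tau> \<partial>lborel)"
    using A by (subst nn_integral_levy)
      (auto intro!: nn_integral_cong simp: indicator_def subset_iff algebra_simps simp flip: ennreal_mult powr_add)
  also have "\<dots> = ennreal I"
    by (rule nn_integral_has_integral_lebesgue'[OF _ I]) auto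
  finally show ?thesis .
qed

lemma has_bochner_integral_levy_powr:
  assumes A: "A \<in> sets borel" "A \<subseteq> {0<..}"
    and I: "((\<lambda>\<tau>. \<tau> powr (\<beta> - (1 + 2 * s))) has_integral I) A"
  shows "has_bochner_integral levy (\<lambda>\<tau>. \<tau> powr \<beta> * indicator A \<tau>) I"
proof (rule has_bochner_integral_nn_integral)
  show "(\<lambda>\<tau>. \<tau> powr \<beta> * indicator A \<tau>) \<in> borel_measurable levy"
    using A by measurable
  show "0 \<le> I" using has_integral_nonneg[OF I] by simp
qed (use nn_integral_levy_powr[OF assms] in \<open>auto simp: indicator_def\<close>)

lemma has_bochner_integral_levy_tail_powr:
  assumes "0 < h" "\<beta> < 2 * s"
  shows "has_bochner_integral levy (\<lambda>\<tau>. \<tau> powr \<beta> * indicator {h..} \<tau>) (h powr (\<beta> - 2 * s) / (2 * s - \<beta>))"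
proof -
  have "((\<lambda>\<tau>. \<tau> powr (\<beta> - (1 + 2 * s))) has_integral
      - (h powr (\<beta> - (1 + 2 * s) + 1)) / (\<beta> - (1 + 2 * s) + 1)) {h..}"
    using assms by (intro has_integral_powr_to_inf) auto
  also have "- (h powr (\<beta> - (1 + 2 * s) + 1)) / (\<beta> - (1 + 2 * s) + 1) = h powr (\<beta> - 2 * s) / (2 * s - \<beta>)"
    using assms by (simp add: divide_simps algebra_simps)
  finally show ?thesis
    using assms by (intro has_bochner_integral_levy_powr) auto
qed

lemma has_bochner_integral_levy_tail:
  assumes "0 < h"
  shows "has_bochner_integral levy (indicator {h..}) (h powr (- 2 * s) / (2 * s))"
proof -
  have "has_bochner_integral levy (\<lambda>\<tau>. \<tau> powr 0 * indicator {h..} \<tau>) (h powr (0 - 2 * s) / (2 * s - 0))"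
    using assms s_pos by (intro has_bochner_integral_levy_tail_powr) auto
  also have "(\<lambda>\<tau>. \<tau> powr 0 * indicator {h..} \<tau>) = (indicator {h..} :: real \<Rightarrow> real)"
    using assms by (auto simp: indicator_def fun_eq_iff)
  finally show ?thesis by simp
qed

lemma has_bochner_integral_levy_square:
  assumes "0 < h"
  shows "has_bochner_integral levy (\<lambda>\<tau>. \<tau>\<^sup>2 * indicator {0<..<h} \<tau>) (h powr (2 - 2 * s) / (2 - 2 * s))"
proof -
  have "((\<lambda>\<tau>. \<tau> powr (2 - (1 + 2 * s))) has_integral
      h powr (2 - (1 + 2 * s) + 1) / (2 - (1 + 2 * s) + 1)) {0..h}"
    using assms s_less_1 by (intro has_integral_powr_from_0) auto
  then have "((\<lambda>\<tau>. \<tau> powr (2 - (1 + 2 * s))) has_integral h powr (2 - 2 * s) / (2 - 2 * s)) {0<..<h}"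
    by (subst has_integral_Icc_iff_Ioo[symmetric]) (simp add: algebra_simps)
  then have "has_bochner_integral levy (\<lambda>\<tau>. \<tau> powr 2 * indicator {0<..<h} \<tau>) (h powr (2 - 2 * s) / (2 - 2 * s))"
    by (intro has_bochner_integral_levy_powr) auto
  also have "(\<lambda>\<tau>. \<tau> powr 2 * indicator {0<..<h} \<tau>) = (\<lambda>\<tau>. \<tau>\<^sup>2 * indicator {0<..<h} \<tau> :: real)"
    by (auto simp: indicator_def fun_eq_iff)
  finally show ?thesis .
qed

text \<open>\<open>min 1 (\<tau>\<^sup>2)\<close> is the common majorant of what follows: second
  differences are O(\<open>\<tau>\<^sup>2\<close>) at 0 for a \<open>C\<^sup>2\<close> function and
  O(1) at infinity for a bounded one.\<close>

lemma integrable_levy_min: "integrable levy (\<lambda>\<tau>. min 1 (\<tau>\<^sup>2))"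
proof (rule Bochner_Integration.integrable_bound)
  show "integrable levy (\<lambda>\<tau>. \<tau>\<^sup>2 * indicator {0<..<1} \<tau> + indicator {1..} \<tau> :: real)"
    using has_bochner_integral_levy_square[of 1] has_bochner_integral_levy_tail[of 1]
    by (intro Bochner_Integration.integrable_add) (auto simp: has_bochner_integral_iff)
  show "AE \<tau> in levy. norm (min 1 (\<tau>\<^sup>2)) \<le> norm (\<tau>\<^sup>2 * indicator {0<..<1} \<tau> + indicator {1..} \<tau> :: real)"
    using AE_levy_pos
  proof eventually_elim
    case (elim \<tau>)
    then show ?case
      by (cases "\<tau> < 1") (auto simp: indicator_def abs_if min_def power2_eq_square mult_le_one)
  qed
qed measurable



lemma integrable_levy_bound:
  assumes [measurable]: "g \<in> borel_measurable borel" and B: "\<And>\<tau>. 0 < \<tau> \<Longrightarrow> \<bar>g \<tau>\<bar> \<le> B * min 1 (\<tau>\<^sup>2)"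
  shows "integrable levy g"
proof (rule Bochner_Integration.integrable_bound)
  show "integrable levy (\<lambda>\<tau>. B * min 1 (\<tau>\<^sup>2))" using integrable_levy_min by simp
  show "AE \<tau> in levy. norm (g \<tau>) \<le> norm (B * min 1 (\<tau>\<^sup>2))"
    using AE_levy_pos by eventually_elim (use B in force)
qed measurable

lemma integral_levy_mono:
  fixes f g :: "real \<Rightarrow> real"
  assumes "integrable levy f" "integrable levy g" "\<And>\<tau>. 0 < \<tau> \<Longrightarrow> f \<tau> \<le> g \<tau>"
  shows "integral\<^sup>L levy f \<le> integral\<^sup>L levy g"
proof (rule integral_mono_AE)
  show "AE \<tau> in levy. f \<tau> \<le> g \<tau>"
    using AE_levy_pos by eventually_elim (use assms(3) in auto)
qed (use assms in auto)

text \<open>The one-sided dominated convergence rests on \<open>max (f j) g \<longlonglongrightarrow> g\<close>.\<close>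

lemma integral_levy_limsup:
  fixes f :: "nat \<Rightarrow> real \<Rightarrow> real"
  assumes [measurable]: "\<And>j. f j \<in> borel_measurable borel" "g \<in> borel_measurable borel"
    and f: "\<And>j \<tau>. 0 < \<tau> \<Longrightarrow> \<bar>f j \<tau>\<bar> \<le> B * min 1 (\<tau>\<^sup>2)"
    and g: "\<And>\<tau>. 0 < \<tau> \<Longrightarrow> \<bar>g \<tau>\<bar> \<le> B * min 1 (\<tau>\<^sup>2)"
    and lim: "\<And>\<tau> e. 0 < \<tau> \<Longrightarrow> 0 < e \<Longrightarrow> \<forall>\<^sub>F j in sequentially. f j \<tau> \<le> g \<tau> + e"
    and e: "0 < e"
  shows "\<forall>\<^sub>F j in sequentially. integral\<^sup>L levy (f j) \<le> integral\<^sup>L levy g + e"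
proof -
  have int_f: "integrable levy (f j)" for j by (rule integrable_levy_bound[OF _ f]) auto
  have int_m: "integrable levy (\<lambda>\<tau>. max (f j \<tau>) (g \<tau>))" for j
    by (rule integrable_levy_bound[where B = B]) (use f g in \<open>auto simp: max_def\<close>)
  have "(\<lambda>j. integral\<^sup>L levy (\<lambda>\<tau>. max (f j \<tau>) (g \<tau>))) \<longlonglongrightarrow> integral\<^sup>L levy g"
  proof (rule integral_dominated_convergence)
    show "integrable levy (\<lambda>\<tau>. B * min 1 (\<tau>\<^sup>2))" using integrable_levy_min by simp
    show "AE \<tau> in levy. norm (max (f j \<tau>) (g \<tau>)) \<le> B * min 1 (\<tau>\<^sup>2)" for j
      using AE_levy_pos by eventually_elim (use f g in \<open>auto simp: max_def\<close>)
    show "AE \<tau> in levy. (\<lambda>j. max (f j \<tau>) (g \<tau>)) \<longlonglongrightarrow> g \<tau>"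
      using AE_levy_pos
    proof eventually_elim
      case (elim \<tau>)
      show ?case
      proof (rule LIMSEQ_I)
        fix r :: real assume r: "0 < r"
        from lim[OF elim half_gt_zero[OF r]] obtain N where "\<And>j. j \<ge> N \<Longrightarrow> f j \<tau> \<le> g \<tau> + r / 2"
          by (auto simp: eventually_sequentially)
        then show "\<exists>N. \<forall>j\<ge>N. norm (max (f j \<tau>) (g \<tau>) - g \<tau>) < r"
          using r by (intro exI[of _ N]) (fastforce simp: max_def)
      qed
    qed
  qed measurable
  from order_tendstoD(2)[OF this, of "integral\<^sup>L levy g + e"] e
  have "\<forall>\<^sub>F j in sequentially. integral\<^sup>L levy (\<lambda>\<tau>. max (f j \<tau>) (g \<tau>)) < integral\<^sup>L levy g + e" by simp
  then show ?thesis
  proof eventually_elim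
    case (elim j)
    have "integral\<^sup>L levy (f j) \<le> integral\<^sup>L levy (\<lambda>\<tau>. max (f j \<tau>) (g \<tau>))"
      by (rule integral_levy_mono[OF int_f int_m]) auto
    with elim show ?case by simp
  qed
qed

lemma ext_integral_mono:
  assumes "\<And>\<tau>. \<tau> \<in> A \<Longrightarrow> f \<tau> \<le> g \<tau>"
  shows "ext_integral A f \<le> ext_integral A g"
  unfolding ext_integral_def
proof (rule ereal_minus_mono)
  show "enn2ereal (\<integral>\<^sup>+\<tau>\<in>A. ennreal (f \<tau>) \<partial>lborel) \<le> enn2ereal (\<integral>\<^sup>+\<tau>\<in>A. ennreal (g \<tau>) \<partial>lborel)"
    by (simp flip: less_eq_ennreal.rep_eq, rule nn_integral_mono)
      (use assms in \<open>auto simp: indicator_def intro!: ennreal_leI\<close>)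
  show "enn2ereal (\<integral>\<^sup>+\<tau>\<in>A. ennreal (- g \<tau>) \<partial>lborel) \<le> enn2ereal (\<integral>\<^sup>+\<tau>\<in>A. ennreal (- f \<tau>) \<partial>lborel)"
    by (simp flip: less_eq_ennreal.rep_eq, rule nn_integral_mono)
      (use assms in \<open>auto simp: indicator_def intro!: ennreal_leI\<close>)
qed

text \<open>The bridge from the extended integrals of the viscosity definitions to Bochner
  integrals: integrability of \<open>g\<close> makes the positive and the negative part finite, so
  no infinite case is left.\<close>

lemma ext_integral_levy:
  assumes A [measurable]: "A \<in> sets borel" and A0: "A \<subseteq> {0<..}" and g: "integrable levy g"
  shows "ext_integral A (\<lambda>\<tau>. g \<tau> / \<tau> powr (1 + 2 * s)) = ereal (integral\<^sup>L levy (\<lambda>\<tau>. g \<tau> * indicator A \<tau>))"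
proof -
  have [measurable]: "g \<in> borel_measurable borel"
    using borel_measurable_integrable[OF g] by simp
  have int: "integrable levy (\<lambda>\<tau>. g \<tau> * indicator A \<tau>)"
    using integrable_mult_indicator[of A levy g] g by (simp add: mult.commute)
  have nn: "(\<integral>\<^sup>+\<tau>\<in>A. ennreal (f \<tau> / \<tau> powr (1 + 2 * s)) \<partial>lborel) =
      (\<integral>\<^sup>+\<tau>. ennreal (f \<tau> * indicator A \<tau>) \<partial>levy)"
    if [measurable]: "f \<in> borel_measurable borel" for f
  proof -
    have "(\<integral>\<^sup>+\<tau>. ennreal (f \<tau> * indicator A \<tau>) \<partial>levy) =
      (\<integral>\<^sup>+\<tau>. ennreal (\<tau> powr (- (1 + 2 * s))) * ennreal (f \<tau> * indicator A \<tau>) * indicator {0<..} \<tau> \<partial>lborel)"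
      by (rule nn_integral_levy) measurable
    also have "\<dots> = (\<integral>\<^sup>+\<tau>\<in>A. ennreal (f \<tau> / \<tau> powr (1 + 2 * s)) \<partial>lborel)"
      using A0 by (intro nn_integral_cong)
        (auto simp: indicator_def powr_minus divide_inverse mult.commute
          simp del: minus_add_distrib simp flip: ennreal_mult' ennreal_mult'')
    finally show ?thesis by simp
  qed
  define a b where "a = (\<integral>\<^sup>+\<tau>. ennreal (g \<tau> * indicator A \<tau>) \<partial>levy)"
    and "b = (\<integral>\<^sup>+\<tau>. ennreal (- g \<tau> * indicator A \<tau>) \<partial>levy)"
  have "a \<noteq> \<infinity>" "b \<noteq> \<infinity>"
    using real_integrable_def[THEN iffD1, OF int] by (auto simp: a_def b_def)
  then obtain a' b' where ab: "a = ennreal a'" "0 \<le> a'" "b = ennreal b'" "0 \<le> b'"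
    by (cases a; cases b) auto
  have "ext_integral A (\<lambda>\<tau>. g \<tau> / \<tau> powr (1 + 2 * s)) = enn2ereal a - enn2ereal b"
    unfolding ext_integral_def a_def b_def using nn[of g] nn[of "\<lambda>\<tau>. - g \<tau>"] by simp
  moreover have "integral\<^sup>L levy (\<lambda>\<tau>. g \<tau> * indicator A \<tau>) = enn2real a - enn2real b"
    unfolding real_lebesgue_integral_def[OF int] a_def b_def by simp
  ultimately show ?thesis using ab by (simp add: enn2ereal_ennreal)
qed

end

section \<open>Orthonormal frames\<close>

lemma frac_const_pos: "0 < s \<Longrightarrow> s < 1 \<Longrightarrow> 0 < frac_const s"
  unfolding frac_const_def by (intro divide_pos_pos mult_pos_pos Gamma_real_pos) auto

text \<open>An indexed form of orthonormal sets, so that limits can be taken vector by vector.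
  Values at indices \<open>k\<close> and above are arbitrary.\<close>

definition frame :: "nat \<Rightarrow> (nat \<Rightarrow> 'a::euclidean_space) \<Rightarrow> bool" where
  "frame k e \<longleftrightarrow> (\<forall>i<k. norm (e i) = 1) \<and> (\<forall>i<k. \<forall>j<k. i \<noteq> j \<longrightarrow> e i \<bullet> e j = 0)"

lemma frame_inj_on: "frame k e \<Longrightarrow> inj_on e {..<k}"
  by (rule inj_onI) (metis frame_def inner_eq_zero_iff lessThan_iff norm_zero zero_neq_one)

lemma frame_image: "frame k e \<Longrightarrow> e ` {..<k} \<in> orthonormal_sets k"
  using frame_inj_on[of k e]
  by (auto simp: orthonormal_sets_def card_image frame_def pairwise_def orthogonal_def)

lemma orthonormal_sets_frame:
  assumes "V \<in> orthonormal_sets k"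
  obtains e where "frame k e" "V = e ` {..<k}"
proof -
  have V: "finite V" "card V = k" "\<And>\<xi>. \<xi> \<in> V \<Longrightarrow> norm \<xi> = 1" "pairwise orthogonal V"
    using assms by (auto simp: orthonormal_sets_def)
  obtain e where e: "bij_betw e {..<k} V"
    using ex_bij_betw_nat_finite[OF V(1)] V(2) by (auto simp: atLeast0LessThan)
  then have "e i \<in> V" if "i < k" for i using that by (auto dest: bij_betwE)
  moreover have "e i \<noteq> e j" if "i < k" "j < k" "i \<noteq> j" for i j
    using e that by (auto simp: bij_betw_def inj_on_def)
  ultimately have "frame k e"
    using V(3,4) by (auto simp: frame_def pairwise_def orthogonal_def)
  with e show ?thesis by (intro that[of e]) (auto simp: bij_betw_def)
qed

lemma sum_frame: "frame k e \<Longrightarrow> (\<Sum>\<xi>\<in>e ` {..<k}. f \<xi>) = (\<Sum>i<k. f (e i))"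
  by (rule sum.reindex_cong[OF frame_inj_on]) auto

lemma SUP_orthonormal_sets:
  "(SUP V\<in>orthonormal_sets k. \<Sum>\<xi>\<in>V. f \<xi>) = (SUP e\<in>Collect (frame k). \<Sum>i<k. f (e i) :: ereal)"
  by (rule antisym)
    (auto intro!: SUP_least elim!: orthonormal_sets_frame simp: sum_frame
      intro: SUP_upper2[of _ "Collect (frame k)"] SUP_upper2[OF frame_image])

lemma INF_orthonormal_sets:
  "(INF V\<in>orthonormal_sets k. \<Sum>\<xi>\<in>V. f \<xi>) = (INF e\<in>Collect (frame k). \<Sum>i<k. f (e i) :: ereal)"
  by (rule antisym)
    (auto intro!: INF_greatest elim!: orthonormal_sets_frame simp: sum_frame
      intro: INF_lower2[of _ "Collect (frame k)"] INF_lower2[OF frame_image])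

lemma frame_subset:
  assumes "finite S" "k \<le> card S" "\<And>\<xi>. \<xi> \<in> S \<Longrightarrow> norm \<xi> = 1" "pairwise orthogonal S"
  obtains e where "frame k e" "e ` {..<k} \<subseteq> S"
proof -
  obtain V where V: "V \<subseteq> S" "card V = k" using assms(2) by (meson obtain_subset_with_card_n)
  then have "V \<in> orthonormal_sets k"
    using assms finite_subset[OF V(1)] by (auto simp: orthonormal_sets_def intro: pairwise_mono)
  then show ?thesis using V(1) that by (metis orthonormal_sets_frame)
qed

text \<open>Supplies a competitor in the supremum of \<open>I\<^sub>k\<^sup>+\<close> that contains
  a prescribed direction, later the radial direction of a bump.\<close>

lemma frame_containing:
  fixes a :: "'a::euclidean_space"
  assumes "norm a = 1" "1 \<le> k" "k \<le> DIM('a)"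
  obtains e i where "frame k e" "i < k" "e i = a"
proof -
  obtain S where S: "a \<in> S" "pairwise orthogonal S" "\<And>x. x \<in> S \<Longrightarrow> norm x = 1"
      "independent S" "card S = DIM('a)"
    using vector_in_orthonormal_basis[OF assms(1)] by metis
  have fin: "finite S" using S(4) by (rule independent_imp_finite)
  have "k - 1 \<le> card (S - {a})" using S fin assms by simp
  then obtain V where V: "V \<subseteq> S - {a}" "card V = k - 1" by (meson obtain_subset_with_card_n)
  have "insert a V \<in> orthonormal_sets k"
    using S V assms finite_subset[OF V(1)] fin
    by (auto simp: orthonormal_sets_def card_insert_if pairwise_def subset_iff)
  then obtain e where "frame k e" "insert a V = e ` {..<k}" by (rule orthonormal_sets_frame)
  then show ?thesis using that by (metis image_iff insertI1 lessThan_iff)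
qed

text \<open>One vector of an orthonormal basis is spent on the direction of \<open>x\<close>, which
  leaves \<open>DIM('a) - 1 \<ge> k\<close> others. The restriction on \<open>k\<close> for
  \<open>I\<^sub>k\<^sup>-\<close> enters here.\<close>

lemma frame_orthogonal:
  fixes x :: "'a::euclidean_space"
  assumes "k < DIM('a)"
  obtains e where "frame k e" "\<And>i. i < k \<Longrightarrow> e i \<bullet> x = 0"
proof -
  obtain a :: 'a and c where a: "norm a = 1" "x = c *\<^sub>R a"
  proof (cases "x = 0")
    case True
    obtain b :: 'a where "b \<in> Basis" using nonempty_Basis by blast
    with True show ?thesis by (intro that[of b 0]) auto
  next
    case False
    then show ?thesis by (intro that[of "x /\<^sub>R norm x" "norm x"]) auto
  qed
  obtain S where S: "a \<in> S" "pairwise orthogonal S" "\<And>x. x \<in> S \<Longrightarrow> norm x = 1"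
      "independent S" "card S = DIM('a)"
    using vector_in_orthonormal_basis[OF a(1)] by metis
  have fin: "finite S" using S(4) by (rule independent_imp_finite)
  obtain e where e: "frame k e" "e ` {..<k} \<subseteq> S - {a}"
    by (rule frame_subset[of "S - {a}" k])
      (use S fin assms in \<open>auto intro: pairwise_mono\<close>)
  show ?thesis
  proof (rule that[OF e(1)])
    fix i assume "i < k"
    then have "e i \<in> S" "e i \<noteq> a" using e(2) by auto
    then have "e i \<bullet> a = 0" using S(1,2) by (auto simp: pairwise_def orthogonal_def)
    then show "e i \<bullet> x = 0" using a by simp
  qed
qed

lemma frame_exists: "k \<le> DIM('a::euclidean_space) \<Longrightarrow> \<exists>e :: nat \<Rightarrow> 'a. frame k e"
  by (rule frame_subset[of "Basis :: 'a set" k])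
    (auto simp: pairwise_def orthogonal_def inner_Basis)

text \<open>Compactness of the unit sphere, applied to one vector after another with nested
  subsequences. Orthogonality passes to the limit separately, in \<open>frame_limit\<close>.\<close>

lemma frames_convergent_subseq:
  fixes E :: "nat \<Rightarrow> nat \<Rightarrow> 'a::euclidean_space"
  assumes "\<And>j i. i < k \<Longrightarrow> norm (E j i) = 1"
  shows "\<exists>r e. strict_mono (r :: nat \<Rightarrow> nat) \<and> (\<forall>i<k. (\<lambda>j. E (r j) i) \<longlonglongrightarrow> e i)"
  using assms
proof (induction k)
  case 0
  show ?case by (intro exI[of _ id]) (auto simp: strict_mono_def)
next
  case (Suc k)
  then obtain r e where r: "strict_mono (r :: nat \<Rightarrow> nat)" "\<forall>i<k. (\<lambda>j. E (r j) i) \<longlonglongrightarrow> e i" by force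
  have "\<forall>j. E (r j) k \<in> sphere 0 1" using Suc.prems[of k] by simp
  then obtain l q where q: "strict_mono (q :: nat \<Rightarrow> nat)" "((\<lambda>j. E (r j) k) \<circ> q) \<longlonglongrightarrow> l"
    using compact_sphere[of "0 :: 'a" 1] unfolding compact_def by metis
  show ?case
  proof (intro exI conjI allI impI)
    show "strict_mono (r \<circ> q)" using r(1) q(1) by (rule strict_mono_o)
    fix i assume "i < Suc k"
    show "(\<lambda>j. E ((r \<circ> q) j) i) \<longlonglongrightarrow> (e(k := l)) i"
    proof (cases "i = k")
      case False
      with \<open>i < Suc k\<close> have "(\<lambda>j. E (r j) i) \<longlonglongrightarrow> e i" using r(2) by simp
      from LIMSEQ_subseq_LIMSEQ[OF this q(1)] False show ?thesis by (simp add: o_def)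
    qed (use q(2) in \<open>simp add: o_def\<close>)
  qed
qed

lemma frame_limit:
  assumes "\<And>j. frame k (E j)" "\<And>i. i < k \<Longrightarrow> (\<lambda>j. E j i) \<longlonglongrightarrow> e i"
  shows "frame k e"
  unfolding frame_def
proof (intro conjI allI impI)
  fix i assume i: "i < k"
  have "(\<lambda>j. norm (E j i)) \<longlonglongrightarrow> norm (e i)" by (intro tendsto_norm assms(2) i)
  then show "norm (e i) = 1" using assms(1) i by (simp add: frame_def LIMSEQ_const_iff)
  fix l assume l: "l < k" "i \<noteq> l"
  have "(\<lambda>j. E j i \<bullet> E j l) \<longlonglongrightarrow> e i \<bullet> e l" by (intro tendsto_inner assms(2) i l)
  then show "e i \<bullet> e l = 0" using assms(1) i l by (simp add: frame_def LIMSEQ_const_iff)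
qed

section \<open>Viscosity inequalities reduced to finite bounds in each direction\<close>

context fractional_order
begin

abbreviation C :: real where "C \<equiv> frac_const s"

lemma C_pos: "0 < C"
  using frac_const_pos s_pos s_less_1 .

lemma ext_integral_add_levy:
  assumes h: "integrable levy h" and "0 < \<rho>"
  shows "ext_integral {0<..<\<rho>} (\<lambda>\<tau>. h \<tau> / \<tau> powr (1 + 2 * s)) + ext_integral {\<rho>..} (\<lambda>\<tau>. h \<tau> / \<tau> powr (1 + 2 * s))
    = ereal (integral\<^sup>L levy h)"
proof -
  have int: "integrable levy (\<lambda>\<tau>. h \<tau> * indicator A \<tau>)" if "A \<in> sets borel" for A
    using integrable_mult_indicator[of A levy h] h that by (simp add: mult.commute)
  have [measurable]: "h \<in> borel_measurable borel" using borel_measurable_integrable[OF h] by simp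
  have "integral\<^sup>L levy (\<lambda>\<tau>. h \<tau> * indicator {0<..<\<rho>} \<tau>) + integral\<^sup>L levy (\<lambda>\<tau>. h \<tau> * indicator {\<rho>..} \<tau>)
     = integral\<^sup>L levy (\<lambda>\<tau>. h \<tau> * indicator {0<..<\<rho>} \<tau> + h \<tau> * indicator {\<rho>..} \<tau>)"
    by (rule Bochner_Integration.integral_add[symmetric]) (auto intro!: int)
  also have "\<dots> = integral\<^sup>L levy h"
  proof (rule integral_cong_AE)
    show "AE \<tau> in levy. h \<tau> * indicator {0<..<\<rho>} \<tau> + h \<tau> * indicator {\<rho>..} \<tau> = h \<tau>"
      using AE_levy_pos by eventually_elim (auto simp: indicator_def)
  qed measurable
  finally show ?thesis
    using assms by (subst (1 2) ext_integral_levy) auto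
qed

text \<open>One integrable \<open>h\<close> below the test function inside the ball and below
  \<open>u\<close> outside replaces a sum of extended integrals by a finite number, even if the
  local term is infinite. Viscosity inequalities are verified and exploited through this lemma and
  its counterpart for upper bounds.\<close>

lemma visc_directional_ge:
  assumes "integrable levy h" "0 < \<rho>"
    and "\<And>\<tau>. 0 < \<tau> \<Longrightarrow> \<tau> < \<rho> \<Longrightarrow> h \<tau> \<le> second_diff \<phi> x (\<tau> *\<^sub>R \<xi>)"
    and "\<And>\<tau>. \<rho> \<le> \<tau> \<Longrightarrow> h \<tau> \<le> second_diff u x (\<tau> *\<^sub>R \<xi>)"
  shows "ereal (integral\<^sup>L levy h) \<le> visc_directional s \<rho> \<phi> u x \<xi>"
  unfolding visc_directional_def ext_integral_add_levy[OF assms(1,2), symmetric]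
  by (intro add_mono ext_integral_mono divide_right_mono) (use assms in auto)

lemma visc_directional_le:
  assumes "integrable levy h" "0 < \<rho>"
    and "\<And>\<tau>. 0 < \<tau> \<Longrightarrow> \<tau> < \<rho> \<Longrightarrow> second_diff \<phi> x (\<tau> *\<^sub>R \<xi>) \<le> h \<tau>"
    and "\<And>\<tau>. \<rho> \<le> \<tau> \<Longrightarrow> second_diff u x (\<tau> *\<^sub>R \<xi>) \<le> h \<tau>"
  shows "visc_directional s \<rho> \<phi> u x \<xi> \<le> ereal (integral\<^sup>L levy h)"
  unfolding visc_directional_def ext_integral_add_levy[OF assms(1,2), symmetric]
  by (intro add_mono ext_integral_mono divide_right_mono) (use assms in auto)

text \<open>Division by \<open>C > 0\<close>: with \<open>\<mu> = C * m\<close> the constant leaves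
  all later inequalities. Infinite \<open>S\<close> is included.\<close>

lemma scaled_ereal_sign:
  "0 \<le> ereal C * S + ereal (C * m * t) \<longleftrightarrow> ereal (- m * t) \<le> S"
  "ereal C * S + ereal (C * m * t) \<le> 0 \<longleftrightarrow> S \<le> ereal (- m * t)"
proof -
  have "0 \<le> C * r + C * m * t \<longleftrightarrow> - (m * t) \<le> r" "C * r + C * m * t \<le> 0 \<longleftrightarrow> r \<le> - (m * t)" for r
    using C_pos zero_le_mult_iff[of C "r + m * t"] mult_le_0_iff[of C "r + m * t"]
    by (auto simp: algebra_simps)
  then show "0 \<le> ereal C * S + ereal (C * m * t) \<longleftrightarrow> ereal (- m * t) \<le> S"
    "ereal C * S + ereal (C * m * t) \<le> 0 \<longleftrightarrow> S \<le> ereal (- m * t)"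
    using C_pos by (cases S; simp)+
qed

text \<open>The supremum may not be attained; hence a separate frame for each deficit
  \<open>\<eta>\<close>.\<close>

lemma I_plus_nonnegI:
  assumes "\<And>\<eta>. 0 < \<eta> \<Longrightarrow> \<exists>e a. frame k e \<and>
    (\<forall>i<k. ereal (a i) \<le> visc_directional s \<rho> \<phi> u x (e i)) \<and> - \<eta> \<le> (\<Sum>i<k. a i) + m * u x"
  shows "0 \<le> I_plus s k (C * m) \<rho> \<phi> u x"
  unfolding I_plus_def scaled_ereal_sign SUP_orthonormal_sets
proof (rule ereal_le_epsilon2)
  fix \<eta> :: real assume "0 < \<eta>"
  from assms[OF this] obtain e a where ea: "frame k e"
    "\<forall>i<k. ereal (a i) \<le> visc_directional s \<rho> \<phi> u x (e i)" "- \<eta> \<le> (\<Sum>i<k. a i) + m * u x" by blast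
  have "ereal (\<Sum>i<k. a i) \<le> (\<Sum>i<k. visc_directional s \<rho> \<phi> u x (e i))"
    unfolding sum_ereal[symmetric] by (rule sum_mono) (use ea in auto)
  also have "\<dots> \<le> (SUP e\<in>Collect (frame k). \<Sum>i<k. visc_directional s \<rho> \<phi> u x (e i))"
    by (rule SUP_upper) (use ea in auto)
  finally have "ereal (\<Sum>i<k. a i) + ereal \<eta> \<le> \<dots> + ereal \<eta>" by (rule add_right_mono)
  moreover have "ereal (- m * u x) \<le> ereal (\<Sum>i<k. a i) + ereal \<eta>" using ea(3) by simp
  ultimately show "ereal (- m * u x)
    \<le> (SUP e\<in>Collect (frame k). \<Sum>i<k. visc_directional s \<rho> \<phi> u x (e i)) + ereal \<eta>" by (rule order_trans[rotated])
qed

lemma I_plus_nonposI: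
  assumes "\<And>e. frame k e \<Longrightarrow> \<exists>a.
    (\<forall>i<k. visc_directional s \<rho> \<phi> u x (e i) \<le> ereal (a i)) \<and> (\<Sum>i<k. a i) + m * u x \<le> 0"
  shows "I_plus s k (C * m) \<rho> \<phi> u x \<le> 0"
  unfolding I_plus_def scaled_ereal_sign SUP_orthonormal_sets
proof (rule SUP_least)
  fix e :: "nat \<Rightarrow> 'a" assume "e \<in> Collect (frame k)"
  with assms obtain a where a: "\<forall>i<k. visc_directional s \<rho> \<phi> u x (e i) \<le> ereal (a i)"
    "(\<Sum>i<k. a i) + m * u x \<le> 0" by blast
  have "(\<Sum>i<k. visc_directional s \<rho> \<phi> u x (e i)) \<le> ereal (\<Sum>i<k. a i)"
    unfolding sum_ereal[symmetric] by (rule sum_mono) (use a in auto)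
  also have "\<dots> \<le> ereal (- m * u x)" using a(2) by simp
  finally show "(\<Sum>i<k. visc_directional s \<rho> \<phi> u x (e i)) \<le> ereal (- m * u x)" .
qed

lemma I_plus_nonnegD:
  assumes I: "0 \<le> I_plus s k (C * m) \<rho> \<phi> u x"
    and A: "\<And>\<xi>. norm \<xi> = 1 \<Longrightarrow> visc_directional s \<rho> \<phi> u x \<xi> \<le> ereal (A \<xi>)" and \<eta>: "0 < \<eta>"
  shows "\<exists>e. frame k e \<and> - \<eta> \<le> (\<Sum>i<k. A (e i)) + m * u x"
proof -
  have "ereal (- m * u x - \<eta>) < ereal (- m * u x)" using \<eta> by simp
  also have "\<dots> \<le> (SUP e\<in>Collect (frame k). \<Sum>i<k. visc_directional s \<rho> \<phi> u x (e i))"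
    using I unfolding I_plus_def scaled_ereal_sign SUP_orthonormal_sets .
  finally obtain e where e: "frame k e" "ereal (- m * u x - \<eta>) < (\<Sum>i<k. visc_directional s \<rho> \<phi> u x (e i))"
    unfolding less_SUP_iff by auto
  note e(2)
  also have "(\<Sum>i<k. visc_directional s \<rho> \<phi> u x (e i)) \<le> ereal (\<Sum>i<k. A (e i))"
    unfolding sum_ereal[symmetric] by (rule sum_mono) (use e(1) A in \<open>auto simp: frame_def\<close>)
  finally show ?thesis using e(1) by (intro exI[of _ e]) auto
qed

lemma I_plus_nonposD:
  assumes I: "I_plus s k (C * m) \<rho> \<phi> u x \<le> 0"
    and A: "\<And>\<xi>. norm \<xi> = 1 \<Longrightarrow> ereal (A \<xi>) \<le> visc_directional s \<rho> \<phi> u x \<xi>" and e: "frame k e"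
  shows "(\<Sum>i<k. A (e i)) + m * u x \<le> 0"
proof -
  have "ereal (\<Sum>i<k. A (e i)) \<le> (\<Sum>i<k. visc_directional s \<rho> \<phi> u x (e i))"
    unfolding sum_ereal[symmetric] by (rule sum_mono) (use e A in \<open>auto simp: frame_def\<close>)
  also have "\<dots> \<le> (SUP e\<in>Collect (frame k). \<Sum>i<k. visc_directional s \<rho> \<phi> u x (e i))"
    by (rule SUP_upper) (use e in auto)
  also have "\<dots> \<le> ereal (- m * u x)"
    using I unfolding I_plus_def scaled_ereal_sign SUP_orthonormal_sets .
  finally show ?thesis by simp
qed

lemma I_minus_nonnegD:
  assumes I: "0 \<le> I_minus s k (C * m) \<rho> \<phi> u x"
    and A: "\<And>i. i < k \<Longrightarrow> visc_directional s \<rho> \<phi> u x (e i) \<le> ereal (a i)" and e: "frame k e"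
  shows "0 \<le> (\<Sum>i<k. a i) + m * u x"
proof -
  have "ereal (- m * u x) \<le> (INF e\<in>Collect (frame k). \<Sum>i<k. visc_directional s \<rho> \<phi> u x (e i))"
    using I unfolding I_minus_def scaled_ereal_sign INF_orthonormal_sets .
  also have "\<dots> \<le> (\<Sum>i<k. visc_directional s \<rho> \<phi> u x (e i))"
    by (rule INF_lower) (use e in auto)
  also have "\<dots> \<le> ereal (\<Sum>i<k. a i)"
    unfolding sum_ereal[symmetric] by (rule sum_mono) (use A in auto)
  finally show ?thesis by simp
qed

end

section \<open>The barrier\<close>

text \<open>Both powers lie below the tangent to \<open>t powr p\<close> at \<open>c\<close>, which
  is Young's inequality with weights \<open>p\<close> and \<open>1 - p\<close>; the condition on the
  mean makes the linear terms add up to something nonpositive.\<close>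

lemma sum_powr_le_of_mean_le:
  fixes a b c p :: real
  assumes "0 < a" "0 < b" "0 < c" "a + b \<le> 2 * c" "0 < p" "p < 1"
  shows "a powr p + b powr p \<le> 2 * c powr p"
proof -
  have *: "x powr p \<le> c powr p * (1 + p * (x / c - 1))" if "0 < x" for x
  proof -
    have "(x / c) powr p * 1 powr (1 - p) \<le> p * (x / c) + (1 - p) * 1"
      using assms that by (intro Youngs_inequality_0) auto
    then have "c powr p * (x / c) powr p \<le> c powr p * (p * (x / c) + (1 - p))"
      by (intro mult_left_mono) auto
    then show ?thesis using assms that by (simp add: powr_divide algebra_simps)
  qed
  have "a powr p + b powr p \<le> c powr p * (1 + p * (a / c - 1)) + c powr p * (1 + p * (b / c - 1))"
    using *[of a] *[of b] assms by simp
  also have "\<dots> = c powr p * (2 + p * ((a + b) / c - 2))" by (simp add: algebra_simps add_divide_distrib)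
  also have "\<dots> \<le> c powr p * 2"
    using assms by (intro mult_left_mono) (auto simp: mult_le_0_iff divide_le_eq)
  finally show ?thesis by simp
qed

lemma abs_le_min_square:
  fixes a b h \<tau> :: real
  assumes "0 < h" "h \<le> \<tau>" "\<bar>a\<bar> \<le> b"
  shows "\<bar>a\<bar> \<le> b / min 1 (h\<^sup>2) * min 1 (\<tau>\<^sup>2)"
proof -
  have "h\<^sup>2 \<le> \<tau>\<^sup>2" using assms by (intro power_mono) auto
  then have "min 1 (h\<^sup>2) \<le> min 1 (\<tau>\<^sup>2)" by (rule min.mono[OF order_refl])
  moreover have "0 < min 1 (h\<^sup>2)" using assms(1) by simp
  ultimately have "1 \<le> min 1 (\<tau>\<^sup>2) / min 1 (h\<^sup>2)" by (simp add: le_divide_eq)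
  then have "\<bar>a\<bar> * 1 \<le> b * (min 1 (\<tau>\<^sup>2) / min 1 (h\<^sup>2))" using assms(3) by (intro mult_mono) auto
  then show ?thesis by simp
qed

lemma parallelogram: "(norm (w + v))\<^sup>2 + (norm (w - v))\<^sup>2 = 2 * (norm w)\<^sup>2 + 2 * (norm v)\<^sup>2"
  for w v :: "'a::real_inner"
  unfolding power2_norm_eq_inner inner_add_left inner_add_right inner_diff_left inner_diff_right by simp

lemma powr_split: "(a * (2 * t / e)) powr p = a powr p * (2 powr p * e powr (- p)) * t powr p" for a t e p :: real
  unfolding powr_minus divide_inverse powr_mult inverse_powr by (simp only: mult_ac)

lemma L_inftyE:
  assumes "L_infty f" obtains B where "0 < B" "\<And>x. \<bar>f x\<bar> \<le> B"
  using assms unfolding L_infty_def bounded_pos by auto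

lemma L_inftyI:
  assumes "f \<in> borel_measurable borel" "\<And>x. \<bar>f x\<bar> \<le> B" shows "L_infty f"
  unfolding L_infty_def bounded_iff using assms by auto

lemma L_infty_cmult:
  assumes "L_infty f" shows "L_infty (\<lambda>x. c * f x)"
proof -
  have [measurable]: "f \<in> borel_measurable borel" using assms by (simp add: L_infty_def)
  obtain B where "\<And>x. \<bar>f x\<bar> \<le> B" using L_inftyE[OF assms] by metis
  then show ?thesis by (intro L_inftyI[of _ "\<bar>c\<bar> * B"]) (auto simp: abs_mult mult_left_mono)
qed

lemma second_diff_measurable [measurable]:
  fixes f :: "'a::euclidean_space \<Rightarrow> real"
  assumes [measurable]: "f \<in> borel_measurable borel"
  shows "(\<lambda>\<tau>. second_diff f x (\<tau> *\<^sub>R \<xi>)) \<in> borel_measurable borel"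
  unfolding second_diff_def by measurable

context fractional_order
begin

text \<open>The directional operator with jumps shorter than \<open>h\<close> removed and without
  the factor \<open>C\<close>. No singularity is left, so it is meaningful at every point for every
  bounded Borel function.\<close>

definition far :: "real \<Rightarrow> ('a::euclidean_space \<Rightarrow> real) \<Rightarrow> 'a \<Rightarrow> 'a \<Rightarrow> real" where
  "far h f x \<xi> = (\<integral>\<tau>. indicator {h..} \<tau> * second_diff f x (\<tau> *\<^sub>R \<xi>) \<partial>levy)"

text \<open>The mass that \<open>levy\<close> gives to \<open>{h..}\<close>; it grows without bound
  as \<open>h\<close> tends to 0.\<close>

definition tail :: "real \<Rightarrow> real" where
  "tail h = h powr (- 2 * s) / (2 * s)"

lemma tail_pos: "0 < h \<Longrightarrow> 0 < tail h"
  using s_pos by (simp add: tail_def)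

lemma tail_surj:
  assumes "0 < b" obtains h where "0 < h" "tail h = b"
proof -
  define X where "X = 2 * s * b"
  have X: "0 < X" using s_pos assms by (simp add: X_def)
  show ?thesis
  proof (rule that[of "X powr (- 1 / (2 * s))"])
    show "0 < X powr (- 1 / (2 * s))" using X by simp
    show "tail (X powr (- 1 / (2 * s))) = b" using s_pos X by (simp add: tail_def powr_powr) (simp add: X_def)
  qed
qed

lemma tail_antimono: "0 < h \<Longrightarrow> h \<le> h' \<Longrightarrow> tail h' \<le> tail h"
  unfolding tail_def using s_pos by (intro divide_right_mono powr_mono2') auto

lemma integrable_tail: "0 < h \<Longrightarrow> integrable levy (indicator {h..} :: real \<Rightarrow> real)"
  and integral_tail: "0 < h \<Longrightarrow> integral\<^sup>L levy (indicator {h..}) = tail h"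
  using has_bochner_integral_levy_tail[of h] by (auto simp: has_bochner_integral_iff tail_def)

lemma far_bound:
  assumes "0 < h" "0 < \<tau>" "\<And>x. \<bar>f x\<bar> \<le> B"
  shows "\<bar>indicator {h..} \<tau> * second_diff f x (\<tau> *\<^sub>R \<xi>)\<bar> \<le> 4 * B / min 1 (h\<^sup>2) * min 1 (\<tau>\<^sup>2)"
proof (cases "h \<le> \<tau>")
  case True
  have "\<bar>second_diff f x (\<tau> *\<^sub>R \<xi>)\<bar> \<le> 4 * B"
    using assms(3)[of "x + \<tau> *\<^sub>R \<xi>"] assms(3)[of "x - \<tau> *\<^sub>R \<xi>"] assms(3)[of x]
    by (auto simp: second_diff_def)
  from abs_le_min_square[OF assms(1) True this] True show ?thesis by simp
next
  case False
  moreover have "0 \<le> B" using assms(3)[of 0] by linarith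
  ultimately show ?thesis by simp
qed

lemma integrable_far:
  assumes "L_infty f" "0 < h"
  shows "integrable levy (\<lambda>\<tau>. indicator {h..} \<tau> * second_diff f x (\<tau> *\<^sub>R \<xi>))"
proof -
  have [measurable]: "f \<in> borel_measurable borel" using assms by (simp add: L_infty_def)
  obtain B where "\<And>x. \<bar>f x\<bar> \<le> B" using L_inftyE[OF assms(1)] by metis
  from far_bound[OF assms(2) _ this] show ?thesis by (intro integrable_levy_bound) measurable
qed

text \<open>An error \<open>c\<close> in the second differences is charged with the whole mass
  \<open>tail h\<close>. Near maxima must therefore be taken with errors small compared to
  \<open>1 / tail h\<close>.\<close>

lemma far_le:
  assumes "L_infty f" "L_infty g" "0 < h"
    and "\<And>\<tau>. h \<le> \<tau> \<Longrightarrow> second_diff f x (\<tau> *\<^sub>R \<xi>) \<le> second_diff g y (\<tau> *\<^sub>R \<xi>) + c"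
  shows "far h f x \<xi> \<le> far h g y \<xi> + c * tail h"
proof -
  have "far h f x \<xi> \<le> (\<integral>\<tau>. indicator {h..} \<tau> * second_diff g y (\<tau> *\<^sub>R \<xi>) + c * indicator {h..} \<tau> \<partial>levy)"
    unfolding far_def using assms
    by (intro integral_levy_mono integrable_far Bochner_Integration.integrable_add
        integrable_mult_right integrable_tail) (auto simp: indicator_def)
  also have "\<dots> = far h g y \<xi> + c * tail h"
    unfolding far_def using assms
    by (subst Bochner_Integration.integral_add)
      (auto intro!: integrable_far integrable_tail integrable_mult_right
        simp: integral_tail simp del: Bochner_Integration.integral_indicator)
  finally show ?thesis .
qed

lemma far_le_add:
  assumes "L_infty f" "L_infty g" "L_infty l" "0 < h"
    and "\<And>\<tau>. h \<le> \<tau> \<Longrightarrow> second_diff f x (\<tau> *\<^sub>R \<xi>)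
      \<le> second_diff g y (\<tau> *\<^sub>R \<xi>) + second_diff l z (\<tau> *\<^sub>R \<xi>)"
  shows "far h f x \<xi> \<le> far h g y \<xi> + far h l z \<xi>"
proof -
  have "far h f x \<xi> \<le> (\<integral>\<tau>. indicator {h..} \<tau> * second_diff g y (\<tau> *\<^sub>R \<xi>)
      + indicator {h..} \<tau> * second_diff l z (\<tau> *\<^sub>R \<xi>) \<partial>levy)"
    unfolding far_def using assms
    by (intro integral_levy_mono integrable_far Bochner_Integration.integrable_add) (auto simp: indicator_def)
  also have "\<dots> = far h g y \<xi> + far h l z \<xi>"
    unfolding far_def using assms by (intro Bochner_Integration.integral_add integrable_far)
  finally show ?thesis .
qed

lemma far_cmult: "far h (\<lambda>x. c * f x) x \<xi> = c * far h f x \<xi>"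
proof -
  have *: "indicator {h..} \<tau> * second_diff (\<lambda>x. c * f x) x (\<tau> *\<^sub>R \<xi>)
     = c * (indicator {h..} \<tau> * second_diff f x (\<tau> *\<^sub>R \<xi>))" for \<tau>
    by (simp add: second_diff_def algebra_simps)
  show ?thesis unfolding far_def * by simp
qed

lemma far_minus: "far h (\<lambda>x. - f x) x \<xi> = - far h f x \<xi>"
  using far_cmult[of h "-1" f x \<xi>] by simp

text \<open>This is \<open>2 / (2 * s) - 2 powr p / (2 * s - p)\<close> for
  \<open>p = s / 2\<close>: what the barrier loses beyond the exit time minus what the surviving
  endpoint can gain. The exponent \<open>s / 2\<close> is small enough to keep it positive, since
  \<open>2 powr (s / 2) < 3 / 2\<close>.\<close>

definition barrier_const :: real where
  "barrier_const = (1 - 2 / 3 * 2 powr (s / 2)) / s"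

lemma barrier_const_pos: "0 < barrier_const"
proof -
  have "2 powr (s / 2) \<le> 2 powr (1 / 2)" using s_less_1 by (intro powr_mono) auto
  also have "\<dots> = sqrt 2" by (simp add: powr_half_sqrt)
  also have "\<dots> < 3 / 2" by (rule real_less_lsqrt) (auto simp: power2_eq_square)
  finally show ?thesis using s_pos by (simp add: barrier_const_def)
qed

end

text \<open>What the proof keeps of the domain. \<open>d_strong\<close> is uniform convexity in
  quantitative form and bounds the exit time of every line. \<open>d_ge\<close> limits the decrease
  of \<open>d\<close> over a step from a point of \<open>\<Omega>\<close>, which tells how far the
  barrier has to be shifted for a given truncation length.\<close>

locale concave_level_domain = fractional_order +
  fixes \<Omega> :: "'a::euclidean_space set" and d :: "'a \<Rightarrow> real" and R :: real
  assumes \<Omega>_eq: "\<Omega> = {x. 0 < d x}" and bounded_\<Omega>: "bounded \<Omega>" and \<Omega>_nonempty: "\<Omega> \<noteq> {}"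
    and d_concave: "concave_on UNIV d"
    and d_strong: "\<And>x h. d (x + h) + d (x - h) \<le> 2 * d x - 2 * (norm h)\<^sup>2"
    and d_le: "\<And>x. d x \<le> R\<^sup>2" and R_pos: "0 < R"
    and d_ge: "\<And>x h. x \<in> \<Omega> \<Longrightarrow> d x - 2 * R * norm h - (norm h)\<^sup>2 \<le> d (x + h)"
begin

lemma continuous_d: "continuous_on UNIV d"
proof -
  have "continuous_on UNIV (\<lambda>x. - d x)"
    using d_concave by (intro convex_on_continuous) (auto simp: concave_on_def)
  from continuous_on_minus[OF this] show ?thesis by simp
qed

lemma tendsto_d: "Y \<longlonglongrightarrow> x \<Longrightarrow> (\<lambda>i. d (Y i)) \<longlonglongrightarrow> d x"
  by (rule isCont_tendsto_compose[rotated], assumption)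
    (use continuous_d in \<open>simp add: continuous_on_eq_continuous_at\<close>)

lemma open_\<Omega>: "open \<Omega>"
  unfolding \<Omega>_eq by (intro open_Collect_less continuous_d continuous_on_const)

text \<open>The shift \<open>r\<close> enlarges the superlevel set. With
  \<open>r = 2 * h * R + h\<^sup>2\<close> a jump of length \<open>h\<close> from any point of
  \<open>\<Omega>\<close> stays inside it, which makes the estimate for the truncated operator
  uniform up to the boundary; \<open>r = 0\<close> serves the comparison argument.\<close>

definition barrier :: "real \<Rightarrow> 'a \<Rightarrow> real" where
  "barrier r x = max 0 (d x + r) powr (s / 2)"

lemma barrier_nonneg: "0 \<le> barrier r x"
  by (simp add: barrier_def)

lemma barrier_outside: "d x + r \<le> 0 \<Longrightarrow> barrier r x = 0"
  by (simp add: barrier_def max_def)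

lemma barrier_le:
  assumes "r \<le> 1" shows "barrier r x \<le> (R\<^sup>2 + 1) powr (s / 2)"
  unfolding barrier_def using d_le[of x] assms s_pos by (intro powr_mono2) auto

lemma continuous_barrier: "continuous_on UNIV (barrier r)"
  unfolding barrier_def using s_pos
  by (intro continuous_on_powr' continuous_intros continuous_d) auto

lemma L_infty_barrier: "r \<le> 1 \<Longrightarrow> L_infty (barrier r)"
  using barrier_le[of r] barrier_nonneg[of r]
  by (intro L_inftyI[of _ "(R\<^sup>2 + 1) powr (s / 2)"] borel_measurable_continuous_onI continuous_barrier) auto

lemma d_line_concave:
  assumes "0 \<le> a" "0 \<le> b" "0 < a + b"
  shows "b * d (x - a *\<^sub>R \<xi>) + a * d (x + b *\<^sub>R \<xi>) \<le> (a + b) * d x"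
proof -
  have "d ((b / (a + b)) *\<^sub>R (x - a *\<^sub>R \<xi>) + (a / (a + b)) *\<^sub>R (x + b *\<^sub>R \<xi>))
      \<ge> b / (a + b) * d (x - a *\<^sub>R \<xi>) + a / (a + b) * d (x + b *\<^sub>R \<xi>)"
    using d_concave[unfolded concave_on_iff, THEN conjunct2, rule_format, of "x - a *\<^sub>R \<xi>" "x + b *\<^sub>R \<xi>"
        "b / (a + b)" "a / (a + b)"] assms
    by (simp add: add_divide_distrib[symmetric] add.commute)
  moreover have "(b / (a + b)) *\<^sub>R (x - a *\<^sub>R \<xi>) + (a / (a + b)) *\<^sub>R (x + b *\<^sub>R \<xi>)
     = (b / (a + b) + a / (a + b)) *\<^sub>R x"
    by (simp add: algebra_simps)
  moreover have "b / (a + b) + a / (a + b) = 1" using assms by (simp add: add_divide_distrib[symmetric] add.commute)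
  ultimately have "b / (a + b) * d (x - a *\<^sub>R \<xi>) + a / (a + b) * d (x + b *\<^sub>R \<xi>) \<le> d x" by simp
  then have "(b * d (x - a *\<^sub>R \<xi>) + a * d (x + b *\<^sub>R \<xi>)) / (a + b) \<le> d x"
    by (simp only: add_divide_distrib times_divide_eq_left)
  then show ?thesis using assms(3) by (simp only: pos_divide_le_eq mult.commute)
qed

text \<open>
  Beyond the exit time \<open>\<epsilon>\<close> of the line from the superlevel set one of the two endpoints contributes
  nothing and concavity bounds the other one by the factor \<open>(1 + \<tau> / \<epsilon>) powr (s / 2)\<close>; strong
  concavity yields \<open>\<epsilon> \<le> sqrt (d x + r)\<close>.
\<close>

lemma far_barrier:
  assumes \<xi>: "norm \<xi> = 1" and r: "r \<le> 1" and h: "0 < h" "2 * h * R + h\<^sup>2 < d x + r" and x: "x \<in> \<Omega>"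
  shows "far h (barrier r) x \<xi> \<le> - barrier_const * (d x + r) powr (- s / 2)"
proof -
  define g where "g t = d (x + t *\<^sub>R \<xi>) + r" for t
  have g0: "g 0 = d x + r" by (simp add: g_def)
  have "0 \<le> 2 * h * R + h\<^sup>2" using h(1) R_pos by simp
  then have g0: "g 0 = d x + r" "0 < g 0" using h(2) g0 by auto
  \<comment> \<open>Times at which both endpoints are still in the superlevel set; the supremum is
    the exit time.\<close>
  define E where "E = {t. 0 < g t \<and> 0 < g (- t)}"
  have g_line: "b * g (- a) + a * g b \<le> (a + b) * g 0" "b * g a + a * g (- b) \<le> (a + b) * g 0"
    if "0 \<le> a" "0 \<le> b" "0 < a + b" for a b
    using d_line_concave[OF that, of x \<xi>] d_line_concave[OF that, of x "- \<xi>"]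
    by (auto simp: g_def algebra_simps)
  have g_sum: "g t + g (- t) \<le> 2 * g 0 - 2 * t\<^sup>2" for t
    using d_strong[of x "t *\<^sub>R \<xi>"] \<xi> by (simp add: g_def)
  \<comment> \<open>Here the size restriction on \<open>h\<close> enters: the truncation acts before
    the exit time, so it drops only jumps for which the majorant below is 0.\<close>
  have "h \<in> E"
    using d_ge[OF x, of "h *\<^sub>R \<xi>"] d_ge[OF x, of "- h *\<^sub>R \<xi>"] h \<xi> by (auto simp: E_def g_def algebra_simps)
  have E_sq: "t\<^sup>2 < g 0" if "t \<in> E" for t using g_sum[of t] that by (auto simp: E_def)
  have E_le: "t \<le> sqrt (g 0)" if "t \<in> E" for t
    using E_sq[OF that] real_le_rsqrt[of t "g 0"] by simp
  have bdd: "bdd_above E" using E_le by (rule bdd_aboveI)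
  define \<epsilon> where "\<epsilon> = Sup E"
  have h\<epsilon>: "h \<le> \<epsilon>" unfolding \<epsilon>_def using \<open>h \<in> E\<close> bdd by (rule cSup_upper)
  then have \<epsilon>: "0 < \<epsilon>" using h by simp
  have \<epsilon>_le: "\<epsilon> \<le> sqrt (g 0)" unfolding \<epsilon>_def using \<open>h \<in> E\<close> E_le by (intro cSup_least) auto
  have cont_g: "continuous_on UNIV g"
    unfolding g_def by (intro continuous_intros continuous_on_compose2[OF continuous_d]) auto
  have "open E"
    unfolding E_def Collect_conj_eq
    by (intro open_Int open_Collect_less continuous_on_const cont_g continuous_on_compose2[OF cont_g] continuous_intros) auto
  have out: "\<tau> \<notin> E" if "\<epsilon> \<le> \<tau>" for \<tau>
  proof
    assume "\<tau> \<in> E"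
    with \<open>open E\<close> obtain e where e: "0 < e" "ball \<tau> e \<subseteq> E" by (auto simp: open_contains_ball)
    then have "\<tau> + e / 2 \<in> E" by (auto simp: dist_real_def)
    then have "\<tau> + e / 2 \<le> \<epsilon>" unfolding \<epsilon>_def using bdd by (rule cSup_upper)
    with e that show False by simp
  qed
  have inE: "\<tau> \<in> E" if "0 < \<tau>" and less: "\<tau> < \<epsilon>" for \<tau>
  proof -
    obtain t where t: "t \<in> E" "\<tau> < t"
      using less less_cSup_iff[of E \<tau>] \<open>h \<in> E\<close> bdd unfolding \<epsilon>_def by blast
    have "d (x + \<tau> *\<^sub>R \<eta>) + r > 0" if "d (x + t *\<^sub>R \<eta>) + r > 0" for \<eta>
    proof -
      have "t - \<tau> > 0" using t by simp
      have "\<tau> * d (x + \<tau> *\<^sub>R \<eta> - \<tau> *\<^sub>R \<eta> + t *\<^sub>R \<eta>) + (t - \<tau>) * d x \<le> t * d (x + \<tau> *\<^sub>R \<eta>)"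
        using d_line_concave[of \<tau> "t - \<tau>" "x + \<tau> *\<^sub>R \<eta>" \<eta>] t \<open>0 < \<tau>\<close> by (simp add: algebra_simps)
      then have "\<tau> * (d (x + t *\<^sub>R \<eta>) + r) + (t - \<tau>) * g 0 \<le> t * (d (x + \<tau> *\<^sub>R \<eta>) + r)"
        by (simp add: g0(1) algebra_simps)
      moreover have "0 < \<tau> * (d (x + t *\<^sub>R \<eta>) + r)" "0 < (t - \<tau>) * g 0" using that t \<open>0 < \<tau>\<close> g0 by auto
      ultimately have "0 < t * (d (x + \<tau> *\<^sub>R \<eta>) + r)" by linarith
      then show ?thesis using t \<open>0 < \<tau>\<close> by (simp add: zero_less_mult_iff)
    qed
    from this[of \<xi>] this[of "- \<xi>"] t(1) show ?thesis by (auto simp: E_def g_def)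
  qed
  \<comment> \<open>Concavity along the line from a surviving endpoint at distance \<open>t\<close>
    on the opposite side through \<open>x\<close> bounds \<open>g\<close> by
    \<open>g 0 * (1 + \<tau> / t)\<close>; then \<open>t\<close> tends to
    \<open>\<epsilon> = Sup E\<close>. Products replace quotients.\<close>
  have other: "g \<tau> * \<epsilon> \<le> g 0 * (\<epsilon> + \<tau>)" "g (- \<tau>) * \<epsilon> \<le> g 0 * (\<epsilon> + \<tau>)" if \<tau>: "0 < \<tau>" for \<tau>
  proof -
    have *: "y * \<epsilon> \<le> g 0 * (\<epsilon> + \<tau>)" if y: "\<And>t. t \<in> E \<Longrightarrow> 0 < t \<Longrightarrow> t * y \<le> (\<tau> + t) * g 0" for y
    proof (cases "y \<le> g 0")
      case True
      then have "y * \<epsilon> \<le> g 0 * \<epsilon>" using \<epsilon> by (intro mult_right_mono) auto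
      moreover have "0 < g 0 * \<tau>" using g0 \<tau> by simp
      ultimately show ?thesis by (simp add: algebra_simps)
    next
      case False
      have "t \<le> g 0 * \<tau> / (y - g 0)" if "t \<in> E" for t
      proof (cases "0 < t")
        case True
        then show ?thesis using y[OF that] False by (simp add: field_simps)
      qed (use False g0 \<tau> in \<open>auto intro: order_trans[of _ 0]\<close>)
      then have "\<epsilon> \<le> g 0 * \<tau> / (y - g 0)" unfolding \<epsilon>_def using \<open>h \<in> E\<close> by (intro cSup_least) auto
      then show ?thesis using False by (simp add: field_simps)
    qed
    show "g \<tau> * \<epsilon> \<le> g 0 * (\<epsilon> + \<tau>)"
    proof (rule *)
      fix t assume "t \<in> E" "0 < t"
      then show "t * g \<tau> \<le> (\<tau> + t) * g 0"
        using g_line(2)[of \<tau> t] \<tau> by (simp add: E_def) (smt (verit) mult_pos_pos)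
    qed
    show "g (- \<tau>) * \<epsilon> \<le> g 0 * (\<epsilon> + \<tau>)"
    proof (rule *)
      fix t assume "t \<in> E" "0 < t"
      then show "t * g (- \<tau>) \<le> (\<tau> + t) * g 0"
        using g_line(1)[of \<tau> t] \<tau> by (simp add: E_def) (smt (verit) mult_pos_pos)
    qed
  qed
  define p where "p = s / 2"
  have p: "0 < p" "p < 1" using s_pos s_less_1 by (auto simp: p_def)
  define F where "F \<tau> = max 0 (g \<tau>) powr p" for \<tau>
  have sd: "second_diff (barrier r) x (\<tau> *\<^sub>R \<xi>) = F \<tau> + F (- \<tau>) - 2 * g 0 powr p" for \<tau>
    using g0 by (simp add: second_diff_def barrier_def F_def g_def p_def)
  \<comment> \<open>Before \<open>\<epsilon>\<close> the majorant is 0 by concavity of the power.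
    After it one endpoint gives 0 and the other uses
    \<open>1 + \<tau> / \<epsilon> \<le> 2 * \<tau> / \<epsilon>\<close>, which leaves a pure power
    to integrate.\<close>
  have bound: "second_diff (barrier r) x (\<tau> *\<^sub>R \<xi>) \<le>
      g 0 powr p * (2 powr p * \<epsilon> powr (- p)) * (\<tau> powr p * indicator {\<epsilon>..} \<tau>) - 2 * g 0 powr p * indicator {\<epsilon>..} \<tau>"
    if \<tau>: "0 < \<tau>" for \<tau>
  proof (cases "\<tau> < \<epsilon>")
    case True
    then have "0 < g \<tau>" "0 < g (- \<tau>)" using inE[OF \<tau>] by (auto simp: E_def)
    moreover have "g \<tau> + g (- \<tau>) \<le> 2 * g 0" using g_sum[of \<tau>] by (smt (verit) zero_le_power2)
    ultimately have "F \<tau> + F (- \<tau>) \<le> 2 * g 0 powr p"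
      unfolding F_def using g0 p by (simp add: sum_powr_le_of_mean_le)
    with True show ?thesis by (simp add: sd)
  next
    case False
    have F_le: "F t \<le> g 0 powr p * (2 powr p * \<epsilon> powr (- p)) * \<tau> powr p" if "g t * \<epsilon> \<le> g 0 * (\<epsilon> + \<tau>)" for t
    proof -
      have "g t \<le> g 0 * ((\<epsilon> + \<tau>) / \<epsilon>)" using that \<epsilon> by (simp add: field_simps)
      also have "\<dots> \<le> g 0 * (2 * \<tau> / \<epsilon>)"
        using False \<epsilon> g0 by (intro mult_left_mono divide_right_mono) auto
      finally have "F t \<le> (g 0 * (2 * \<tau> / \<epsilon>)) powr p"
        unfolding F_def using p \<epsilon> g0 \<tau> by (intro powr_mono2) auto
      also have "\<dots> = g 0 powr p * (2 powr p * \<epsilon> powr (- p)) * \<tau> powr p"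
        by (rule powr_split)
      finally show ?thesis .
    qed
    have "g \<tau> \<le> 0 \<or> g (- \<tau>) \<le> 0" using out[of \<tau>] False by (auto simp: E_def)
    then have "F \<tau> = 0 \<or> F (- \<tau>) = 0" by (auto simp: F_def max_def)
    then have "F \<tau> + F (- \<tau>) \<le> g 0 powr p * (2 powr p * \<epsilon> powr (- p)) * \<tau> powr p"
      using F_le[OF other(1)[OF \<tau>]] F_le[OF other(2)[OF \<tau>]] by auto
    with False show ?thesis by (simp add: sd)
  qed
  have tailp: "integrable levy (\<lambda>\<tau>. \<tau> powr p * indicator {\<epsilon>..} \<tau>)"
    "(\<integral>\<tau>. \<tau> powr p * indicator {\<epsilon>..} \<tau> \<partial>levy) = \<epsilon> powr (p - 2 * s) / (2 * s - p)"
    using has_bochner_integral_levy_tail_powr[OF \<epsilon>, of p] s_pos by (auto simp: has_bochner_integral_iff p_def)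
  have "far h (barrier r) x \<xi> \<le> (\<integral>\<tau>. g 0 powr p * (2 powr p * \<epsilon> powr (- p)) * (\<tau> powr p * indicator {\<epsilon>..} \<tau>)
      - 2 * g 0 powr p * indicator {\<epsilon>..} \<tau> \<partial>levy)"
    unfolding far_def
  proof (rule integral_levy_mono)
    fix \<tau> :: real assume "0 < \<tau>"
    from bound[OF this] h\<epsilon> show "indicator {h..} \<tau> * second_diff (barrier r) x (\<tau> *\<^sub>R \<xi>) \<le>
      g 0 powr p * (2 powr p * \<epsilon> powr (- p)) * (\<tau> powr p * indicator {\<epsilon>..} \<tau>) - 2 * g 0 powr p * indicator {\<epsilon>..} \<tau>"
      by (auto simp: indicator_def)
  qed (intro integrable_far L_infty_barrier r h Bochner_Integration.integrable_diff integrable_mult_right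
      tailp integrable_tail \<epsilon>)+
  also have "\<dots> = g 0 powr p * (2 powr p * \<epsilon> powr (- p)) * (\<epsilon> powr (p - 2 * s) / (2 * s - p)) - 2 * g 0 powr p * tail \<epsilon>"
    by (subst Bochner_Integration.integral_diff)
      (rule integrable_mult_right tailp(1) integrable_tail[OF \<epsilon>]
        | simp only: integral_mult_right_zero tailp(2) integral_tail[OF \<epsilon>])+
  also have "\<dots> = g 0 powr p * (2 powr p * (\<epsilon> powr (- p) * \<epsilon> powr (p - 2 * s)) / (2 * s - p) - 2 * tail \<epsilon>)"
    by (simp add: algebra_simps)
  also have "\<epsilon> powr (- p) * \<epsilon> powr (p - 2 * s) = \<epsilon> powr (- 2 * s)"
    by (simp flip: powr_add)
  also have "g 0 powr p * (2 powr p * \<epsilon> powr (- 2 * s) / (2 * s - p) - 2 * tail \<epsilon>)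
      = - barrier_const * (g 0 powr p * \<epsilon> powr (- 2 * s))"
    using s_pos by (simp add: tail_def barrier_const_def p_def field_simps)
  also have "\<dots> \<le> - barrier_const * (g 0 powr p * g 0 powr (- s))"
  proof -
    have "g 0 powr (- s) = sqrt (g 0) powr (- 2 * s)"
      using g0 by (simp add: powr_half_sqrt[symmetric] powr_powr)
    also have "\<dots> \<le> \<epsilon> powr (- 2 * s)" using \<epsilon> \<epsilon>_le s_pos by (intro powr_mono2') auto
    finally show ?thesis using barrier_const_pos by (simp add: mult_left_mono)
  qed
  also have "g 0 powr p * g 0 powr (- s) = (d x + r) powr (- s / 2)"
    by (simp add: p_def g0(1) flip: powr_add)
  finally show ?thesis .
qed

end

text \<open>Each \<open>R\<^sup>2 - |x - y|\<^sup>2\<close> satisfies the strong concavity with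
  equality, and the required inequalities pass to the infimum. The delicate point is positivity of
  \<open>d\<close> on \<open>\<Omega>\<close>: an infimum of infinitely many positive values could
  be 0, which openness of \<open>\<Omega>\<close> excludes.\<close>

lemma uniformly_convex_domain_level:
  fixes \<Omega> :: "'a::euclidean_space set"
  assumes "uniformly_convex_domain \<Omega>" "0 < s" "s < 1"
  obtains d R where "concave_level_domain s \<Omega> d R"
proof -
  from assms obtain R Y where op: "open \<Omega>" and ne: "\<Omega> \<noteq> {}" and bd: "bounded \<Omega>" and R: "0 < R"
    and \<Omega>: "\<Omega> = (\<Inter>y\<in>Y. ball y R)"
    unfolding uniformly_convex_domain_def by blast
  have Y: "Y \<noteq> {}" using \<Omega> bd by (auto simp: not_bounded_UNIV)
  obtain x0 where x0: "x0 \<in> \<Omega>" using ne by blast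
  define f where "f x y = R\<^sup>2 - (norm (x - y))\<^sup>2" for x y :: 'a
  have norm_sq: "(norm (a + b))\<^sup>2 = (norm a)\<^sup>2 + 2 * (a \<bullet> b) + (norm b)\<^sup>2"
    "(norm (a - b))\<^sup>2 = (norm a)\<^sup>2 - 2 * (a \<bullet> b) + (norm b)\<^sup>2" for a b :: 'a
    by (simp_all add: power2_norm_eq_inner inner_add_left inner_add_right inner_diff_left inner_diff_right inner_commute)
  define d where "d x = (INF y\<in>Y. f x y)" for x
  have bdd: "bdd_below (f x ` Y)" for x
  proof (rule bdd_belowI2)
    fix y assume "y \<in> Y"
    then have "dist y x0 < R" using x0 \<Omega> by (auto simp: mem_ball)
    then have "norm (x - y) \<le> norm (x - x0) + R"
      using norm_triangle_ineq[of "x - x0" "x0 - y"] by (simp add: dist_norm norm_minus_commute)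
    then have "(norm (x - y))\<^sup>2 \<le> (norm (x - x0) + R)\<^sup>2" by (intro power_mono) auto
    then show "R\<^sup>2 - (norm (x - x0) + R)\<^sup>2 \<le> f x y" by (simp add: f_def)
  qed
  have d_le: "d x \<le> f x y" if "y \<in> Y" for x y
    unfolding d_def using bdd that by (intro cINF_lower)
  have d_ge: "c \<le> d x" if "\<And>y. y \<in> Y \<Longrightarrow> c \<le> f x y" for x c
    unfolding d_def using Y that by (intro cINF_greatest)
  have in_iff: "x \<in> \<Omega> \<longleftrightarrow> (\<forall>y\<in>Y. norm (x - y) < R)" for x
    using \<Omega> by (auto simp: dist_norm norm_minus_commute)
  have \<Omega>_eq: "\<Omega> = {x. 0 < d x}"
  proof (intro equalityI subsetI CollectI)
    fix x assume "x \<in> \<Omega>"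
    then obtain e where e: "0 < e" "cball x e \<subseteq> \<Omega>" using op by (meson open_contains_cball)
    \<comment> \<open>Moving from \<open>x\<close> away from \<open>y\<close> by \<open>e\<close>
      stays in \<open>\<Omega>\<close>, so \<open>norm (x - y) + e < R\<close>; the resulting bound
      does not depend on \<open>y\<close>.\<close>
    have "e\<^sup>2 \<le> f x y" if "y \<in> Y" for y
    proof -
      obtain b :: 'a where b: "norm b = 1" "norm (x - y + e *\<^sub>R b) = norm (x - y) + e"
      proof (cases "x = y")
        case True
        obtain b :: 'a where "b \<in> Basis" using nonempty_Basis by blast
        with True e show ?thesis by (intro that[of b]) auto
      next
        case False
        define n where "n = norm (x - y)"
        have "n > 0" using False by (simp add: n_def)
        have "x - y + e *\<^sub>R ((x - y) /\<^sub>R n) = (1 + e / n) *\<^sub>R (x - y)" by (simp add: algebra_simps divide_inverse)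
        also have "norm \<dots> = \<bar>1 + e / n\<bar> * n" unfolding n_def by (rule norm_scaleR)
        also have "\<dots> = n + e" using \<open>n > 0\<close> e(1) by (simp add: abs_of_nonneg distrib_right)
        finally have "norm (x - y + e *\<^sub>R ((x - y) /\<^sub>R n)) = n + e" .
        moreover have "norm ((x - y) /\<^sub>R n) = 1" using \<open>n > 0\<close> by (simp add: n_def)
        ultimately show ?thesis by (intro that[of "(x - y) /\<^sub>R n"]) (simp_all only: n_def)
      qed
      have "x + e *\<^sub>R b \<in> \<Omega>" using e b by (auto simp: dist_norm subset_iff)
      then have "norm (x - y) + e < R" using that b(2) unfolding in_iff by (auto simp: algebra_simps)
      then have "(norm (x - y) + e)\<^sup>2 \<le> R\<^sup>2" using e by (intro power_mono) auto
      moreover have "0 \<le> 2 * norm (x - y) * e" using e by simp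
      ultimately show ?thesis unfolding f_def power2_sum by linarith
    qed
    then have "e\<^sup>2 \<le> d x" by (rule d_ge)
    then show "0 < d x" using e by (smt (verit) zero_less_power)
  next
    fix x assume "x \<in> {x. 0 < d x}"
    then have "0 < f x y" if "y \<in> Y" for y using d_le[OF that, of x] by simp
    then show "x \<in> \<Omega>" unfolding in_iff f_def
      using R by (auto intro: power_less_imp_less_base[of _ 2])
  qed
  have "concave_level_domain s \<Omega> d R"
  proof
    show "concave_on UNIV d"
      unfolding concave_on_iff
    proof (intro conjI ballI allI impI)
      fix a b :: 'a and u v :: real assume uv: "0 \<le> u" "0 \<le> v" "u + v = 1"
      show "u * d a + v * d b \<le> d (u *\<^sub>R a + v *\<^sub>R b)"
      proof (rule d_ge)
        fix y assume y: "y \<in> Y"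
        have "u * d a + v * d b \<le> u * f a y + v * f b y"
          using uv d_le[OF y] by (intro add_mono mult_left_mono) auto
        also have "\<dots> \<le> f (u *\<^sub>R a + v *\<^sub>R b) y"
        proof -
          define \<alpha> \<beta> where "\<alpha> = a - y" and "\<beta> = b - y"
          have v: "v = 1 - u" using uv by simp
          have "u *\<^sub>R a + v *\<^sub>R b - y = u *\<^sub>R \<alpha> + v *\<^sub>R \<beta>" by (simp add: \<alpha>_def \<beta>_def v algebra_simps)
          moreover have "(norm (u *\<^sub>R \<alpha> + v *\<^sub>R \<beta>))\<^sup>2 = u * (norm \<alpha>)\<^sup>2 + v * (norm \<beta>)\<^sup>2 - u * v * (norm (\<alpha> - \<beta>))\<^sup>2"
            unfolding power2_norm_eq_inner v inner_add_left inner_add_right inner_diff_left inner_diff_right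
              inner_scaleR_left inner_scaleR_right inner_commute[of \<beta> \<alpha>] by algebra
          moreover have "0 \<le> u * v * (norm (\<alpha> - \<beta>))\<^sup>2" using uv by simp
          moreover have "u * (R\<^sup>2 - (norm \<alpha>)\<^sup>2) + v * (R\<^sup>2 - (norm \<beta>)\<^sup>2)
              = R\<^sup>2 - (u * (norm \<alpha>)\<^sup>2 + v * (norm \<beta>)\<^sup>2)"
            by (simp add: v algebra_simps)
          ultimately show ?thesis unfolding f_def \<alpha>_def[symmetric] \<beta>_def[symmetric] by auto
        qed
        finally show "u * d a + v * d b \<le> f (u *\<^sub>R a + v *\<^sub>R b) y" .
      qed
    qed auto
    show "d (x + h) + d (x - h) \<le> 2 * d x - 2 * (norm h)\<^sup>2" for x h
    proof -
      have "(d (x + h) + d (x - h) + 2 * (norm h)\<^sup>2) / 2 \<le> d x"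
      proof (rule d_ge)
        fix y assume y: "y \<in> Y"
        have "f (x + h) y + f (x - h) y + 2 * (norm h)\<^sup>2 = 2 * f x y"
          using norm_sq[of "x - y" h] by (simp add: f_def algebra_simps)
        with d_le[OF y, of "x + h"] d_le[OF y, of "x - h"]
        show "(d (x + h) + d (x - h) + 2 * (norm h)\<^sup>2) / 2 \<le> f x y" by simp
      qed
      then show ?thesis by simp
    qed
    show "d x \<le> R\<^sup>2" for x
    proof -
      obtain y where "y \<in> Y" using Y by blast
      from d_le[OF this, of x] show ?thesis by (simp add: f_def) (smt (verit) zero_le_power2)
    qed
    show "d x - 2 * R * norm h - (norm h)\<^sup>2 \<le> d (x + h)" if "x \<in> \<Omega>" for x h
    proof (rule d_ge)
      fix y assume y: "y \<in> Y"
      have "(x - y) \<bullet> h \<le> norm (x - y) * norm h" by (rule norm_cauchy_schwarz)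
      also have "\<dots> \<le> R * norm h" using that y unfolding in_iff by (intro mult_right_mono) (auto intro: less_imp_le)
      finally show "d x - 2 * R * norm h - (norm h)\<^sup>2 \<le> f (x + h) y"
        using d_le[OF y, of x] norm_sq(1)[of "x - y" h] by (simp add: f_def algebra_simps)
    qed
  qed (use assms \<Omega>_eq bd ne R in auto)
  then show ?thesis using that by blast
qed

section \<open>Semicontinuity and doubling of variables\<close>

text \<open>Semicontinuity on the whole space by open sublevel sets: the functions compared are
  first extended by 0 outside \<open>\<Omega>\<close>. Lower semicontinuity of \<open>v\<close> is
  written \<open>usc (\<lambda>x. - v x)\<close>.\<close>

definition usc :: "('a::topological_space \<Rightarrow> real) \<Rightarrow> bool" where
  "usc f \<longleftrightarrow> (\<forall>c. open {x. f x < c})"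

lemma usc_continuous:
  fixes f :: "'a::topological_space \<Rightarrow> real"
  shows "continuous_on UNIV f \<Longrightarrow> usc f"
  unfolding usc_def by (intro allI open_Collect_less continuous_on_const)

lemma usc_add:
  assumes "usc f" "usc g" shows "usc (\<lambda>x. f x + g x)"
  unfolding usc_def
proof
  fix c
  have "{x. f x + g x < c} = (\<Union>r. {x. f x < r} \<inter> {x. g x < c - r})"
  proof (intro equalityI subsetI)
    fix x assume "x \<in> {x. f x + g x < c}"
    then have "f x < (f x + c - g x) / 2" "g x < c - (f x + c - g x) / 2" by (auto simp: field_simps)
    then show "x \<in> (\<Union>r. {x. f x < r} \<inter> {x. g x < c - r})" by blast
  qed auto
  then show "open {x. f x + g x < c}" using assms by (auto simp: usc_def intro!: open_UN open_Int)
qed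

lemma usc_compose:
  assumes "usc f" "continuous_on UNIV g" shows "usc (\<lambda>x. f (g x))"
  unfolding usc_def
proof
  fix c
  have "open (g -` {x. f x < c})" using assms by (intro open_vimage) (auto simp: usc_def)
  then show "open {x. f (g x) < c}" by (simp add: vimage_def)
qed

lemma usc_cmult: "usc f \<Longrightarrow> 0 < t \<Longrightarrow> usc (\<lambda>x. t * f x)"
  by (simp add: usc_def mult.commute[of t] flip: pos_less_divide_eq)

lemma usc_attains:
  assumes K: "compact K" "K \<noteq> {}" and f: "usc f"
  obtains x where "x \<in> K" "\<And>y. y \<in> K \<Longrightarrow> f y \<le> f x"
proof (rule ccontr)
  assume "\<not> thesis"
  then have "\<forall>x\<in>K. \<exists>y\<in>K. f x < f y" using that by (force simp: not_le)
  then have "K \<subseteq> (\<Union>y\<in>K. {x. f x < f y})" by auto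
  then obtain D where D: "D \<subseteq> K" "finite D" "K \<subseteq> (\<Union>y\<in>D. {x. f x < f y})"
    using compactE_image[OF K(1), of K "\<lambda>y. {x. f x < f y}"] f unfolding usc_def by metis
  have "D \<noteq> {}" using D(3) K(2) by auto
  then have "Max (f ` D) \<in> f ` D" using D(2) by simp
  then obtain y where y: "y \<in> D" "f y = Max (f ` D)" by (metis imageE)
  obtain z where "z \<in> D" "f y < f z" using D(1,3) y(1) by blast
  then show False using y(2) Max_ge[of "f ` D" "f z"] D(2) by (simp add: not_le[symmetric] del: Max_ge)
qed

lemma usc_sequentially:
  assumes "usc f" "X \<longlonglongrightarrow> x" "f x < c"
  shows "\<forall>\<^sub>F j in sequentially. f (X j) < c"
proof -
  have "open {x. f x < c}" "x \<in> {x. f x < c}" using assms(1,3) by (auto simp: usc_def)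
  from topological_tendstoD[OF assms(2) this] show ?thesis by (simp only: mem_Collect_eq)
qed

lemma usc_le_limit:
  assumes "usc f" "X \<longlonglongrightarrow> x" "Y \<longlonglongrightarrow> y" "\<And>j. Y j \<le> f (X j)"
  shows "y \<le> f x"
proof (rule ccontr)
  assume "\<not> y \<le> f x"
  then obtain c where c: "f x < c" "c < y" using dense[of "f x" y] by (auto simp: not_le)
  have "\<forall>\<^sub>F j in sequentially. False"
    using usc_sequentially[OF assms(1,2) c(1)] order_tendstoD(1)[OF assms(3) c(2)]
  proof eventually_elim
    case (elim j)
    then show False using assms(4)[of j] by linarith
  qed
  then show False by simp
qed

lemma usc_tendsto:
  assumes "usc f" "X \<longlonglongrightarrow> x" "Y \<longlonglongrightarrow> f x" "\<And>j. Y j \<le> f (X j)"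
  shows "(\<lambda>j. f (X j)) \<longlonglongrightarrow> f x"
proof (rule order_tendstoI)
  fix a assume "a < f x"
  from order_tendstoD(1)[OF assms(3) this] show "\<forall>\<^sub>F j in sequentially. a < f (X j)"
  proof eventually_elim
    case (elim j)
    then show ?case using assms(4)[of j] by linarith
  qed
qed (use usc_sequentially[OF assms(1,2)] in auto)

lemma usc_borel:
  assumes "usc f" shows "f \<in> borel_measurable borel"
  unfolding borel_measurable_iff_less using assms by (auto simp: usc_def)

lemma usc_imp_usc_on: "usc f \<Longrightarrow> usc_on S f"
  unfolding usc_on_def usc_def
  unfolding eventually_at_topological by blast

text \<open>At a boundary point the cutoff is 0 and \<open>u\<close> is nonpositive, so
  semicontinuity of \<open>u\<close> relative to the closure keeps nearby values below any
  \<open>c > 0\<close>. For \<open>c \<le> 0\<close> the sublevel set is empty.\<close>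

lemma usc_cutoff:
  assumes u: "usc_on (closure \<Omega>) u" and \<Omega>: "open \<Omega>" and out: "\<And>x. x \<notin> \<Omega> \<Longrightarrow> u x \<le> 0"
  shows "usc (\<lambda>x. if x \<in> \<Omega> then max 0 (u x) else 0)"
  unfolding usc_def
proof
  fix c :: real
  let ?f = "\<lambda>x. if x \<in> \<Omega> then max 0 (u x) else 0"
  show "open {x. ?f x < c}"
  proof (subst open_subopen, intro ballI)
    fix x assume "x \<in> {x. ?f x < c}"
    then have x: "?f x < c" by simp
    then have c: "0 < c" by (auto split: if_splits)
    show "\<exists>T. open T \<and> x \<in> T \<and> T \<subseteq> {x. ?f x < c}"
    proof (cases "x \<in> closure \<Omega>")
      case True
      have "u x < c" using x out[of x] c by (auto split: if_splits)
      then have "\<forall>\<^sub>F y in at x within closure \<Omega>. u y < c" using u True by (auto simp: usc_on_def)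
      then obtain T where T: "open T" "x \<in> T" "\<And>y. y \<in> T \<Longrightarrow> y \<noteq> x \<Longrightarrow> y \<in> closure \<Omega> \<Longrightarrow> u y < c"
        unfolding eventually_at_topological by blast
      have "?f y < c" if "y \<in> T" for y
        using T(3)[OF that] c x closure_subset[of \<Omega>] by (cases "y = x") auto
      then have "T \<subseteq> {x. ?f x < c}" by blast
      with T(1,2) show ?thesis by blast
    next
      case False
      then show ?thesis
        using c closure_subset[of \<Omega>] by (intro exI[of _ "- closure \<Omega>"]) auto
    qed
  qed
qed

text \<open>Since \<open>v \<ge> 0\<close>, the extension by 0 jumps downwards on the closed
  complement, which lower semicontinuity permits.\<close>

lemma usc_minus_cutoff:
  assumes v: "lsc_on \<Omega> v" and \<Omega>: "open \<Omega>" and nonneg: "\<And>x. 0 \<le> v x"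
  shows "usc (\<lambda>x. - (if x \<in> \<Omega> then v x else 0))"
  unfolding usc_def
proof
  fix c :: real
  let ?f = "\<lambda>x. - (if x \<in> \<Omega> then v x else 0)"
  show "open {x. ?f x < c}"
  proof (cases "0 < c")
    case True
    then have "{x. ?f x < c} = UNIV" using nonneg by (auto intro: le_less_trans[of "- v _" 0])
    then show ?thesis by simp
  next
    case False
    show ?thesis
    proof (subst open_subopen, intro ballI)
      fix x assume "x \<in> {x. ?f x < c}"
      then have x: "x \<in> \<Omega>" "- c < v x" using False by (auto split: if_splits)
      then have "\<forall>\<^sub>F y in at x within \<Omega>. - c < v y" using v by (auto simp: lsc_on_def)
      then obtain T where T: "open T" "x \<in> T" "\<And>y. y \<in> T \<Longrightarrow> y \<noteq> x \<Longrightarrow> y \<in> \<Omega> \<Longrightarrow> - c < v y"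
        unfolding eventually_at_topological by blast
      have "- v y < c" if "y \<in> T \<inter> \<Omega>" for y using T(3)[of y] that x by (cases "y = x") auto
      then show "\<exists>T. open T \<and> x \<in> T \<and> T \<subseteq> {x. ?f x < c}"
        using T(1,2) x(1) \<Omega> by (intro exI[of _ "T \<inter> \<Omega>"]) auto
    qed
  qed
qed

text \<open>
  The third variable keeps the barrier \<open>W\<close>, which is not \<open>C\<^sup>2\<close>, out of the test functions: these are
  then paraboloids.
\<close>

lemma doubling_variables:
  fixes U V W :: "'a::euclidean_space \<Rightarrow> real"
  assumes U: "usc U" and V: "usc (\<lambda>x. - V x)" and W: "continuous_on UNIV W"
    and bd: "bounded {x. 0 < U x}" and US: "\<And>x. U x \<le> S"
    and V0: "\<And>x. 0 \<le> V x" and W0: "\<And>x. 0 \<le> W x" and pos: "0 < U p0 - V p0 - W p0"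
  obtains x0 x y z q where
    "x \<longlonglongrightarrow> x0" "y \<longlonglongrightarrow> x0" "z \<longlonglongrightarrow> x0"
    "(\<lambda>j. U (x j)) \<longlonglongrightarrow> U x0" "(\<lambda>j. V (y j)) \<longlonglongrightarrow> V x0"
    "\<And>p. U p - V p - W p \<le> U x0 - V x0 - W x0"
    "\<And>j :: nat. 0 < q j"
    "\<And>j p. U p - q j * ((norm (p - y j))\<^sup>2 + (norm (p - z j))\<^sup>2)
      \<le> U (x j) - q j * ((norm (x j - y j))\<^sup>2 + (norm (x j - z j))\<^sup>2)"
    "\<And>j p. V (y j) + q j * (norm (y j - x j))\<^sup>2 \<le> V p + q j * (norm (p - x j))\<^sup>2"
    "\<And>j h. U (x j + h) - V (y j + h) - W (z j + h) \<le> U (x j) - V (y j) - W (z j)"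
proof -
  define F where "F q w = U (fst w) - V (fst (snd w)) - W (snd (snd w))
     - q * ((norm (fst w - fst (snd w)))\<^sup>2 + (norm (fst w - snd (snd w)))\<^sup>2)"
    for q :: real and w :: "'a \<times> 'a \<times> 'a"
  have S0: "0 < S" using US[of p0] V0[of p0] W0[of p0] pos by linarith
  obtain B where B: "0 < B" "\<And>x. 0 < U x \<Longrightarrow> norm x \<le> B" using bd unfolding bounded_pos by auto
  \<comment> \<open>The margin \<open>S + 1\<close>: a point outside \<open>K\<close> has distance
    at least \<open>S + 1\<close> from where \<open>U\<close> is positive, and the penalty with
    \<open>q \<ge> 1\<close> then outweighs \<open>U\<close>. Maximisers exist although
    \<open>V\<close> and \<open>W\<close> are not confined to a compact set.\<close>
  define K where "K = cball (0::'a) (B + S + 1)"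
  have K: "compact (K \<times> K \<times> K)" "K \<noteq> {}" using B S0 by (auto simp: K_def intro!: compact_Times)
  have uscF: "usc (F q)" for q
  proof -
    have "usc (\<lambda>w :: 'a \<times> 'a \<times> 'a. U (fst w))" "usc (\<lambda>w :: 'a \<times> 'a \<times> 'a. - V (fst (snd w)))"
      by (rule usc_compose[OF U] usc_compose[OF V]; intro continuous_intros)+
    moreover have "continuous_on UNIV (\<lambda>w :: 'a \<times> 'a \<times> 'a. - W (snd (snd w))
       - q * ((norm (fst w - fst (snd w)))\<^sup>2 + (norm (fst w - snd (snd w)))\<^sup>2))"
      by (intro continuous_intros continuous_on_compose2[OF W, of _ "\<lambda>w. snd (snd w)"]) auto
    ultimately have "usc (\<lambda>w. U (fst w) + (- V (fst (snd w))) + (- W (snd (snd w))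
     - q * ((norm (fst w - fst (snd w)))\<^sup>2 + (norm (fst w - snd (snd w)))\<^sup>2)))"
      by (intro usc_add) (auto intro: usc_continuous)
    then show ?thesis by (simp add: F_def[abs_def] add_diff_eq)
  qed
  have "usc (\<lambda>x. U x + (- V x) + (- W x))"
    by (rule usc_add[OF usc_add[OF U V] usc_continuous]) (intro continuous_intros W)
  then obtain p1 where p1: "\<And>p. p \<in> K \<Longrightarrow> U p - V p - W p \<le> U p1 - V p1 - W p1"
    using usc_attains[of K "\<lambda>x. U x + (- V x) + (- W x)"] K(2) by (auto simp: K_def)
  define m where "m = U p1 - V p1 - W p1"
  have UK: "x \<in> K" if "0 < U x" for x using B(2)[OF that] S0 by (simp add: K_def)
  have "p0 \<in> K" using pos V0[of p0] W0[of p0] by (intro UK) linarith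
  then have m0: "0 < m" using p1[of p0] pos by (simp add: m_def)
  have m: "U p - V p - W p \<le> m" for p
  proof (cases "0 < U p")
    case False
    then show ?thesis using m0 V0[of p] W0[of p] by linarith
  qed (use p1 UK m_def in auto)
  have ex: "\<exists>w. \<forall>w'. F (real (Suc j)) w' \<le> F (real (Suc j)) w" for j
  proof -
    define q where "q = real (Suc j)"
    have q: "1 \<le> q" by (simp add: q_def)
    have "K \<times> K \<times> K \<noteq> {}" using K(2) by simp
    then obtain w where w: "\<And>w'. w' \<in> K \<times> K \<times> K \<Longrightarrow> F q w' \<le> F q w"
      using usc_attains[OF K(1) _ uscF[of q]] by metis
    have "p1 \<in> K" using m0 V0[of p1] W0[of p1] by (intro UK) (simp add: m_def)
    then have "m \<le> F q w" using w[of "(p1, p1, p1)"] by (simp add: F_def m_def)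
    have "F q w' \<le> F q w" if "w' \<notin> K \<times> K \<times> K" for w'
    proof -
      obtain a b c where w': "w' = (a, b, c)" by (cases w') auto
      have "F q w' \<le> 0"
      proof (cases "0 < U a")
        case False
        have "0 \<le> q * ((norm (a - b))\<^sup>2 + (norm (a - c))\<^sup>2)" using q by simp
        then show ?thesis using False V0[of b] W0[of c] by (simp add: F_def w')
      next
        case True
        have far: "S \<le> (norm (a - t))\<^sup>2" if "t \<notin> K" for t
        proof -
          have "B + S + 1 < norm t" using that by (simp add: K_def)
          then have "S + 1 \<le> norm (a - t)" using B(2)[OF True] norm_triangle_ineq2[of t a]
            by (simp add: norm_minus_commute)
          then have "(S + 1)\<^sup>2 \<le> (norm (a - t))\<^sup>2" using S0 by (intro power_mono) auto
          moreover have "S \<le> (S + 1)\<^sup>2" using S0 by (simp add: power2_eq_square algebra_simps)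
          ultimately show ?thesis by simp
        qed
        have "b \<notin> K \<or> c \<notin> K" using that UK[OF True] by (auto simp: w')
        then have "S \<le> (norm (a - b))\<^sup>2 + (norm (a - c))\<^sup>2"
          using far[of b] far[of c] by (smt (verit) zero_le_power2)
        then have "1 * S \<le> q * ((norm (a - b))\<^sup>2 + (norm (a - c))\<^sup>2)"
          using q S0 by (intro mult_mono) auto
        then show ?thesis using US[of a] V0[of b] W0[of c] by (simp add: F_def w')
      qed
      with \<open>m \<le> F q w\<close> m0 show ?thesis by simp
    qed
    then show ?thesis unfolding q_def[symmetric] using w by blast
  qed
  then obtain w where w: "\<And>j w'. F (real (Suc j)) w' \<le> F (real (Suc j)) (w j)" by metis
  define x y z where "x j = fst (w j)" and "y j = fst (snd (w j))" and "z j = snd (snd (w j))" for j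
  have max: "U a - V b - W c - real (Suc j) * ((norm (a - b))\<^sup>2 + (norm (a - c))\<^sup>2) \<le>
    U (x j) - V (y j) - W (z j) - real (Suc j) * ((norm (x j - y j))\<^sup>2 + (norm (x j - z j))\<^sup>2)" for a b c j
    using w[of j "(a, b, c)"] by (simp add: F_def x_def y_def z_def)
  have m_le: "m \<le> U (x j) - V (y j) - W (z j) - real (Suc j) * ((norm (x j - y j))\<^sup>2 + (norm (x j - z j))\<^sup>2)" for j
    using max[of p1 p1 p1 j] by (simp add: m_def)
  have m_le': "m \<le> U (x j) - V (y j) - W (z j)" for j
  proof -
    have "0 \<le> real (Suc j) * ((norm (x j - y j))\<^sup>2 + (norm (x j - z j))\<^sup>2)" by simp
    with m_le[of j] show ?thesis by linarith
  qed
  have "\<forall>j. x j \<in> K"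
  proof
    fix j show "x j \<in> K" using m_le'[of j] m0 V0[of "y j"] W0[of "z j"] by (intro UK) linarith
  qed
  moreover have "compact K" by (simp add: K_def)
  ultimately obtain x0 r where r: "strict_mono r" "(x \<circ> r) \<longlonglongrightarrow> x0"
    unfolding compact_def by metis
  have pen: "(norm (x j - y j))\<^sup>2 + (norm (x j - z j))\<^sup>2 \<le> S * inverse (real (Suc j))" for j
  proof -
    have "real (Suc j) * ((norm (x j - y j))\<^sup>2 + (norm (x j - z j))\<^sup>2) \<le> S"
      using m_le[of j] m0 US[of "x j"] V0[of "y j"] W0[of "z j"] by linarith
    then show ?thesis by (simp add: field_simps)
  qed
  have lim: "(\<lambda>j. norm (t j)) \<longlonglongrightarrow> 0" if t: "\<And>j. (norm (t j))\<^sup>2 \<le> S * inverse (real (Suc j))" for t :: "nat \<Rightarrow> 'a"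
  proof -
    have "(\<lambda>j. S * inverse (real (Suc j))) \<longlonglongrightarrow> S * 0"
      by (intro tendsto_intros LIMSEQ_inverse_real_of_nat)
    then have "(\<lambda>j. (norm (t j))\<^sup>2) \<longlonglongrightarrow> 0"
      using t by (intro Lim_null_comparison[of "\<lambda>j. (norm (t j))\<^sup>2" "\<lambda>j. S * inverse (real (Suc j))"]) auto
    from tendsto_real_sqrt[OF this] show ?thesis by simp
  qed
  have "(\<lambda>j. norm (x j - y j)) \<longlonglongrightarrow> 0" "(\<lambda>j. norm (x j - z j)) \<longlonglongrightarrow> 0"
    using pen by (intro lim; smt (verit) zero_le_power2)+
  then have xy: "(\<lambda>j. x (r j) - y (r j)) \<longlonglongrightarrow> 0" and xz: "(\<lambda>j. x (r j) - z (r j)) \<longlonglongrightarrow> 0"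
    using LIMSEQ_subseq_LIMSEQ[OF _ r(1)] by (auto simp: tendsto_norm_zero_iff o_def)
  have xl: "(\<lambda>j. x (r j)) \<longlonglongrightarrow> x0" using r(2) by (simp add: o_def)
  have yl: "(\<lambda>j. y (r j)) \<longlonglongrightarrow> x0" using tendsto_diff[OF xl xy] by simp
  have zl: "(\<lambda>j. z (r j)) \<longlonglongrightarrow> x0" using tendsto_diff[OF xl xz] by simp
  have Wl: "(\<lambda>j. W (z (r j))) \<longlonglongrightarrow> W x0"
    by (rule isCont_tendsto_compose[OF _ zl]) (use W in \<open>simp add: continuous_on_eq_continuous_at\<close>)
  have uscUV: "usc (\<lambda>w. U (fst w) + (- V (snd w)))"
    by (rule usc_add[OF usc_compose[OF U] usc_compose[OF V]]; intro continuous_intros)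
  have "m + W x0 \<le> U (fst (x0, x0)) + (- V (snd (x0, x0)))"
    by (rule usc_le_limit[OF uscUV tendsto_Pair[OF xl yl] tendsto_add[OF tendsto_const Wl]])
      (use m_le' in \<open>auto simp: algebra_simps\<close>)
  \<comment> \<open>The penalised maxima are at least \<open>m\<close>, and semicontinuity carries
    this to the limit: \<open>x0\<close> maximises the unpenalised function.\<close>
  with m[of x0] have meq: "m = U x0 - V x0 - W x0" by simp
  have uscU': "(\<lambda>j. U (x (r j)) + (- V (y (r j)))) \<longlonglongrightarrow> U x0 + (- V x0)"
    using usc_tendsto[OF uscUV tendsto_Pair[OF xl yl], of "\<lambda>j. m + W (z (r j))"]
      tendsto_add[OF tendsto_const[of m] Wl] m_le' by (simp add: meq algebra_simps)
  \<comment> \<open>A sum of two upper semicontinuous terms converges to its value at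
    \<open>x0\<close>; neither term can drop in the limit, because the other cannot compensate from
    above.\<close>
  have "(\<lambda>j. U (x (r j))) \<longlonglongrightarrow> U x0"
  proof (rule order_tendstoI)
    fix a assume "a < U x0"
    define c where "c = (U x0 - a) / 2"
    have c: "0 < c" using \<open>a < U x0\<close> by (simp add: c_def)
    have "\<forall>\<^sub>F j in sequentially. U x0 + (- V x0) - c < U (x (r j)) + (- V (y (r j)))"
      using order_tendstoD(1)[OF uscU'] c by simp
    moreover have "\<forall>\<^sub>F j in sequentially. - V (y (r j)) < - V x0 + c"
      using usc_sequentially[OF V yl] c by simp
    ultimately show "\<forall>\<^sub>F j in sequentially. a < U (x (r j))"
      by eventually_elim (simp add: c_def field_simps)
  qed (use usc_sequentially[OF U xl] in auto)
  note Ul = this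
  have Vl: "(\<lambda>j. V (y (r j))) \<longlonglongrightarrow> V x0"
    using tendsto_diff[OF Ul uscU'] by simp
  show ?thesis
  proof (rule that[OF xl yl zl Ul Vl, of "\<lambda>j. real (Suc (r j))"])
    show "U p - V p - W p \<le> U x0 - V x0 - W x0" for p using m meq by simp
    show "U p - real (Suc (r j)) * ((norm (p - y (r j)))\<^sup>2 + (norm (p - z (r j)))\<^sup>2)
      \<le> U (x (r j)) - real (Suc (r j)) * ((norm (x (r j) - y (r j)))\<^sup>2 + (norm (x (r j) - z (r j)))\<^sup>2)" for j p
      using max[of p "y (r j)" "z (r j)" "r j"] by simp
    show "V (y (r j)) + real (Suc (r j)) * (norm (y (r j) - x (r j)))\<^sup>2
      \<le> V p + real (Suc (r j)) * (norm (p - x (r j)))\<^sup>2" for j p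
      using max[of "x (r j)" p "z (r j)" "r j"] by (simp add: norm_minus_commute algebra_simps)
    \<comment> \<open>A common translation leaves the penalty unchanged. This orders the second
      differences of \<open>U\<close>, \<open>V\<close> and \<open>W\<close> at three different
      points.\<close>
    show "U (x (r j) + h) - V (y (r j) + h) - W (z (r j) + h) \<le> U (x (r j)) - V (y (r j)) - W (z (r j))" for j h
      using max[of "x (r j) + h" "y (r j) + h" "z (r j) + h" "r j"] by simp
  qed simp
qed

section \<open>Viscosity inequalities tested by paraboloids\<close>

lemma C2_on_paraboloid:
  fixes a b :: "'a::euclidean_space"
  shows "C2_on S (\<lambda>p. q * ((norm (p - a))\<^sup>2 + (norm (p - b))\<^sup>2))"
  unfolding C2_on_def power2_norm_eq_inner
proof (intro exI conjI ballI)
  show "((\<lambda>p. q * ((p - a) \<bullet> (p - a) + (p - b) \<bullet> (p - b))) has_derivative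
     (\<lambda>h. ((2 * q) *\<^sub>R (x - a) + (2 * q) *\<^sub>R (x - b)) \<bullet> h)) (at x)" for x
    by (auto intro!: derivative_eq_intros simp: algebra_simps inner_simps inner_commute)
  show "((\<lambda>x. (2 * q) *\<^sub>R (x - a) + (2 * q) *\<^sub>R (x - b)) has_derivative
     blinfun_apply ((4 * q) *\<^sub>R id_blinfun)) (at x)" for x
    by (auto intro!: derivative_eq_intros simp: scaleR_blinfun.rep_eq simp flip: scaleR_add_left)
qed (intro continuous_intros)

lemma second_diff_paraboloid:
  fixes \<xi> :: "'a::euclidean_space"
  assumes "norm \<xi> = 1"
  shows "second_diff (\<lambda>p. q * ((norm (p - a))\<^sup>2 + (norm (p - b))\<^sup>2)) x (\<tau> *\<^sub>R \<xi>) = 4 * q * \<tau>\<^sup>2"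
proof -
  have "(norm (x + \<tau> *\<^sub>R \<xi> - a))\<^sup>2 + (norm (x - \<tau> *\<^sub>R \<xi> - a))\<^sup>2 = 2 * (norm (x - a))\<^sup>2 + 2 * \<tau>\<^sup>2"
    for a
  proof -
    have "x + \<tau> *\<^sub>R \<xi> - a = (x - a) + \<tau> *\<^sub>R \<xi>" "x - \<tau> *\<^sub>R \<xi> - a = (x - a) - \<tau> *\<^sub>R \<xi>" by auto
    then show ?thesis using parallelogram[of "x - a" "\<tau> *\<^sub>R \<xi>"] assms by (simp only: norm_scaleR) simp
  qed
  note par = this
  have "second_diff (\<lambda>p. q * ((norm (p - a))\<^sup>2 + (norm (p - b))\<^sup>2)) x (\<tau> *\<^sub>R \<xi>)
    = q * (((norm (x + \<tau> *\<^sub>R \<xi> - a))\<^sup>2 + (norm (x - \<tau> *\<^sub>R \<xi> - a))\<^sup>2)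
      + ((norm (x + \<tau> *\<^sub>R \<xi> - b))\<^sup>2 + (norm (x - \<tau> *\<^sub>R \<xi> - b))\<^sup>2))
      - 2 * (q * ((norm (x - a))\<^sup>2 + (norm (x - b))\<^sup>2))"
    unfolding second_diff_def by (simp only: distrib_left right_diff_distrib)
  also have "\<dots> = 4 * q * \<tau>\<^sup>2" unfolding par by (simp add: distrib_left)
  finally show ?thesis .
qed

context fractional_order
begin

text \<open>The second moment of \<open>levy\<close> on \<open>(0, h)\<close>. It tends to 0 with
  \<open>h\<close> because \<open>s < 1\<close>, so the local term of a paraboloid of any fixed
  opening disappears.\<close>

definition near :: "real \<Rightarrow> real" where
  "near h = h powr (2 - 2 * s) / (2 - 2 * s)"

lemma integrable_near: "0 < h \<Longrightarrow> integrable levy (\<lambda>\<tau>. \<tau>\<^sup>2 * indicator {0<..<h} \<tau> :: real)"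
  and integral_near: "0 < h \<Longrightarrow> (\<integral>\<tau>. \<tau>\<^sup>2 * indicator {0<..<h} \<tau> \<partial>levy) = near h"
  using has_bochner_integral_levy_square[of h] by (auto simp: has_bochner_integral_iff near_def)

lemma near_nonneg: "0 \<le> near h"
  using s_less_1 by (simp add: near_def)

lemma near_tendsto_0: "(near \<longlongrightarrow> 0) (at_right 0)"
proof -
  have "((\<lambda>h. h powr (2 - 2 * s) / (2 - 2 * s)) \<longlongrightarrow> 0 powr (2 - 2 * s) / (2 - 2 * s)) (at_right 0)"
    using s_less_1 by (intro tendsto_intros tendsto_powr')
      (auto simp: eventually_at_right_less intro!: eventually_mono[OF eventually_at_right_less[of 0]])
  then show ?thesis by (simp add: near_def[abs_def])
qed

lemma integral_near_add_far:
  assumes "L_infty f" "0 < h"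
  shows "integrable levy (\<lambda>\<tau>. c * (\<tau>\<^sup>2 * indicator {0<..<h} \<tau>) + indicator {h..} \<tau> * second_diff f x (\<tau> *\<^sub>R \<xi>))"
    "(\<integral>\<tau>. c * (\<tau>\<^sup>2 * indicator {0<..<h} \<tau>) + indicator {h..} \<tau> * second_diff f x (\<tau> *\<^sub>R \<xi>) \<partial>levy)
      = c * near h + far h f x \<xi>"
proof -
  have 1: "integrable levy (\<lambda>\<tau>. c * (\<tau>\<^sup>2 * indicator {0<..<h} \<tau>))"
    using integrable_near assms by (intro integrable_mult_right) auto
  have 2: "integrable levy (\<lambda>\<tau>. indicator {h..} \<tau> * second_diff f x (\<tau> *\<^sub>R \<xi>))"
    using assms by (rule integrable_far)
  show "integrable levy (\<lambda>\<tau>. c * (\<tau>\<^sup>2 * indicator {0<..<h} \<tau>) + indicator {h..} \<tau> * second_diff f x (\<tau> *\<^sub>R \<xi>))"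
    using 1 2 by (rule Bochner_Integration.integrable_add)
  show "(\<integral>\<tau>. c * (\<tau>\<^sup>2 * indicator {0<..<h} \<tau>) + indicator {h..} \<tau> * second_diff f x (\<tau> *\<^sub>R \<xi>) \<partial>levy)
      = c * near h + far h f x \<xi>"
    unfolding Bochner_Integration.integral_add[OF 1 2] far_def integral_mult_right_zero
      integral_near[OF assms(2)] ..
qed

text \<open>Only the tests produced by doubling of variables are kept. There are two centres because
  \<open>x\<close> is tied to both \<open>y\<close> and \<open>z\<close>; the second difference of
  the paraboloid is \<open>4 * q * \<tau>\<^sup>2\<close>, whence the term with
  \<open>near h\<close>. Contact is global and at points where \<open>U\<close> is positive, which
  suits the cutoff.\<close>

definition paraboloid_subsolution :: "nat \<Rightarrow> real \<Rightarrow> ('a::euclidean_space \<Rightarrow> real) \<Rightarrow> bool" where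
  "paraboloid_subsolution k m U \<longleftrightarrow> (\<forall>x a b q h \<eta>. 0 < U x \<longrightarrow> 0 < h \<longrightarrow> 0 < \<eta> \<longrightarrow>
     (\<forall>p. U p - q * ((norm (p - a))\<^sup>2 + (norm (p - b))\<^sup>2) \<le> U x - q * ((norm (x - a))\<^sup>2 + (norm (x - b))\<^sup>2)) \<longrightarrow>
     (\<exists>e. frame k e \<and> - \<eta> \<le> (\<Sum>i<k. 4 * q * near h + far h U x (e i)) + m * U x))"

definition paraboloid_supersolution :: "nat \<Rightarrow> real \<Rightarrow> 'a::euclidean_space set \<Rightarrow> ('a \<Rightarrow> real) \<Rightarrow> bool" where
  "paraboloid_supersolution k m \<Omega> V \<longleftrightarrow> (\<forall>x a b q h e. x \<in> \<Omega> \<longrightarrow> 0 < h \<longrightarrow> frame k e \<longrightarrow>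
     (\<forall>p. V x + q * ((norm (x - a))\<^sup>2 + (norm (x - b))\<^sup>2) \<le> V p + q * ((norm (p - a))\<^sup>2 + (norm (p - b))\<^sup>2)) \<longrightarrow>
     (\<Sum>i<k. - 4 * q * near h + far h V x (e i)) + m * V x \<le> 0)"

text \<open>Allows the comparison to be run against a multiple of the barrier alone, with
  \<open>V = 0\<close>. The contact condition forces \<open>q \<ge> 0\<close>, so the local term has
  the right sign.\<close>

lemma paraboloid_supersolution_zero: "paraboloid_supersolution k m \<Omega> (\<lambda>x. 0)"
  unfolding paraboloid_supersolution_def
proof (intro allI impI)
  fix x a b :: 'a and q h :: real and e :: "nat \<Rightarrow> 'a"
  assume x: "x \<in> \<Omega>" and h: "0 < h" and e: "frame k e"
    and *: "\<forall>p. 0 + q * ((norm (x - a))\<^sup>2 + (norm (x - b))\<^sup>2) \<le> 0 + q * ((norm (p - a))\<^sup>2 + (norm (p - b))\<^sup>2)"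
  obtain \<xi> :: 'a where \<xi>: "norm \<xi> = 1" using vector_choose_size[of 1] by auto
  have "0 \<le> second_diff (\<lambda>p. q * ((norm (p - a))\<^sup>2 + (norm (p - b))\<^sup>2)) x (1 *\<^sub>R \<xi>)"
    using *[rule_format, of "x + 1 *\<^sub>R \<xi>"] *[rule_format, of "x - 1 *\<^sub>R \<xi>"] by (simp add: second_diff_def)
  then have "0 \<le> q" unfolding second_diff_paraboloid[OF \<xi>] by simp
  then show "(\<Sum>i<k. - 4 * q * near h + far h (\<lambda>x. 0) x (e i)) + m * 0 \<le> 0"
    using near_nonneg[of h] by (simp add: far_def second_diff_def sum_nonpos)
qed

lemma paraboloid_supersolution_cmult:
  assumes V: "paraboloid_supersolution k m \<Omega> V" and t: "0 < t"
  shows "paraboloid_supersolution k m \<Omega> (\<lambda>x. t * V x)"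
  unfolding paraboloid_supersolution_def
proof (intro allI impI)
  fix x a b :: 'a and q h :: real and e :: "nat \<Rightarrow> 'a"
  assume x: "x \<in> \<Omega>" and h: "0 < h" and e: "frame k e"
    and *: "\<forall>p. t * V x + q * ((norm (x - a))\<^sup>2 + (norm (x - b))\<^sup>2) \<le> t * V p + q * ((norm (p - a))\<^sup>2 + (norm (p - b))\<^sup>2)"
  have "V x + q / t * ((norm (x - a))\<^sup>2 + (norm (x - b))\<^sup>2) \<le> V p + q / t * ((norm (p - a))\<^sup>2 + (norm (p - b))\<^sup>2)" for p
    using divide_right_mono[OF *[rule_format, of p], of t] t by (simp add: add_divide_distrib)
  with V x h e have "(\<Sum>i<k. - 4 * (q / t) * near h + far h V x (e i)) + m * V x \<le> 0"
    unfolding paraboloid_supersolution_def by blast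
  then have "t * ((\<Sum>i<k. - 4 * (q / t) * near h + far h V x (e i)) + m * V x) \<le> 0"
    using t by (simp add: mult_le_0_iff)
  also have "t * ((\<Sum>i<k. - 4 * (q / t) * near h + far h V x (e i)) + m * V x)
    = (\<Sum>i<k. t * (- 4 * (q / t) * near h + far h V x (e i))) + m * (t * V x)"
    by (simp add: distrib_left sum_distrib_left)
  also have "(\<Sum>i<k. t * (- 4 * (q / t) * near h + far h V x (e i)))
    = (\<Sum>i<k. - 4 * q * near h + far h (\<lambda>x. t * V x) x (e i))"
    using t by (intro sum.cong) (auto simp: far_cmult algebra_simps)
  finally show "(\<Sum>i<k. - 4 * q * near h + far h (\<lambda>x. t * V x) x (e i)) + m * (t * V x) \<le> 0" .
qed

lemma L_infty_cutoff:
  assumes "L_infty u" "open \<Omega>"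
  shows "L_infty (\<lambda>x. if x \<in> \<Omega> then u x else 0)" "L_infty (\<lambda>x. if x \<in> \<Omega> then max 0 (u x) else 0)"
proof -
  obtain B where B: "0 < B" "\<And>x. \<bar>u x\<bar> \<le> B" using L_inftyE[OF assms(1)] by metis
  have [measurable]: "u \<in> borel_measurable borel" "\<Omega> \<in> sets borel" using assms by (auto simp: L_infty_def)
  show "L_infty (\<lambda>x. if x \<in> \<Omega> then u x else 0)" using B by (intro L_inftyI[of _ B]) auto
  have "\<bar>max 0 (u x)\<bar> \<le> B" for x using B(1) B(2)[of x] by (auto simp: max_def)
  then show "L_infty (\<lambda>x. if x \<in> \<Omega> then max 0 (u x) else 0)" using B by (intro L_inftyI[of _ B]) auto
qed

text \<open>The cutoff lies above \<open>u\<close> and agrees with it where the cutoff is positive.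
  A paraboloid touching the cutoff there from above thus touches \<open>u\<close>, and far second
  differences only increase.\<close>

lemma paraboloid_subsolutionI:
  fixes u :: "'a::euclidean_space \<Rightarrow> real"
  assumes u: "visc_subsolution (I_plus s k (C * m)) \<Omega> u" and \<Omega>: "open \<Omega>"
    and out: "\<And>x. x \<notin> \<Omega> \<Longrightarrow> u x \<le> 0"
  shows "paraboloid_subsolution k m (\<lambda>x. if x \<in> \<Omega> then max 0 (u x) else 0)"
  unfolding paraboloid_subsolution_def
proof (intro allI impI)
  define U where "U = (\<lambda>x. if x \<in> \<Omega> then max 0 (u x) else 0)"
  have Linf: "L_infty U" unfolding U_def
    by (rule L_infty_cutoff(2)[OF _ \<Omega>]) (use u in \<open>simp add: visc_subsolution_def\<close>)
  fix x a b :: 'a and q h \<eta> :: real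
  assume x: "0 < U x" and h: "0 < h" and \<eta>: "0 < \<eta>"
    and max: "\<forall>p. U p - q * ((norm (p - a))\<^sup>2 + (norm (p - b))\<^sup>2) \<le> U x - q * ((norm (x - a))\<^sup>2 + (norm (x - b))\<^sup>2)"
  define \<phi> where "\<phi> = (\<lambda>p. q * ((norm (p - a))\<^sup>2 + (norm (p - b))\<^sup>2))"
  have xU: "x \<in> \<Omega>" "U x = u x" using x by (auto simp: U_def split: if_splits)
  have le: "u p \<le> U p" for p using out[of p] by (auto simp: U_def)
  have "u p - \<phi> p \<le> u x - \<phi> x" for p
    using max[rule_format, of p] le[of p] xU(2) by (simp add: \<phi>_def)
  moreover have "C2_on (ball x h) \<phi>" unfolding \<phi>_def by (rule C2_on_paraboloid)
  ultimately have I: "0 \<le> I_plus s k (C * m) h \<phi> u x"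
    using u xU(1) h unfolding visc_subsolution_def by blast
  have "visc_directional s h \<phi> u x \<xi> \<le> ereal (4 * q * near h + far h U x \<xi>)" if \<xi>: "norm \<xi> = 1" for \<xi>
    unfolding integral_near_add_far(2)[OF Linf h, symmetric]
  proof (rule visc_directional_le[OF integral_near_add_far(1)[OF Linf h] h])
    show "second_diff \<phi> x (\<tau> *\<^sub>R \<xi>) \<le> 4 * q * (\<tau>\<^sup>2 * indicator {0<..<h} \<tau>) + indicator {h..} \<tau> * second_diff U x (\<tau> *\<^sub>R \<xi>)"
      if "0 < \<tau>" "\<tau> < h" for \<tau>
      using that by (simp add: \<phi>_def second_diff_paraboloid \<xi>)
    show "second_diff u x (\<tau> *\<^sub>R \<xi>) \<le> 4 * q * (\<tau>\<^sup>2 * indicator {0<..<h} \<tau>) + indicator {h..} \<tau> * second_diff U x (\<tau> *\<^sub>R \<xi>)"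
      if "h \<le> \<tau>" for \<tau>
      using that le[of "x + \<tau> *\<^sub>R \<xi>"] le[of "x - \<tau> *\<^sub>R \<xi>"] xU by (simp add: second_diff_def)
  qed
  from I_plus_nonnegD[OF I this \<eta>] show "\<exists>e. frame k e \<and> - \<eta> \<le> (\<Sum>i<k. 4 * q * near h + far h U x (e i)) + m * U x"
    by (simp add: xU(2))
qed

lemma paraboloid_supersolutionI:
  fixes v :: "'a::euclidean_space \<Rightarrow> real"
  assumes v: "visc_supersolution (I_plus s k (C * m)) \<Omega> v" and \<Omega>: "open \<Omega>" and nonneg: "\<And>x. 0 \<le> v x"
  shows "paraboloid_supersolution k m \<Omega> (\<lambda>x. if x \<in> \<Omega> then v x else 0)"
  unfolding paraboloid_supersolution_def
proof (intro allI impI)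
  define V where "V = (\<lambda>x. if x \<in> \<Omega> then v x else 0)"
  have Linf: "L_infty V" unfolding V_def
    by (rule L_infty_cutoff(1)[OF _ \<Omega>]) (use v in \<open>simp add: visc_supersolution_def\<close>)
  fix x a b :: 'a and q h :: real and e :: "nat \<Rightarrow> 'a"
  assume x: "x \<in> \<Omega>" and h: "0 < h" and e: "frame k e"
    and min: "\<forall>p. V x + q * ((norm (x - a))\<^sup>2 + (norm (x - b))\<^sup>2) \<le> V p + q * ((norm (p - a))\<^sup>2 + (norm (p - b))\<^sup>2)"
  define \<phi> where "\<phi> = (\<lambda>p. (- q) * ((norm (p - a))\<^sup>2 + (norm (p - b))\<^sup>2))"
  have xV: "V x = v x" using x by (simp add: V_def)
  have le: "V p \<le> v p" for p using nonneg[of p] by (auto simp: V_def)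
  have "v x - \<phi> x \<le> v p - \<phi> p" for p
    using min[rule_format, of p] le[of p] xV by (simp add: \<phi>_def)
  moreover have "C2_on (ball x h) \<phi>" unfolding \<phi>_def by (rule C2_on_paraboloid)
  ultimately have I: "I_plus s k (C * m) h \<phi> v x \<le> 0"
    using v x h unfolding visc_supersolution_def by blast
  have "ereal (- 4 * q * near h + far h V x \<xi>) \<le> visc_directional s h \<phi> v x \<xi>" if \<xi>: "norm \<xi> = 1" for \<xi>
    unfolding integral_near_add_far(2)[OF Linf h, symmetric]
  proof (rule visc_directional_ge[OF integral_near_add_far(1)[OF Linf h] h])
    show "- 4 * q * (\<tau>\<^sup>2 * indicator {0<..<h} \<tau>) + indicator {h..} \<tau> * second_diff V x (\<tau> *\<^sub>R \<xi>) \<le> second_diff \<phi> x (\<tau> *\<^sub>R \<xi>)"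
      if "0 < \<tau>" "\<tau> < h" for \<tau>
      using that unfolding \<phi>_def second_diff_paraboloid[OF \<xi>] by simp
    show "- 4 * q * (\<tau>\<^sup>2 * indicator {0<..<h} \<tau>) + indicator {h..} \<tau> * second_diff V x (\<tau> *\<^sub>R \<xi>) \<le> second_diff v x (\<tau> *\<^sub>R \<xi>)"
      if "h \<le> \<tau>" for \<tau>
      using that le[of "x + \<tau> *\<^sub>R \<xi>"] le[of "x - \<tau> *\<^sub>R \<xi>"] xV by (simp add: second_diff_def)
  qed
  from I_plus_nonposD[OF I this e] show "(\<Sum>i<k. - 4 * q * near h + far h V x (e i)) + m * V x \<le> 0"
    by (simp add: xV)
qed

end

section \<open>Comparison below the principal eigenvalue\<close>

lemma mult_le_abs_mult: "0 \<le> b \<Longrightarrow> b \<le> c \<Longrightarrow> m * b \<le> \<bar>m\<bar> * c" for m b c :: real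
  by (rule order_trans[OF mult_right_mono[OF abs_ge_self] mult_left_mono]) auto

context concave_level_domain
begin

lemma small_radius_exists:
  assumes "0 < c" "0 < D"
  obtains h where "0 < h" "near h \<le> c" "2 * h * R + h\<^sup>2 < D"
proof -
  have "((\<lambda>h. 2 * h * R + h\<^sup>2) \<longlongrightarrow> 2 * 0 * R + 0\<^sup>2) (at_right 0)" by (intro tendsto_intros)
  then have "\<forall>\<^sub>F h in at_right 0. 2 * h * R + h\<^sup>2 < D" using assms(2) by (auto dest: order_tendstoD(2))
  moreover have "\<forall>\<^sub>F h in at_right 0. near h < c" using order_tendstoD(2)[OF near_tendsto_0 assms(1)] .
  moreover have "\<forall>\<^sub>F h in at_right 0. (0::real) < h" by (rule eventually_at_right_less)
  ultimately have "\<forall>\<^sub>F h in at_right 0. 0 < h \<and> near h \<le> c \<and> 2 * h * R + h\<^sup>2 < D" by eventually_elim auto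
  then obtain h where "0 < h \<and> near h \<le> c \<and> 2 * h * R + h\<^sup>2 < D"
    using eventually_happens'[OF trivial_limit_at_right_real] by blast
  then show ?thesis using that by blast
qed

text \<open>With \<open>q\<close> fixed, \<open>h\<close> tends to 0 and removes the paraboloids,
  while the translation inequality cancels the nonlocal terms of \<open>U\<close> against those of
  \<open>V\<close> up to that of the barrier. The latter is evaluated at its own point
  \<open>z\<close>, where \<open>far_barrier\<close> applies with \<open>h\<close> small relative to
  \<open>d z\<close>.\<close>

lemma doubled_inequality:
  fixes U V :: "'a \<Rightarrow> real"
  assumes U: "L_infty U" "paraboloid_subsolution k m U"
    and V: "L_infty V" "paraboloid_supersolution k m' \<Omega> V" and a: "0 \<le> a"
    and x: "0 < U x" and y: "y \<in> \<Omega>" and z: "z \<in> \<Omega>" and q: "0 < q"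
    and maxU: "\<And>p. U p - q * ((norm (p - y))\<^sup>2 + (norm (p - z))\<^sup>2) \<le> U x - q * ((norm (x - y))\<^sup>2 + (norm (x - z))\<^sup>2)"
    and minV: "\<And>p. V y + q * (norm (y - x))\<^sup>2 \<le> V p + q * (norm (p - x))\<^sup>2"
    and sum: "\<And>h. U (x + h) - V (y + h) - a * barrier 0 (z + h) \<le> U x - V y - a * barrier 0 z"
  shows "0 \<le> m * U x - m' * V y - a * real k * barrier_const * d z powr (- s / 2)"
proof (rule field_le_epsilon)
  fix \<eta> :: real assume \<eta>: "0 < \<eta>"
  \<comment> \<open>\<open>6 * q\<close> collects \<open>4 * q\<close> from \<open>U\<close> and
    \<open>2 * q\<close> from \<open>V\<close>, whose single penalty term is read as a paraboloid of
    weight \<open>q / 2\<close> with equal centres.\<close>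
  define c where "c = \<eta> / 2 / (6 * q * real k + 1)"
  have "0 \<le> 6 * q * real k" using q by simp
  then have den: "0 < 6 * q * real k + 1" by linarith
  then have c: "0 < c" using \<eta> by (simp add: c_def)
  have dz: "0 < d z" using z by (simp add: \<Omega>_eq)
  obtain h where h: "0 < h" "near h \<le> c" "2 * h * R + h\<^sup>2 < d z + 0"
    using small_radius_exists[OF c dz] by auto
  have "\<exists>e. frame k e \<and> - (\<eta> / 2) \<le> (\<Sum>i<k. 4 * q * near h + far h U x (e i)) + m * U x"
    using U(2) x h(1) \<eta> maxU unfolding paraboloid_subsolution_def by (meson half_gt_zero)
  then obtain e where e: "frame k e"
    and 1: "- (\<eta> / 2) \<le> (\<Sum>i<k. 4 * q * near h + far h U x (e i)) + m * U x" by blast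
  have "V y + q / 2 * ((norm (y - x))\<^sup>2 + (norm (y - x))\<^sup>2) \<le> V p + q / 2 * ((norm (p - x))\<^sup>2 + (norm (p - x))\<^sup>2)" for p
    using minV[of p] by simp
  then have 2: "(\<Sum>i<k. - 4 * (q / 2) * near h + far h V y (e i)) + m' * V y \<le> 0"
    using V(2) y h(1) e unfolding paraboloid_supersolution_def by blast
  have "far h U x (e i) \<le> far h V y (e i) - a * (barrier_const * d z powr (- s / 2))" if "i < k" for i
  proof -
    have B: "L_infty (barrier 0)" by (rule L_infty_barrier) simp
    have aB: "L_infty (\<lambda>p. a * barrier 0 p)" using B by (rule L_infty_cmult)
    have "far h U x (e i) \<le> far h V y (e i) + far h (\<lambda>p. a * barrier 0 p) z (e i)"
    proof (rule far_le_add[OF U(1) V(1) aB h(1)])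
      fix \<tau> :: real
      show "second_diff U x (\<tau> *\<^sub>R e i) \<le> second_diff V y (\<tau> *\<^sub>R e i) + second_diff (\<lambda>p. a * barrier 0 p) z (\<tau> *\<^sub>R e i)"
        using sum[of "\<tau> *\<^sub>R e i"] sum[of "- \<tau> *\<^sub>R e i"] by (simp add: second_diff_def)
    qed
    also have "far h (\<lambda>p. a * barrier 0 p) z (e i) = a * far h (barrier 0) z (e i)" by (rule far_cmult)
    also have "\<dots> \<le> a * (- barrier_const * (d z + 0) powr (- s / 2))"
      using e that by (intro mult_left_mono far_barrier h z a) (auto simp: frame_def)
    finally show ?thesis by simp
  qed
  then have "(\<Sum>i<k. 4 * q * near h + far h U x (e i))
     \<le> (\<Sum>i<k. 6 * q * near h - a * (barrier_const * d z powr (- s / 2)) + (- 4 * (q / 2) * near h + far h V y (e i)))"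
    by (intro sum_mono) auto
  also have "\<dots> = real k * (6 * q * near h - a * (barrier_const * d z powr (- s / 2)))
     + (\<Sum>i<k. - 4 * (q / 2) * near h + far h V y (e i))"
    by (simp only: sum.distrib sum_constant card_lessThan)
  finally have "- (\<eta> / 2) \<le> 6 * q * real k * near h - a * real k * barrier_const * d z powr (- s / 2) - m' * V y + m * U x"
    using 1 2 by (simp add: algebra_simps)
  moreover have "6 * q * real k * near h \<le> (6 * q * real k + 1) * c"
    using h(2) near_nonneg[of h] q by (intro mult_mono) auto
  moreover have "(6 * q * real k + 1) * c = \<eta> / 2"
    unfolding c_def using den by (metis less_irrefl nonzero_mult_div_cancel_left times_divide_eq_right)
  ultimately show "0 \<le> m * U x - m' * V y - a * real k * barrier_const * d z powr (- s / 2) + \<eta>" by linarith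
qed

text \<open>Yields at a true maximum point the inequality that smooth functions would satisfy there.
  Convergence of \<open>U (x j)\<close> and \<open>V (y j)\<close> to the values at
  \<open>x0\<close> lets the zero-order terms pass to the limit whatever the signs of
  \<open>m\<close> and \<open>m'\<close>.\<close>

lemma comparison_at_maximum:
  fixes U V :: "'a \<Rightarrow> real"
  assumes U: "usc U" "L_infty U" "paraboloid_subsolution k m U" "\<And>x. 0 < U x \<Longrightarrow> x \<in> \<Omega>"
    and V: "usc (\<lambda>x. - V x)" "L_infty V" "paraboloid_supersolution k m' \<Omega> V" "\<And>x. 0 \<le> V x"
    and a: "0 \<le> a" and pos: "V p0 + a * barrier 0 p0 < U p0"
  obtains x0 where "x0 \<in> \<Omega>"
    "\<And>p. U p - V p - a * barrier 0 p \<le> U x0 - V x0 - a * barrier 0 x0"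
    "0 \<le> m * U x0 - m' * V x0 - a * real k * barrier_const * d x0 powr (- s / 2)"
proof -
  obtain B where B: "\<And>x. \<bar>U x\<bar> \<le> B" using L_inftyE[OF U(2)] by metis
  have U_bd: "bounded {x. 0 < U x}" by (rule bounded_subset[OF bounded_\<Omega>]) (use U(4) in auto)
  have U_le: "U x \<le> B" for x using B[of x] by simp
  have cont: "continuous_on UNIV (\<lambda>x. a * barrier 0 x)" by (intro continuous_intros continuous_barrier)
  have W0: "0 \<le> a * barrier 0 x" for x using a barrier_nonneg by simp
  have pos': "0 < U p0 - V p0 - a * barrier 0 p0" using pos by simp
  show ?thesis
  proof (rule doubling_variables[OF U(1) V(1) cont U_bd U_le V(4) W0 pos'])
    fix x0 x y z q assume lim: "x \<longlonglongrightarrow> x0" "y \<longlonglongrightarrow> x0" "z \<longlonglongrightarrow> x0"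
      "(\<lambda>j. U (x j)) \<longlonglongrightarrow> U x0" "(\<lambda>j. V (y j)) \<longlonglongrightarrow> V x0"
      and max: "\<And>p. U p - V p - a * barrier 0 p \<le> U x0 - V x0 - a * barrier 0 x0"
      and q: "\<And>j :: nat. 0 < q j"
      and maxU: "\<And>j p. U p - q j * ((norm (p - y j))\<^sup>2 + (norm (p - z j))\<^sup>2)
        \<le> U (x j) - q j * ((norm (x j - y j))\<^sup>2 + (norm (x j - z j))\<^sup>2)"
      and minV: "\<And>j p. V (y j) + q j * (norm (y j - x j))\<^sup>2 \<le> V p + q j * (norm (p - x j))\<^sup>2"
      and sum: "\<And>j h. U (x j + h) - V (y j + h) - a * barrier 0 (z j + h) \<le> U (x j) - V (y j) - a * barrier 0 (z j)"
    have "0 < U x0 - V x0 - a * barrier 0 x0" using max[of p0] pos by simp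
    then have Ux0: "0 < U x0" using V(4)[of x0] W0[of x0] by linarith
    then have x0: "x0 \<in> \<Omega>" using U(4) by simp
    then have dx0: "0 < d x0" by (simp add: \<Omega>_eq)
    have "\<forall>\<^sub>F j in sequentially. 0 \<le> m * U (x j) - m' * V (y j) - a * real k * barrier_const * d (z j) powr (- s / 2)"
      using topological_tendstoD[OF lim(2) open_\<Omega> x0] topological_tendstoD[OF lim(3) open_\<Omega> x0]
        order_tendstoD(1)[OF lim(4) Ux0]
    proof eventually_elim
      case (elim j)
      show ?case
        by (rule doubled_inequality[OF U(2,3) V(2,3) a elim(3) elim(1,2) q maxU minV sum])
    qed
    moreover have "(\<lambda>j. m * U (x j) - m' * V (y j) - a * real k * barrier_const * d (z j) powr (- s / 2))
      \<longlonglongrightarrow> m * U x0 - m' * V x0 - a * real k * barrier_const * d x0 powr (- s / 2)"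
    proof -
      have "(\<lambda>j. d (z j)) \<longlonglongrightarrow> d x0" using lim(3) by (rule tendsto_d)
      then show ?thesis using dx0 lim by (intro tendsto_intros) auto
    qed
    ultimately have "0 \<le> m * U x0 - m' * V x0 - a * real k * barrier_const * d x0 powr (- s / 2)"
      by (intro tendsto_lowerbound[OF _ _ sequentially_bot]) auto
    with x0 max show ?thesis by (intro that[of x0]) auto
  qed
qed

lemma d_powr_lower: "x \<in> \<Omega> \<Longrightarrow> (R\<^sup>2) powr (- s / 2) \<le> d x powr (- s / 2)"
  using d_le[of x] s_pos by (intro powr_mono2') (auto simp: \<Omega>_eq)

text \<open>At a positive maximum of \<open>U - M * barrier 0\<close> the barrier term, bounded
  below through \<open>d \<le> R\<^sup>2\<close>, would exceed \<open>m * U\<close>. The bound makes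
  the set of admissible factors \<open>\<theta>\<close> nonempty later.\<close>

lemma subsolution_le_barrier:
  assumes k: "1 \<le> k" and U: "usc U" "L_infty U" "paraboloid_subsolution k m U" "\<And>x. 0 < U x \<Longrightarrow> x \<in> \<Omega>"
  obtains M where "0 < M" "\<And>x. U x \<le> M * barrier 0 x"
proof -
  obtain B where B: "0 < B" "\<And>x. \<bar>U x\<bar> \<le> B" using L_inftyE[OF U(2)] by metis
  define \<beta> where "\<beta> = real k * barrier_const * (R\<^sup>2) powr (- s / 2)"
  have \<beta>: "0 < \<beta>" using k barrier_const_pos R_pos by (simp add: \<beta>_def)
  \<comment> \<open>\<open>M * \<beta>\<close> is then one more than the zero-order term can
    reach.\<close>
  define M where "M = (\<bar>m\<bar> * B + 1) / \<beta>"
  have "0 \<le> \<bar>m\<bar> * B" using B by simp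
  then have M: "0 < M" using \<beta> by (simp add: M_def)
  have "U p \<le> M * barrier 0 p" for p
  proof (rule ccontr)
    assume "\<not> U p \<le> M * barrier 0 p"
    then have p: "0 + M * barrier 0 p < U p" by simp
    have zero: "usc (\<lambda>x::'a. - (0::real))" "L_infty (\<lambda>x::'a. 0)"
      by (auto intro: usc_continuous L_inftyI[of _ 0])
    obtain x0 where x0: "x0 \<in> \<Omega>" "0 \<le> m * U x0 - m * 0 - M * real k * barrier_const * d x0 powr (- s / 2)"
      by (rule comparison_at_maximum[OF U zero paraboloid_supersolution_zero order_refl less_imp_le[OF M] p])
    have "m * U x0 \<le> \<bar>m\<bar> * B"
      using B(2)[of x0] abs_ge_self[of "m * U x0"] mult_left_mono[of "\<bar>U x0\<bar>" B "\<bar>m\<bar>"] by (simp add: abs_mult)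
    moreover have "M * \<beta> \<le> M * (real k * barrier_const * d x0 powr (- s / 2))"
      unfolding \<beta>_def using M k barrier_const_pos d_powr_lower[OF x0(1)] by (intro mult_left_mono) auto
    moreover have "M * \<beta> = \<bar>m\<bar> * B + 1" using \<beta> by (simp add: M_def)
    ultimately show False using x0(2) by (simp add: mult.assoc)
  qed
  with M that show ?thesis by blast
qed

text \<open>Two regimes. Where \<open>d\<close> is small, \<open>d powr (- s / 2)\<close> outweighs
  \<open>m * barrier 0\<close>. Elsewhere \<open>V\<close> has a positive minimum by compactness,
  and \<open>(m' - m) * V\<close> pays for the perturbation if \<open>\<delta>\<close> is
  small.\<close>

lemma strict_supersolution_constants:
  fixes V :: "'a \<Rightarrow> real"
  assumes k: "1 \<le> k" and m: "m < m'" and V: "usc (\<lambda>x. - V x)" "\<And>x. x \<in> \<Omega> \<Longrightarrow> 0 < V x"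
  obtains \<delta> c where "0 < \<delta>" "0 < c"
    "\<And>x. x \<in> \<Omega> \<Longrightarrow> (m - m') * V x + \<delta> * (m * barrier 0 x - real k * barrier_const * d x powr (- s / 2)) \<le> - c"
proof -
  define \<kappa> where "\<kappa> = real k * barrier_const"
  have \<kappa>: "0 < \<kappa>" using k barrier_const_pos by (simp add: \<kappa>_def)
  \<comment> \<open>The power makes \<open>d x \<le> \<eta>\<close> imply
    \<open>\<bar>m\<bar> + 1 \<le> \<kappa> * d x powr (- s / 2)\<close>; the cap 1 keeps the
    barrier at most 1 there.\<close>
  define \<eta> where "\<eta> = min 1 ((\<kappa> / (\<bar>m\<bar> + 1)) powr (2 / s))"
  have \<eta>: "0 < \<eta>" "\<eta> \<le> 1" using \<kappa> by (auto simp: \<eta>_def)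
  have near: "m * barrier 0 x - \<kappa> * d x powr (- s / 2) \<le> - 1" if x: "x \<in> \<Omega>" "d x \<le> \<eta>" for x
  proof -
    have dx: "0 < d x" using x by (simp add: \<Omega>_eq)
    have "barrier 0 x = d x powr (s / 2)" using dx by (simp add: barrier_def)
    also have "\<dots> \<le> 1 powr (s / 2)" using dx x \<eta> s_pos by (intro powr_mono2) auto
    finally have "m * barrier 0 x \<le> \<bar>m\<bar> * 1"
      using barrier_nonneg[of 0 x] by (intro mult_le_abs_mult) auto
    moreover have "d x powr (s / 2) \<le> ((\<kappa> / (\<bar>m\<bar> + 1)) powr (2 / s)) powr (s / 2)"
      using dx x s_pos by (intro powr_mono2) (auto simp: \<eta>_def)
    then have "d x powr (s / 2) \<le> \<kappa> / (\<bar>m\<bar> + 1)" using s_pos \<kappa> by (simp add: powr_powr)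
    then have "\<bar>m\<bar> + 1 \<le> \<kappa> * d x powr (- s / 2)"
      using dx by (simp add: powr_minus field_simps)
    ultimately show ?thesis by simp
  qed
  have "\<exists>c>0. \<forall>x. \<eta> \<le> d x \<longrightarrow> c \<le> V x"
  proof (cases "{x. \<eta> \<le> d x} = {}")
    case True
    then show ?thesis by (intro exI[of _ 1]) auto
  next
    case False
    have "{x. \<eta> \<le> d x} \<subseteq> \<Omega>" using \<eta> by (auto simp: \<Omega>_eq)
    then have "compact {x. \<eta> \<le> d x}"
      unfolding compact_eq_bounded_closed
      using bounded_\<Omega> bounded_subset by (auto intro!: closed_Collect_le continuous_d)
    then obtain x where x: "x \<in> {x. \<eta> \<le> d x}" "\<And>y. y \<in> {x. \<eta> \<le> d x} \<Longrightarrow> - V y \<le> - V x"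
      using usc_attains[OF _ False V(1)] by metis
    then show ?thesis using V(2)[of x] \<eta> by (intro exI[of _ "V x"]) (auto simp: \<Omega>_eq)
  qed
  then obtain c where c: "0 < c" "\<And>x. \<eta> \<le> d x \<Longrightarrow> c \<le> V x" by blast
  define D where "D = \<bar>m\<bar> * (R\<^sup>2 + 1) powr (s / 2) + 1"
  have D: "0 < D" by (simp add: D_def add_nonneg_pos)
  \<comment> \<open>The perturbation, at most \<open>\<delta> * D\<close>, then costs half of
    \<open>(m' - m) * c\<close>.\<close>
  define \<delta> where "\<delta> = (m' - m) * c / 2 / D"
  have \<delta>: "0 < \<delta>" using m c D by (simp add: \<delta>_def)
  show ?thesis
  proof (rule that[of \<delta> "min \<delta> ((m' - m) * c / 2)"])
    show "0 < \<delta>" "0 < min \<delta> ((m' - m) * c / 2)" using \<delta> m c by auto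
    fix x assume x: "x \<in> \<Omega>"
    show "(m - m') * V x + \<delta> * (m * barrier 0 x - real k * barrier_const * d x powr (- s / 2)) \<le> - min \<delta> ((m' - m) * c / 2)"
    proof (cases "d x \<le> \<eta>")
      case True
      have "(m - m') * V x \<le> 0" using m V(2)[OF x] by (simp add: mult_le_0_iff)
      moreover have "\<delta> * (m * barrier 0 x - \<kappa> * d x powr (- s / 2)) \<le> \<delta> * (- 1)"
        using near[OF x True] \<delta> by (intro mult_left_mono) auto
      ultimately show ?thesis unfolding \<kappa>_def by (simp add: min_def)
    next
      case False
      have "(m' - m) * c \<le> (m' - m) * V x" using c(2)[of x] False m by (intro mult_left_mono) auto
      moreover have "m * barrier 0 x \<le> \<bar>m\<bar> * (R\<^sup>2 + 1) powr (s / 2)"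
        using barrier_nonneg[of 0 x] barrier_le[of 0 x] by (intro mult_le_abs_mult) auto
      then have "m * barrier 0 x - \<kappa> * d x powr (- s / 2) \<le> D" using \<kappa> by (simp add: D_def) (smt (verit) mult_nonneg_nonneg powr_ge_zero)
      then have "\<delta> * (m * barrier 0 x - \<kappa> * d x powr (- s / 2)) \<le> \<delta> * D" using \<delta> by (intro mult_left_mono) auto
      moreover have "\<delta> * D = (m' - m) * c / 2" using D by (simp add: \<delta>_def)
      moreover have "(m - m') * V x = - ((m' - m) * V x)" by (simp add: algebra_simps)
      ultimately have "(m - m') * V x + \<delta> * (m * barrier 0 x - \<kappa> * d x powr (- s / 2)) \<le> - ((m' - m) * c / 2)"
        by linarith
      also have "\<dots> \<le> - min \<delta> ((m' - m) * c / 2)" by simp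
      finally show ?thesis unfolding \<kappa>_def .
    qed
  qed
qed

text \<open>Comparison requires a positive excess, so it is applied at
  \<open>t = \<theta> - \<kappa>\<close>, where \<open>U \<le> t * Z\<close> fails. The excess
  \<open>w\<close> is at most \<open>\<kappa> * Z\<close>, and for small \<open>\<kappa>\<close> the
  strictness \<open>- t * c\<close> outweighs \<open>m * w\<close> even for positive
  \<open>m\<close>.\<close>

lemma maximum_principle_paraboloid:
  fixes U V :: "'a \<Rightarrow> real"
  assumes k: "1 \<le> k" and m: "m < m'"
    and U: "usc U" "L_infty U" "paraboloid_subsolution k m U" "\<And>x. 0 < U x \<Longrightarrow> x \<in> \<Omega>"
    and V: "usc (\<lambda>x. - V x)" "L_infty V" "paraboloid_supersolution k m' \<Omega> V" "\<And>x. 0 \<le> V x" "\<And>x. x \<in> \<Omega> \<Longrightarrow> 0 < V x"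
  shows "U x \<le> 0"
proof (rule ccontr)
  assume "\<not> U x \<le> 0"
  then have Ux: "0 < U x" by simp
  obtain M where M: "0 < M" "\<And>x. U x \<le> M * barrier 0 x" using subsolution_le_barrier[OF k U] by blast
  obtain \<delta> c where \<delta>: "0 < \<delta>" and c: "0 < c"
    and strict: "\<And>x. x \<in> \<Omega> \<Longrightarrow> (m - m') * V x + \<delta> * (m * barrier 0 x - real k * barrier_const * d x powr (- s / 2)) \<le> - c"
    using strict_supersolution_constants[OF k m V(1,5)] by blast
  define Z where "Z p = V p + \<delta> * barrier 0 p" for p
  have Z0: "0 \<le> Z p" for p using V(4)[of p] \<delta> barrier_nonneg[of 0 p] by (simp add: Z_def)
  obtain BV where BV: "\<And>p. \<bar>V p\<bar> \<le> BV" using L_inftyE[OF V(2)] by metis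
  define ZM where "ZM = BV + \<delta> * (R\<^sup>2 + 1) powr (s / 2)"
  have ZM: "Z p \<le> ZM" for p
    unfolding Z_def ZM_def using BV[of p] barrier_le[of 0 p] \<delta> by (intro add_mono mult_left_mono) auto
  define A where "A = {\<theta>. 0 \<le> \<theta> \<and> (\<forall>p. U p \<le> \<theta> * Z p)}"
  have "M / \<delta> \<in> A"
  proof -
    have "U p \<le> M / \<delta> * Z p" for p
    proof -
      have "0 \<le> M / \<delta> * V p" using M \<delta> V(4)[of p] by simp
      then show ?thesis using M(2)[of p] \<delta> by (simp add: Z_def distrib_left)
    qed
    then show ?thesis using M \<delta> by (simp add: A_def)
  qed
  define \<theta> where "\<theta> = Inf A"
  have bdd: "bdd_below A" by (rule bdd_belowI[of _ 0]) (simp add: A_def)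
  have Zx: "0 < Z x"
    using V(5)[OF U(4)[OF Ux]] \<delta> barrier_nonneg[of 0 x] by (simp add: Z_def add_pos_nonneg)
  have "U x / Z x \<le> \<theta>" unfolding \<theta>_def
    using \<open>M / \<delta> \<in> A\<close> Zx by (intro cInf_greatest) (auto simp: A_def field_simps)
  then have \<theta>: "0 < \<theta>" using Ux Zx by (meson divide_pos_pos less_le_trans)
  have \<theta>_le: "U p \<le> \<theta> * Z p" for p
  proof (cases "0 < Z p")
    case True
    have "U p / Z p \<le> \<theta>" unfolding \<theta>_def
      using \<open>M / \<delta> \<in> A\<close> True by (intro cInf_greatest) (auto simp: A_def field_simps)
    then show ?thesis using True by (simp add: field_simps)
  next
    case False
    then show ?thesis using Z0[of p] \<open>M / \<delta> \<in> A\<close> by (auto simp: A_def dest: spec[of _ p])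
  qed
  have ZM0: "0 < ZM" using Zx ZM[of x] by simp
  \<comment> \<open>\<open>\<kappa> * (c + \<bar>m\<bar> * ZM) = \<theta> * c / 2\<close> gives both
    \<open>\<kappa> < \<theta>\<close> and \<open>\<kappa> * \<bar>m\<bar> * ZM < t * c\<close>,
    which is the final contradiction.\<close>
  define \<kappa> where "\<kappa> = \<theta> * c / (2 * (c + \<bar>m\<bar> * ZM))"
  have den: "0 < c + \<bar>m\<bar> * ZM" using c ZM0 by (intro add_pos_nonneg) auto
  have \<kappa>: "0 < \<kappa>" using \<theta> c den by (simp add: \<kappa>_def)
  have \<kappa>_eq: "\<kappa> * (c + \<bar>m\<bar> * ZM) = \<theta> * c / 2" using den unfolding \<kappa>_def by (simp add: field_simps)
  have \<kappa>_less: "\<kappa> < \<theta>"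
  proof -
    have "\<kappa> * c \<le> \<kappa> * (c + \<bar>m\<bar> * ZM)" using \<kappa> ZM0 by (intro mult_left_mono) auto
    also have "\<dots> < \<theta> * c" unfolding \<kappa>_eq using \<theta> c by simp
    finally show ?thesis using c by simp
  qed
  define t where "t = \<theta> - \<kappa>"
  have t: "0 < t" using \<kappa>_less by (simp add: t_def)
  have "t \<notin> A"
  proof
    assume "t \<in> A"
    then have "\<theta> \<le> t" unfolding \<theta>_def by (rule cInf_lower[OF _ bdd])
    then show False using \<kappa> by (simp add: t_def)
  qed
  then obtain p0 where "t * Z p0 < U p0" using t by (auto simp: A_def not_le)
  then have p0: "t * V p0 + (t * \<delta>) * barrier 0 p0 < U p0" by (simp add: Z_def algebra_simps)
  have tV: "usc (\<lambda>x. - (t * V x))" using usc_cmult[OF V(1) t] by simp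
  have LtV: "L_infty (\<lambda>x. t * V x)" using V(2) by (rule L_infty_cmult)
  have "0 \<le> t * V x" "0 \<le> t * \<delta>" for x using t \<delta> V(4)[of x] by auto
  then obtain x0 where x0: "x0 \<in> \<Omega>"
    "\<And>p. U p - t * V p - (t * \<delta>) * barrier 0 p \<le> U x0 - t * V x0 - (t * \<delta>) * barrier 0 x0"
    "0 \<le> m * U x0 - m' * (t * V x0) - (t * \<delta>) * real k * barrier_const * d x0 powr (- s / 2)"
    using comparison_at_maximum[OF U tV LtV paraboloid_supersolution_cmult[OF V(3) t] _ _ p0] by blast
  define w where "w = U x0 - t * Z x0"
  have "0 < w" using x0(2)[of p0] p0 by (simp add: w_def Z_def algebra_simps)
  have "w \<le> \<kappa> * Z x0" using \<theta>_le[of x0] by (simp add: w_def t_def algebra_simps)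
  also have "\<dots> \<le> \<kappa> * ZM" using ZM \<kappa> by (intro mult_left_mono) auto
  finally have "\<bar>m\<bar> * w \<le> \<bar>m\<bar> * (\<kappa> * ZM)" by (intro mult_left_mono) auto
  moreover have "m * w \<le> \<bar>m\<bar> * w" using \<open>0 < w\<close> by (intro mult_right_mono) auto
  moreover have "m * U x0 - m' * (t * V x0) - (t * \<delta>) * real k * barrier_const * d x0 powr (- s / 2)
     = t * ((m - m') * V x0 + \<delta> * (m * barrier 0 x0 - real k * barrier_const * d x0 powr (- s / 2))) + m * w"
    by (simp add: w_def Z_def algebra_simps)
  moreover have "t * ((m - m') * V x0 + \<delta> * (m * barrier 0 x0 - real k * barrier_const * d x0 powr (- s / 2))) \<le> t * (- c)"
    using strict[OF x0(1)] t by (intro mult_left_mono) auto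
  ultimately have "0 \<le> t * (- c) + \<bar>m\<bar> * (\<kappa> * ZM)" using x0(3) by linarith
  also have "\<dots> = \<kappa> * (c + \<bar>m\<bar> * ZM) - \<theta> * c" by (simp add: t_def algebra_simps)
  also have "\<dots> < 0" unfolding \<kappa>_eq using \<theta> c by simp
  finally show False by simp
qed

lemma maximum_principle_below_mu_plus:
  assumes k: "1 \<le> k" and \<mu>: "ereal (C * m) < mu_plus s k \<Omega>"
  shows "maximum_principle (I_plus s k (C * m)) \<Omega>"
  unfolding maximum_principle_def
proof (intro allI impI ballI)
  fix u x
  assume u: "usc_on (closure \<Omega>) u" "L_infty u" "visc_subsolution (I_plus s k (C * m)) \<Omega> u"
    and out: "\<forall>x. x \<notin> \<Omega> \<longrightarrow> u x \<le> 0" and x: "x \<in> \<Omega>"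
  from \<mu> obtain \<mu>' v where \<mu>': "C * m < \<mu>'" and v: "L_infty v" "lsc_on \<Omega> v" "\<forall>x\<in>\<Omega>. 0 < v x" "\<forall>x. 0 \<le> v x"
      "visc_supersolution (I_plus s k \<mu>') \<Omega> v"
    unfolding mu_plus_def less_SUP_iff by auto
  define m' where "m' = \<mu>' / C"
  have m': "\<mu>' = C * m'" "m < m'" using C_pos \<mu>' by (auto simp: m'_def field_simps)
  define U V where "U = (\<lambda>x. if x \<in> \<Omega> then max 0 (u x) else 0)" and "V = (\<lambda>x. if x \<in> \<Omega> then v x else 0)"
  have "U x \<le> 0"
  proof (rule maximum_principle_paraboloid[OF k m'(2)])
    show "usc U" unfolding U_def using u(1) open_\<Omega> out by (intro usc_cutoff) auto
    show "L_infty U" unfolding U_def using u(2) open_\<Omega> by (rule L_infty_cutoff)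
    show "paraboloid_subsolution k m U"
      unfolding U_def using u(3) open_\<Omega> out by (intro paraboloid_subsolutionI) auto
    show "0 < U x \<Longrightarrow> x \<in> \<Omega>" for x by (auto simp: U_def split: if_splits)
    show "usc (\<lambda>x. - V x)" unfolding V_def using v open_\<Omega> by (intro usc_minus_cutoff) auto
    show "L_infty V" unfolding V_def using v(1) open_\<Omega> by (rule L_infty_cutoff)
    show "paraboloid_supersolution k m' \<Omega> V"
      unfolding V_def using v(4,5) open_\<Omega> m' by (intro paraboloid_supersolutionI) auto
    show "0 \<le> V x" for x using v(4) by (auto simp: V_def)
    show "x \<in> \<Omega> \<Longrightarrow> 0 < V x" for x using v(3) by (auto simp: V_def)
  qed
  then show "u x \<le> 0" using x by (simp add: U_def)
qed

end

section \<open>Gaussians and bumps\<close>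

lemma C2_on_gaussian: "C2_on S (\<lambda>p. \<theta> * exp (- A * (p \<bullet> p)))"
  unfolding C2_on_def
proof (intro exI conjI ballI)
  show "((\<lambda>p. \<theta> * exp (- A * (p \<bullet> p))) has_derivative
     (\<lambda>h. ((- 2 * A * \<theta> * exp (- A * (x \<bullet> x))) *\<^sub>R x) \<bullet> h)) (at x)" for x
    by (auto intro!: derivative_eq_intros simp: inner_commute algebra_simps)
  show "((\<lambda>x. (- 2 * A * \<theta> * exp (- A * (x \<bullet> x))) *\<^sub>R x) has_derivative
     blinfun_apply ((- 2 * A * \<theta> * exp (- A * (x \<bullet> x))) *\<^sub>R
       (id_blinfun - (2 * A) *\<^sub>R (blinfun_scaleR_left x o\<^sub>L blinfun_inner_left x)))) (at x)" for x :: 'a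
    by (auto intro!: derivative_eq_intros
      simp: scaleR_blinfun.rep_eq minus_blinfun.rep_eq inner_commute algebra_simps fun_eq_iff)
  show "continuous_on S (\<lambda>x. (- 2 * A * \<theta> * exp (- A * (x \<bullet> x))) *\<^sub>R
       (id_blinfun - (2 * A) *\<^sub>R (blinfun_scaleR_left x o\<^sub>L blinfun_inner_left x)))"
    by (intro continuous_intros bounded_bilinear.continuous_on[OF bounded_bilinear_blinfun_compose]
        bounded_linear.continuous_on[OF bounded_linear_blinfun_scaleR_left]
        bounded_linear.continuous_on[OF bounded_linear_blinfun_inner_left])
qed

text \<open>\<open>f x * g x < c\<close> means \<open>f x - c / g x < 0\<close>, a statement about a
  sum; this covers \<open>f\<close> of either sign.\<close>

lemma usc_mult_continuous:
  fixes f g :: "'a::topological_space \<Rightarrow> real"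
  assumes "usc f" "continuous_on UNIV g" "\<And>x. 0 < g x"
  shows "usc (\<lambda>x. f x * g x)"
  unfolding usc_def
proof
  fix c
  have "g x \<noteq> 0" for x using assms(3)[of x] by simp
  then have "usc (\<lambda>x. f x + - (c / g x))"
    using assms(2) by (intro usc_add[OF assms(1)] usc_continuous continuous_intros) auto
  then have "open {x. f x + - (c / g x) < 0}" unfolding usc_def by blast
  moreover have "f x + - (c / g x) < 0 \<longleftrightarrow> f x * g x < c" for x using assms(3)[of x] by (simp add: field_simps)
  ultimately show "open {x. f x * g x < c}" by simp
qed

context concave_level_domain
begin

text \<open>
  In directions orthogonal to the contact point \<open>I\<^sub>\<xi>\<close> maps the Gaussian \<open>exp (- A * (p \<bullet> p))\<close> below
  any prescribed negative multiple of itself, once \<open>A\<close> is large.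
\<close>

lemma maximum_principle_I_minus:
  assumes k: "1 \<le> k" "k < DIM('a)"
  shows "maximum_principle (I_minus s k (C * m)) \<Omega>"
  unfolding maximum_principle_def
proof (intro allI impI ballI)
  fix u x
  assume u: "usc_on (closure \<Omega>) u" "L_infty u" "visc_subsolution (I_minus s k (C * m)) \<Omega> u"
    and out: "\<forall>x. x \<notin> \<Omega> \<longrightarrow> u x \<le> 0" and x: "x \<in> \<Omega>"
  show "u x \<le> 0"
  proof (rule ccontr)
    assume neg: "\<not> u x \<le> 0"
    have "0 < \<bar>m\<bar> + 1" by simp
    \<comment> \<open>\<open>tail h\<close> exceeds \<open>m\<close>, so the decay of the Gaussian
      over jumps beyond \<open>h\<close> will beat the zero-order term.\<close>
    then obtain h where h: "0 < h" and tail_h: "tail h = \<bar>m\<bar> + 1" by (rule tail_surj)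
    \<comment> \<open>With this rate \<open>exp (- A * \<tau>\<^sup>2) \<le> 1 / 2\<close> for
      \<open>\<tau> \<ge> h\<close>, so that second differences in orthogonal directions are at most
      \<open>- \<phi> x0\<close> there.\<close>
    define A where "A = 1 / h\<^sup>2"
    define U where "U = (\<lambda>x. if x \<in> \<Omega> then max 0 (u x) else 0)"
    have "usc U" unfolding U_def using u(1) open_\<Omega> out by (intro usc_cutoff) auto
    then have usc: "usc (\<lambda>p. U p * exp (A * (p \<bullet> p)))"
      by (rule usc_mult_continuous) (auto intro!: continuous_intros)
    have "compact (closure \<Omega>)" "closure \<Omega> \<noteq> {}" using bounded_\<Omega> \<Omega>_nonempty by auto
    then obtain x0 where x0: "\<And>p. p \<in> closure \<Omega> \<Longrightarrow> U p * exp (A * (p \<bullet> p)) \<le> U x0 * exp (A * (x0 \<bullet> x0))"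
      using usc_attains[OF _ _ usc] by metis
    \<comment> \<open>The smallest multiple of the Gaussian above \<open>U\<close>, with contact at
      \<open>x0\<close>. The contact is global, so the radius 1 of the test below is
      arbitrary.\<close>
    define \<theta> where "\<theta> = U x0 * exp (A * (x0 \<bullet> x0))"
    have xc: "x \<in> closure \<Omega>" using x closure_subset by blast
    have "0 < U x * exp (A * (x \<bullet> x))" using neg x by (simp add: U_def)
    then have \<theta>: "0 < \<theta>" using x0[OF xc] by (simp add: \<theta>_def)
    then have "0 < U x0" by (simp add: \<theta>_def zero_less_mult_iff)
    then have x0\<Omega>: "x0 \<in> \<Omega>" and Ux0: "u x0 = U x0" by (auto simp: U_def split: if_splits)
    define \<phi> where "\<phi> = (\<lambda>p::'a. \<theta> * exp (- A * (p \<bullet> p)))"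
    have le: "u p \<le> \<phi> p" for p
    proof (cases "p \<in> \<Omega>")
      case True
      then have "U p * exp (A * (p \<bullet> p)) \<le> \<theta>" using x0[of p] closure_subset[of \<Omega>] unfolding \<theta>_def by blast
      then have "U p \<le> \<phi> p" by (simp add: \<phi>_def exp_minus field_simps)
      then show ?thesis using True by (simp add: U_def)
    next
      case False
      then show ?thesis using out \<theta> by (auto simp: \<phi>_def intro: order_trans[of _ 0])
    qed
    have eq: "u x0 = \<phi> x0" unfolding Ux0 by (simp add: \<phi>_def \<theta>_def flip: exp_add)
    have "C2_on (ball x0 1) \<phi>" unfolding \<phi>_def by (rule C2_on_gaussian)
    moreover have "\<forall>p\<in>ball x0 1. u p - \<phi> p \<le> u x0 - \<phi> x0" using le eq by simp
    ultimately have I: "0 \<le> I_minus s k (C * m) 1 \<phi> u x0"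
      using u(3) x0\<Omega> zero_less_one unfolding visc_subsolution_def by blast
    obtain e where e: "frame k e" "\<And>i. i < k \<Longrightarrow> e i \<bullet> x0 = 0" using frame_orthogonal[OF k(2)] by blast
    have \<phi>x0: "0 < \<phi> x0" using \<theta> by (simp add: \<phi>_def)
    have \<phi>_decay: "second_diff \<phi> x0 (\<tau> *\<^sub>R e i) \<le> - \<phi> x0 * indicator {h..} \<tau>" if "i < k" "0 < \<tau>" for i \<tau>
    proof -
      have ei: "e i \<bullet> e i = 1" using e(1) that by (simp add: frame_def dot_square_norm)
      have "(x0 + \<tau> *\<^sub>R e i) \<bullet> (x0 + \<tau> *\<^sub>R e i) = x0 \<bullet> x0 + \<tau>\<^sup>2"
        "(x0 - \<tau> *\<^sub>R e i) \<bullet> (x0 - \<tau> *\<^sub>R e i) = x0 \<bullet> x0 + \<tau>\<^sup>2"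
        using e(2)[OF that(1)] by (simp_all add: inner_add_left inner_add_right inner_diff_left inner_diff_right
            inner_commute ei power2_eq_square)
      then have "second_diff \<phi> x0 (\<tau> *\<^sub>R e i) = 2 * (\<theta> * exp (- A * (x0 \<bullet> x0 + \<tau>\<^sup>2))) - 2 * \<phi> x0"
        by (simp add: second_diff_def \<phi>_def)
      also have "\<dots> = - 2 * \<phi> x0 * (1 - exp (- (A * \<tau>\<^sup>2)))"
        by (simp add: \<phi>_def ring_distribs exp_diff exp_minus divide_inverse)
      also have "\<dots> \<le> - \<phi> x0 * indicator {h..} \<tau>"
      proof (cases "h \<le> \<tau>")
        case True
        then have "h\<^sup>2 \<le> \<tau>\<^sup>2" using h by (intro power_mono) auto
        then have "1 \<le> A * \<tau>\<^sup>2" using h by (simp add: A_def)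
        then have "exp 1 \<le> exp (A * \<tau>\<^sup>2)" by simp
        moreover have "2 \<le> exp (1::real)" using exp_ge_add_one_self[of 1] by simp
        ultimately have "2 \<le> exp (A * \<tau>\<^sup>2)" by linarith
        then have "exp (- (A * \<tau>\<^sup>2)) \<le> 1 / 2" by (simp add: exp_minus field_simps)
        then have "\<phi> x0 * 1 \<le> \<phi> x0 * (2 * (1 - exp (- (A * \<tau>\<^sup>2))))" using \<phi>x0 by (intro mult_left_mono) auto
        then show ?thesis using True by (simp add: algebra_simps)
      next
        case False
        have "0 \<le> A * \<tau>\<^sup>2" by (simp add: A_def)
        then have "exp (- (A * \<tau>\<^sup>2)) \<le> 1" by simp
        then show ?thesis using False \<phi>x0 by simp
      qed
      finally show ?thesis .
    qed
    have "visc_directional s 1 \<phi> u x0 (e i) \<le> ereal (- \<phi> x0 * tail h)" if i: "i < k" for i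
    proof -
      have int: "integrable levy (\<lambda>\<tau>. - \<phi> x0 * indicator {h..} \<tau>)" "(\<integral>\<tau>. - \<phi> x0 * indicator {h..} \<tau> \<partial>levy) = - \<phi> x0 * tail h"
        using integrable_tail[OF h] integral_tail[OF h] by (auto simp del: Bochner_Integration.integral_indicator)
      show ?thesis
        unfolding int(2)[symmetric]
      proof (rule visc_directional_le[OF int(1) zero_less_one])
        fix \<tau> :: real assume "1 \<le> \<tau>"
        have "second_diff u x0 (\<tau> *\<^sub>R e i) \<le> second_diff \<phi> x0 (\<tau> *\<^sub>R e i)"
          using le[of "x0 + \<tau> *\<^sub>R e i"] le[of "x0 - \<tau> *\<^sub>R e i"] eq by (simp add: second_diff_def)
        also have "\<dots> \<le> - \<phi> x0 * indicator {h..} \<tau>" using i \<open>1 \<le> \<tau>\<close> by (intro \<phi>_decay) auto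
        finally show "second_diff u x0 (\<tau> *\<^sub>R e i) \<le> - \<phi> x0 * indicator {h..} \<tau>" .
      qed (use \<phi>_decay[OF i] in auto)
    qed
    from I_minus_nonnegD[OF I this e(1)] have "0 \<le> real k * (- \<phi> x0 * tail h) + m * \<phi> x0" by (simp add: eq)
    also have "\<dots> = \<phi> x0 * (m - real k * tail h)" by (simp add: algebra_simps)
    also have "m - real k * tail h < 0"
    proof -
      have "1 * tail h \<le> real k * tail h" using k tail_pos[OF h] by (intro mult_right_mono) auto
      then show ?thesis using tail_h by linarith
    qed
    then have "\<phi> x0 * (m - real k * tail h) < 0" using \<phi>x0 by (simp add: mult_pos_neg)
    finally show False by simp
  qed
qed

text \<open>The bump \<open>b\<close> loses at most a multiple of \<open>b x powr (1 - s)\<close> in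
  each direction. Near the edge of its support this is small, whereas radial jumps towards the
  centre gain a fixed amount \<open>T\<close>, so the operator itself is nonnegative there. Where
  \<open>b\<close> exceeds \<open>\<beta>0\<close> a large \<open>m\<close> compensates the
  loss.\<close>

lemma not_maximum_principle_large:
  assumes k: "1 \<le> k" "k \<le> DIM('a)"
  shows "\<exists>m. \<not> maximum_principle (I_plus s k (C * m)) \<Omega>"
proof -
  obtain c where c: "c \<in> \<Omega>" using \<Omega>_nonempty by blast
  then obtain r where r: "0 < r" "ball c r \<subseteq> \<Omega>" using open_\<Omega> by (meson openE)
  define b where "b p = max 0 (r\<^sup>2 - (norm (p - c))\<^sup>2)" for p :: 'a
  have b0: "0 \<le> b p" for p by (simp add: b_def)
  have b_le: "b p \<le> r\<^sup>2" for p by (simp add: b_def)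
  have cont: "continuous_on UNIV b" unfolding b_def by (intro continuous_intros)
  have Linf: "L_infty b"
    by (rule L_inftyI[of _ "r\<^sup>2"]) (use b0 b_le in \<open>auto intro: borel_measurable_continuous_onI cont\<close>)
  have out: "b p = 0" if "p \<notin> \<Omega>" for p
  proof -
    have "p \<notin> ball c r" using that r by blast
    then have "r \<le> norm (p - c)" by (simp add: dist_norm norm_minus_commute)
    then have "r\<^sup>2 \<le> (norm (p - c))\<^sup>2" using r by (intro power_mono) auto
    then show ?thesis by (simp add: b_def)
  qed
  define B where "B = 1 / (1 - s) + 1 / s"
  have B: "0 < B" using s_pos s_less_1 by (simp add: B_def add_pos_pos)
  \<comment> \<open>Second differences of \<open>b\<close> are at least
    \<open>- 2 * \<tau>\<^sup>2\<close> and at least \<open>- 2 * \<beta>\<close> for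
    \<open>\<beta> = b x > 0\<close>; the minorant changes over at \<open>sqrt \<beta>\<close>,
    where the two agree. Its integral produces \<open>B\<close>.\<close>
  define H where "H \<beta> \<tau> = - 2 * (\<tau>\<^sup>2 * indicator {0<..<sqrt \<beta>} \<tau> + \<beta> * indicator {sqrt \<beta>..} \<tau>)" for \<beta> \<tau> :: real
  have H_int: "integrable levy (H \<beta>)" "integral\<^sup>L levy (H \<beta>) = - B * \<beta> powr (1 - s)" if "0 < \<beta>" for \<beta>
  proof -
    have sq: "0 < sqrt \<beta>" using that by simp
    note I = integrable_near[OF sq] integrable_mult_right[OF integrable_tail[OF sq], of \<beta>]
    show "integrable levy (H \<beta>)" unfolding H_def using I by (intro integrable_mult_right Bochner_Integration.integrable_add) auto
    have "integral\<^sup>L levy (H \<beta>) = - 2 * (near (sqrt \<beta>) + \<beta> * tail (sqrt \<beta>))"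
      unfolding H_def integral_mult_right_zero using I
      by (subst Bochner_Integration.integral_add)
        (simp_all add: integral_near[OF sq] integral_tail[OF sq] del: Bochner_Integration.integral_indicator)
    also have "near (sqrt \<beta>) = \<beta> powr (1 - s) / (2 * (1 - s))"
    proof -
      have "sqrt \<beta> powr (2 - 2 * s) = \<beta> powr (1 / 2 * (2 - 2 * s))"
        using that by (simp only: powr_half_sqrt[symmetric, OF less_imp_le] powr_powr)
      also have "1 / 2 * (2 - 2 * s) = 1 - s" by simp
      finally show ?thesis by (simp add: near_def right_diff_distrib)
    qed
    also have "\<beta> * tail (sqrt \<beta>) = \<beta> powr (1 - s) / (2 * s)"
    proof -
      have "sqrt \<beta> powr (- 2 * s) = \<beta> powr (1 / 2 * (- 2 * s))"
        using that by (simp only: powr_half_sqrt[symmetric, OF less_imp_le] powr_powr)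
      also have "1 / 2 * (- 2 * s) = - s" by simp
      finally have "\<beta> * tail (sqrt \<beta>) = \<beta> * \<beta> powr (- s) / (2 * s)" by (simp only: tail_def times_divide_eq_right)
      also have "\<beta> * \<beta> powr (- s) = \<beta> powr (1 - s)" using powr_add[of \<beta> 1 "- s"] that by simp
      finally show ?thesis .
    qed
    also have "- 2 * (\<beta> powr (1 - s) / (2 * (1 - s)) + \<beta> powr (1 - s) / (2 * s)) = - B * \<beta> powr (1 - s)"
    proof -
      have "- 2 * (P / (2 * t) + P / (2 * s)) = - (1 / t + 1 / s) * P" for P t :: real
        by (simp add: left_diff_distrib)
      then show ?thesis unfolding B_def .
    qed
    finally show "integral\<^sup>L levy (H \<beta>) = - B * \<beta> powr (1 - s)" .
  qed
  have sd_b: "- 2 * b x \<le> second_diff b x v" "0 < b x \<Longrightarrow> - 2 * (norm v)\<^sup>2 \<le> second_diff b x v" for x v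
  proof -
    show "- 2 * b x \<le> second_diff b x v" using b0[of "x + v"] b0[of "x - v"] by (simp add: second_diff_def)
    assume "0 < b x"
    then have "b x = r\<^sup>2 - (norm (x - c))\<^sup>2" by (simp add: b_def max_def split: if_splits)
    moreover have "r\<^sup>2 - (norm (x + v - c))\<^sup>2 \<le> b (x + v)" "r\<^sup>2 - (norm (x - v - c))\<^sup>2 \<le> b (x - v)" by (simp_all add: b_def)
    moreover have "(norm (x + v - c))\<^sup>2 + (norm (x - v - c))\<^sup>2 = 2 * (norm (x - c))\<^sup>2 + 2 * (norm v)\<^sup>2"
    proof -
      have *: "x + v - c = (x - c) + v" "x - v - c = (x - c) - v" by auto
      show ?thesis unfolding * by (rule parallelogram)
    qed
    ultimately show "- 2 * (norm v)\<^sup>2 \<le> second_diff b x v" by (simp add: second_diff_def)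
  qed
  have H_le: "H (b x) \<tau> \<le> second_diff b x (\<tau> *\<^sub>R \<xi>)" if "0 < b x" "0 < \<tau>" "norm \<xi> = 1" for x \<tau> \<xi>
    using sd_b(1)[of x "\<tau> *\<^sub>R \<xi>"] sd_b(2)[OF that(1), of "\<tau> *\<^sub>R \<xi>"] that by (auto simp: H_def indicator_def)
  \<comment> \<open>Radial jumps of length in \<open>[r / 2, r)\<close> from a point near the edge
    land within \<open>r / 2\<close> of the centre, where \<open>b \<ge> 3 * r\<^sup>2 / 4\<close>;
    the bracket is the mass of these lengths.\<close>
  define T where "T = 3 * r\<^sup>2 / 4 * (tail (r / 2) - tail r)"
  have "r powr (- 2 * s) < (r / 2) powr (- 2 * s)" using r s_pos by (intro powr_less_mono2_neg) auto
  then have T: "0 < T" using r s_pos by (simp add: T_def tail_def divide_strict_right_mono)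
  have G_int: "integrable levy (\<lambda>\<tau>. 3 * r\<^sup>2 / 4 * (indicator {r / 2..} \<tau> - indicator {r..} \<tau>))"
    "(\<integral>\<tau>. 3 * r\<^sup>2 / 4 * (indicator {r / 2..} \<tau> - indicator {r..} \<tau>) \<partial>levy) = T"
  proof -
    have t: "integrable levy (indicator {r / 2..} :: real \<Rightarrow> real)" "integrable levy (indicator {r..} :: real \<Rightarrow> real)"
      using r by (auto intro: integrable_tail)
    show "integrable levy (\<lambda>\<tau>. 3 * r\<^sup>2 / 4 * (indicator {r / 2..} \<tau> - indicator {r..} \<tau>))"
      using t by (intro integrable_mult_right Bochner_Integration.integrable_diff)
    show "(\<integral>\<tau>. 3 * r\<^sup>2 / 4 * (indicator {r / 2..} \<tau> - indicator {r..} \<tau>) \<partial>levy) = T"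
      unfolding integral_mult_right_zero Bochner_Integration.integral_diff[OF t] T_def using r by (simp only: integral_tail half_gt_zero)
  qed
  \<comment> \<open>The first entry places the point at distance at least \<open>r / 2\<close> from
    \<open>c\<close> and puts \<open>sqrt (b x)\<close> below \<open>r / 2\<close>; the second makes
    the total loss at most \<open>T\<close>.\<close>
  define \<beta>0 where "\<beta>0 = min (r\<^sup>2 / 4) ((T / (real k * B)) powr (1 / (1 - s)))"
  have kB: "0 < real k * B" using k B by simp
  have \<beta>0: "0 < \<beta>0" using r T k B by (simp add: \<beta>0_def)
  \<comment> \<open>Gain and loss balance at \<open>\<beta>0\<close>, so
    \<open>real k * B * \<beta> powr (1 - s) \<le> m * \<beta>\<close> for all
    \<open>\<beta> \<ge> \<beta>0\<close>.\<close>
  define m where "m = real k * B * \<beta>0 powr (- s)"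
  have m: "0 < m" using kB \<beta>0 by (simp add: m_def)
  have "visc_subsolution (I_plus s k (C * m)) \<Omega> b"
    unfolding visc_subsolution_def
  proof (intro conjI ballI allI impI)
    show "L_infty b" by (rule Linf)
    show "usc_on \<Omega> b" by (intro usc_imp_usc_on usc_continuous cont)
    fix x \<rho> \<phi> assume x: "x \<in> \<Omega>" and \<rho>: "0 < (\<rho> :: real)" and touch: "\<forall>p\<in>ball x \<rho>. b p - \<phi> p \<le> b x - \<phi> x"
    have sd_\<phi>: "second_diff b x (\<tau> *\<^sub>R \<xi>) \<le> second_diff \<phi> x (\<tau> *\<^sub>R \<xi>)" if "0 < \<tau>" "\<tau> < \<rho>" "norm \<xi> = 1" for \<tau> \<xi>
      using touch[rule_format, of "x + \<tau> *\<^sub>R \<xi>"] touch[rule_format, of "x - \<tau> *\<^sub>R \<xi>"] that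
      by (simp add: second_diff_def dist_norm)
    have visc: "ereal (integral\<^sup>L levy L) \<le> visc_directional s \<rho> \<phi> b x \<xi>"
      if L: "integrable levy L" "\<And>\<tau>. 0 < \<tau> \<Longrightarrow> L \<tau> \<le> second_diff b x (\<tau> *\<^sub>R \<xi>)" and \<xi>: "norm \<xi> = 1" for L \<xi>
      by (rule visc_directional_ge[OF L(1) \<rho>]) (use L(2) sd_\<phi> \<xi> \<rho> in \<open>force intro: order_trans\<close>)+
    show "0 \<le> I_plus s k (C * m) \<rho> \<phi> b x"
    proof (rule I_plus_nonnegI)
      fix \<eta> :: real assume \<eta>: "0 < \<eta>"
      show "\<exists>e a. frame k e \<and> (\<forall>i<k. ereal (a i) \<le> visc_directional s \<rho> \<phi> b x (e i)) \<and> - \<eta> \<le> (\<Sum>i<k. a i) + m * b x"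
      proof -
        consider "b x = 0" | "\<beta>0 < b x" | "0 < b x" "b x \<le> \<beta>0" using b0[of x] by linarith
        then show ?thesis
        proof cases
          case 1
          obtain e :: "nat \<Rightarrow> 'a" where e: "frame k e" using frame_exists[OF k(2)] by blast
          have "ereal (integral\<^sup>L levy (\<lambda>\<tau>. 0)) \<le> visc_directional s \<rho> \<phi> b x (e i)" if "i < k" for i
            using e that sd_b(1)[of x] 1 by (intro visc) (auto simp: frame_def)
          then show ?thesis using e \<eta> 1 by (intro exI[of _ e] exI[of _ "\<lambda>_. 0"]) auto
        next
          case 2
          then have bx: "0 < b x" using \<beta>0 by simp
          obtain e :: "nat \<Rightarrow> 'a" where e: "frame k e" using frame_exists[OF k(2)] by blast
          have "ereal (- B * b x powr (1 - s)) \<le> visc_directional s \<rho> \<phi> b x (e i)" if "i < k" for i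
            unfolding H_int(2)[OF bx, symmetric] using e that bx by (intro visc H_int H_le) (auto simp: frame_def)
          moreover have "0 \<le> real k * (- B * b x powr (1 - s)) + m * b x"
          proof -
            have "b x powr (1 - s) = b x * b x powr (- s)" using powr_add[of "b x" 1 "- s"] bx by simp
            moreover have "b x powr (- s) \<le> \<beta>0 powr (- s)" using 2 \<beta>0 s_pos by (intro powr_mono2') auto
            then have "real k * B * b x * b x powr (- s) \<le> real k * B * b x * \<beta>0 powr (- s)"
              using kB bx by (intro mult_left_mono) auto
            ultimately show ?thesis by (simp add: m_def algebra_simps)
          qed
          ultimately show ?thesis using e \<eta> by (intro exI[of _ e] exI[of _ "\<lambda>_. - B * b x powr (1 - s)"]) auto
        next
          case 3
          have bx: "b x \<le> r\<^sup>2 / 4" using 3(2) by (simp add: \<beta>0_def)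
          define n where "n = norm (x - c)"
          have n2: "b x = r\<^sup>2 - n\<^sup>2" using 3(1) by (simp add: b_def n_def max_def split: if_splits)
          have "(r / 2)\<^sup>2 = r\<^sup>2 / 4" "0 \<le> r\<^sup>2" by (simp_all add: power_divide)
          then have "(r / 2)\<^sup>2 \<le> n\<^sup>2" using bx n2 by linarith
          then have n: "r / 2 \<le> n" by (rule power2_le_imp_le) (simp add: n_def)
          have "n\<^sup>2 \<le> r\<^sup>2" using n2 3 by simp
          then have nr: "n \<le> r" by (rule power2_le_imp_le) (use r in simp)
          have n0: "0 < n" using n r by simp
          define \<nu> where "\<nu> = (x - c) /\<^sub>R n"
          have \<nu>: "norm \<nu> = 1" "x = c + n *\<^sub>R \<nu>" using n0 by (auto simp: \<nu>_def n_def)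
          obtain e i0 where e: "frame k e" "i0 < k" "e i0 = \<nu>" using frame_containing[OF \<nu>(1) k] by blast
          define L where "L \<tau> = H (b x) \<tau> + 3 * r\<^sup>2 / 4 * (indicator {r / 2..} \<tau> - indicator {r..} \<tau>)" for \<tau>
          have L_int: "integrable levy L" "integral\<^sup>L levy L = - B * b x powr (1 - s) + T"
            unfolding L_def using H_int[OF 3(1)] G_int by (simp_all add: Bochner_Integration.integral_add)
          have L_le: "L \<tau> \<le> second_diff b x (\<tau> *\<^sub>R \<nu>)" if \<tau>: "0 < \<tau>" for \<tau>
          proof (cases "r / 2 \<le> \<tau> \<and> \<tau> < r")
            case True
            have "sqrt (b x) \<le> r / 2" by (rule real_le_lsqrt) (use bx r in \<open>auto simp: power_divide\<close>)
            then have "L \<tau> = - 2 * b x + 3 * r\<^sup>2 / 4" using True by (simp add: L_def H_def)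
            moreover have "3 * r\<^sup>2 / 4 \<le> b (x - \<tau> *\<^sub>R \<nu>)"
            proof -
              have "x - \<tau> *\<^sub>R \<nu> - c = (n - \<tau>) *\<^sub>R \<nu>" using \<nu>(2) by (simp add: algebra_simps)
              then have "norm (x - \<tau> *\<^sub>R \<nu> - c) = \<bar>n - \<tau>\<bar>" using \<nu>(1) by simp
              also have "\<dots> \<le> r / 2" unfolding abs_le_iff using True n nr by auto
              finally have "(norm (x - \<tau> *\<^sub>R \<nu> - c))\<^sup>2 \<le> (r / 2)\<^sup>2" by (intro power_mono) auto
              then have "3 * r\<^sup>2 / 4 \<le> r\<^sup>2 - (norm (x - \<tau> *\<^sub>R \<nu> - c))\<^sup>2" by (simp add: power_divide)
              also have "\<dots> \<le> b (x - \<tau> *\<^sub>R \<nu>)" by (simp add: b_def)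
              finally show ?thesis .
            qed
            ultimately show ?thesis using b0[of "x + \<tau> *\<^sub>R \<nu>"] by (simp add: second_diff_def)
          next
            case False
            then have "L \<tau> = H (b x) \<tau>" using r by (auto simp: L_def indicator_def)
            then show ?thesis using H_le[OF 3(1) \<tau> \<nu>(1)] by simp
          qed
          define a where "a i = - B * b x powr (1 - s) + (if i = i0 then T else 0)" for i
          have "ereal (a i) \<le> visc_directional s \<rho> \<phi> b x (e i)" if "i < k" for i
          proof (cases "i = i0")
            case True
            then show ?thesis using visc[OF L_int(1) L_le \<nu>(1)] e by (simp add: a_def L_int)
          next
            case False
            have "ereal (integral\<^sup>L levy (H (b x))) \<le> visc_directional s \<rho> \<phi> b x (e i)"
              using e that 3 by (intro visc H_int H_le) (auto simp: frame_def)
            then show ?thesis using False by (simp add: a_def H_int[OF 3(1)])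
          qed
          moreover have "(\<Sum>i<k. a i) = - (real k * B) * b x powr (1 - s) + T"
            unfolding a_def sum.distrib sum_constant using e(2) by simp
          moreover have "real k * B * b x powr (1 - s) \<le> T"
          proof -
            have "b x powr (1 - s) \<le> ((T / (real k * B)) powr (1 / (1 - s))) powr (1 - s)"
              using 3 s_less_1 by (intro powr_mono2) (auto simp: \<beta>0_def)
            also have "\<dots> = T / (real k * B)" using s_less_1 T kB by (simp add: powr_powr)
            finally show ?thesis using kB by (simp add: field_simps)
          qed
          moreover have "0 \<le> m * b x" using m 3 by simp
          ultimately show ?thesis using e(1) \<eta> by (intro exI[of _ e] exI[of _ a]) auto
        qed
      qed
    qed
  qed
  moreover have "0 < b c" using r by (simp add: b_def)
  ultimately have "\<not> maximum_principle (I_plus s k (C * m)) \<Omega>"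
    unfolding maximum_principle_def using Linf c out usc_imp_usc_on[OF usc_continuous[OF cont]]
    by (metis not_le order_refl)
  then show ?thesis by blast
qed

text \<open>\<open>maximum_principle_below_mu_plus\<close> read backwards: a value at which the
  principle fails is an upper bound.\<close>

lemma mu_plus_finite:
  assumes "1 \<le> k" "k \<le> DIM('a)" shows "mu_plus s k \<Omega> < \<infinity>"
proof -
  obtain m where "\<not> maximum_principle (I_plus s k (C * m)) \<Omega>"
    using not_maximum_principle_large[OF assms] by blast
  then have "mu_plus s k \<Omega> \<le> ereal (C * m)"
    using maximum_principle_below_mu_plus[OF assms(1)] not_less by blast
  also have "\<dots> < \<infinity>" by simp
  finally show ?thesis .
qed

end

section \<open>Half-relaxed limits\<close>

text \<open>The upper half-relaxed limit, the limsup of \<open>z j y\<close> as \<open>j\<close>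
  tends to infinity and \<open>y\<close> to \<open>x\<close>. One \<open>N\<close> controls index
  and radius together, and the infimum runs over eventual upper bounds.\<close>

definition upper_limit :: "(nat \<Rightarrow> 'a::metric_space \<Rightarrow> real) \<Rightarrow> 'a \<Rightarrow> real" where
  "upper_limit z x = Inf {c. \<exists>N. \<forall>j\<ge>N. \<forall>y. dist y x < inverse (real (Suc N)) \<longrightarrow> z j y \<le> c}"

lemma filterlim_at_top_ge_ident: "\<forall>i :: nat. i \<le> J i \<Longrightarrow> filterlim J at_top sequentially"
  by (rule filterlim_at_top_mono[OF filterlim_ident]) auto

lemma upper_limit_less:
  assumes "\<And>j y. \<bar>z j y\<bar> \<le> S" "upper_limit z x < c"
  obtains N c' where "c' < c" "\<And>j y. j \<ge> N \<Longrightarrow> dist y x < inverse (real (Suc N)) \<Longrightarrow> z j y \<le> c'"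
proof -
  let ?A = "{c. \<exists>N. \<forall>j\<ge>N. \<forall>y. dist y x < inverse (real (Suc N)) \<longrightarrow> z j y \<le> c}"
  have "S \<in> ?A" using assms(1) abs_le_D1 by blast
  then obtain c' where "c' \<in> ?A" "c' < c"
    using cInf_lessD[of ?A c] assms(2) unfolding upper_limit_def by blast
  then show ?thesis using that by blast
qed

lemma upper_limit_le:
  assumes "\<And>j y. \<bar>z j y\<bar> \<le> S" "\<And>j y. j \<ge> N \<Longrightarrow> dist y x < inverse (real (Suc N)) \<Longrightarrow> z j y \<le> c"
  shows "upper_limit z x \<le> c"
  unfolding upper_limit_def
proof (rule cInf_lower)
  show "c \<in> {c. \<exists>N. \<forall>j\<ge>N. \<forall>y. dist y x < inverse (real (Suc N)) \<longrightarrow> z j y \<le> c}" using assms(2) by blast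
  show "bdd_below {c. \<exists>N. \<forall>j\<ge>N. \<forall>y. dist y x < inverse (real (Suc N)) \<longrightarrow> z j y \<le> c}"
  proof (rule bdd_belowI)
    fix c assume "c \<in> {c. \<exists>N. \<forall>j\<ge>N. \<forall>y. dist y x < inverse (real (Suc N)) \<longrightarrow> z j y \<le> c}"
    then obtain N where "z N x \<le> c" by force
    with assms(1)[of N x] show "- S \<le> c" by linarith
  qed
qed

lemma upper_limit_abs_le:
  assumes "\<And>j y. \<bar>z j y\<bar> \<le> S" shows "\<bar>upper_limit z x\<bar> \<le> S"
proof -
  have "upper_limit z x \<le> S"
    using assms by (intro upper_limit_le[of z S 0]) (auto intro: abs_le_D1)
  moreover have "- S \<le> upper_limit z x"
  proof (rule ccontr)
    assume "\<not> - S \<le> upper_limit z x"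
    then obtain N c' where "c' < - S" "z N x \<le> c'"
      using upper_limit_less[of z S x "- S"] assms by (metis dist_self inverse_positive_iff_positive not_le of_nat_0_less_iff order_refl zero_less_Suc)
    then show False using assms[of N x] by linarith
  qed
  ultimately show ?thesis by (simp add: abs_le_iff)
qed

lemma upper_limit_sequence:
  assumes z: "\<And>j y. \<bar>z j y\<bar> \<le> S" and "upper_limit z x < c"
    and J: "filterlim J at_top sequentially" and Y: "Y \<longlonglongrightarrow> x"
  shows "\<forall>\<^sub>F i in sequentially. z (J i) (Y i) < c"
proof -
  obtain N c' where N: "c' < c" "\<And>j y. j \<ge> N \<Longrightarrow> dist y x < inverse (real (Suc N)) \<Longrightarrow> z j y \<le> c'"
    using upper_limit_less[of z S x c] assms by metis
  have "\<forall>\<^sub>F i in sequentially. N \<le> J i" using J by (simp add: filterlim_at_top)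
  moreover have "\<forall>\<^sub>F i in sequentially. dist (Y i) x < inverse (real (Suc N))" using Y by (rule tendstoD) simp
  ultimately show ?thesis by eventually_elim (use N in force)
qed

text \<open>A value below the limit is no eventual bound, so indices and points that exceed it exist
  arbitrarily far out. \<open>J\<close> need not be increasing; it diverges by
  \<open>i \<le> J i\<close>.\<close>

lemma upper_limit_recovery:
  assumes z: "\<And>j y. \<bar>z j y\<bar> \<le> S"
  obtains J Y where "\<forall>i :: nat. i \<le> J i" "Y \<longlonglongrightarrow> x" "(\<lambda>i. z (J i) (Y i)) \<longlonglongrightarrow> upper_limit z x"
proof -
  have "\<exists>j y. i \<le> j \<and> dist y x < inverse (real (Suc i)) \<and> upper_limit z x - inverse (real (Suc i)) < z j y" for i
  proof (rule ccontr)
    assume "\<not> ?thesis"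
    then have "z j y \<le> upper_limit z x - inverse (real (Suc i))"
      if "i \<le> j" "dist y x < inverse (real (Suc i))" for j y
      using that not_less by blast
    then have "upper_limit z x \<le> upper_limit z x - inverse (real (Suc i))"
      by (rule upper_limit_le[of z S i, OF z])
    then show False by simp
  qed
  then obtain J Y where JY: "\<And>i. i \<le> J i" "\<And>i. dist (Y i) x < inverse (real (Suc i))"
    "\<And>i. upper_limit z x - inverse (real (Suc i)) < z (J i) (Y i)" by metis
  have Y: "Y \<longlonglongrightarrow> x"
    unfolding tendsto_dist_iff[of Y]
    by (rule Lim_null_comparison[OF _ LIMSEQ_inverse_real_of_nat])
      (use JY(2) in \<open>auto intro!: always_eventually simp del: of_nat_Suc simp: less_imp_le\<close>)
  have J: "filterlim J at_top sequentially" using JY(1) by (simp add: filterlim_at_top_ge_ident)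
  have "(\<lambda>i. z (J i) (Y i)) \<longlonglongrightarrow> upper_limit z x"
  proof (rule order_tendstoI)
    fix a assume "a < upper_limit z x"
    have "(\<lambda>i. upper_limit z x - inverse (real (Suc i))) \<longlonglongrightarrow> upper_limit z x - 0"
      by (intro tendsto_intros LIMSEQ_inverse_real_of_nat)
    then have "\<forall>\<^sub>F i in sequentially. a < upper_limit z x - inverse (real (Suc i))"
      using \<open>a < upper_limit z x\<close> by (intro order_tendstoD(1)) auto
    then show "\<forall>\<^sub>F i in sequentially. a < z (J i) (Y i)"
      by eventually_elim (use JY(3) in \<open>force intro: less_trans\<close>)
  qed (rule upper_limit_sequence[OF z _ J Y])
  then show ?thesis using that JY(1) Y by blast
qed

lemma usc_upper_limit:
  assumes z: "\<And>j y. \<bar>z j y\<bar> \<le> S" shows "usc (upper_limit z)"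
  unfolding usc_def
proof
  fix c
  show "open {x. upper_limit z x < c}"
    unfolding open_dist
  proof (intro ballI)
    fix x assume "x \<in> {x. upper_limit z x < c}"
    then obtain N c' where N: "c' < c" "\<And>j y. j \<ge> N \<Longrightarrow> dist y x < inverse (real (Suc N)) \<Longrightarrow> z j y \<le> c'"
      using upper_limit_less[of z S x c] z by (metis mem_Collect_eq)
    define e where "e = inverse (real (Suc N)) / 2"
    have "upper_limit z y < c" if y: "dist y x < e" for y
    proof -
      \<comment> \<open>At index \<open>2 * N + 1\<close> the radius is half of that at
        \<open>N\<close>, so the small ball around \<open>y\<close> lies in the one around
        \<open>x\<close>.\<close>
      have "upper_limit z y \<le> c'"
      proof (rule upper_limit_le[of z S "2 * N + 1", OF z])
        fix j w assume j: "2 * N + 1 \<le> j" and w: "dist w y < inverse (real (Suc (2 * N + 1)))"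
        have "inverse (real (Suc (2 * N + 1))) = e" by (simp add: e_def field_simps)
        then have "dist w x < inverse (real (Suc N))"
          using dist_triangle[of w x y] w y by (simp add: e_def dist_commute)
        with j show "z j w \<le> c'" by (intro N(2)) auto
      qed
      with N(1) show ?thesis by simp
    qed
    then show "\<exists>e>0. \<forall>y. dist y x < e \<longrightarrow> y \<in> {x. upper_limit z x < c}"
      by (intro exI[of _ e]) (auto simp: e_def)
  qed
qed

section \<open>Stability of viscosity inequalities under half-relaxed limits\<close>

lemma C2_on_continuous: "C2_on S \<phi> \<Longrightarrow> continuous_on S \<phi>"
  unfolding C2_on_def
  by (meson continuous_at_imp_continuous_on has_derivative_continuous)

text \<open>The mean value theorem for the sum of \<open>\<phi>\<close> at the two endpoints, and a
  Lipschitz bound for the gradient on a compact ball. The constant is uniform in \<open>y\<close>,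
  as dominated convergence along moving contact points requires.\<close>

lemma C2_on_second_diff_bound:
  fixes \<phi> :: "'a::euclidean_space \<Rightarrow> real"
  assumes \<phi>: "C2_on (ball x0 \<rho>) \<phi>" and \<rho>: "0 < \<rho>"
  obtains K where "0 \<le> K" "\<And>y v. dist y x0 < \<rho> / 3 \<Longrightarrow> norm v < \<rho> / 3 \<Longrightarrow> \<bar>second_diff \<phi> y v\<bar> \<le> K * (norm v)\<^sup>2"
proof -
  from \<phi> obtain g H where g: "\<And>x. x \<in> ball x0 \<rho> \<Longrightarrow> (\<phi> has_derivative (\<lambda>h. g x \<bullet> h)) (at x)"
    and H: "\<And>x. x \<in> ball x0 \<rho> \<Longrightarrow> (g has_derivative blinfun_apply (H x)) (at x)"
    and cont: "continuous_on (ball x0 \<rho>) H"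
    unfolding C2_on_def by blast
  define B where "B = cball x0 (2 * \<rho> / 3)"
  have B: "B \<subseteq> ball x0 \<rho>" using \<rho> by (auto simp: B_def)
  have "bounded (H ` B)"
    by (intro compact_imp_bounded compact_continuous_image continuous_on_subset[OF cont B]) (simp add: B_def)
  then obtain K where K: "0 < K" "\<And>x. x \<in> B \<Longrightarrow> norm (H x) \<le> K" unfolding bounded_pos by auto
  have lip: "norm (g a - g b) \<le> K * norm (a - b)" if "a \<in> B" "b \<in> B" for a b
  proof (rule differentiable_bound[where S = B])
    show "convex B" by (simp add: B_def)
    show "(g has_derivative blinfun_apply (H x)) (at x within B)" if "x \<in> B" for x
      using H[OF subsetD[OF B that]] by (rule has_derivative_at_withinI)
    show "onorm (blinfun_apply (H x)) \<le> K" if "x \<in> B" for x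
      using K(2)[OF that] by (simp add: norm_blinfun.rep_eq)
  qed (use that in auto)
  show ?thesis
  proof (rule that[of "2 * K"])
    fix y v :: 'a assume y: "dist y x0 < \<rho> / 3" and v: "norm v < \<rho> / 3"
    have in_B: "y + t *\<^sub>R v \<in> B" "y - t *\<^sub>R v \<in> B" if t: "0 \<le> t" "t \<le> 1" for t
    proof -
      have "norm (t *\<^sub>R v) \<le> norm v" using t by (simp add: mult_left_le_one_le)
      moreover have "dist x0 (y + t *\<^sub>R v) \<le> dist y x0 + norm (t *\<^sub>R v)" "dist x0 (y - t *\<^sub>R v) \<le> dist y x0 + norm (t *\<^sub>R v)"
        using norm_triangle_ineq4[of "x0 - y" "t *\<^sub>R v"] norm_triangle_ineq[of "x0 - y" "t *\<^sub>R v"]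
        by (auto simp: dist_norm norm_minus_commute algebra_simps)
      ultimately show "y + t *\<^sub>R v \<in> B" "y - t *\<^sub>R v \<in> B" using y v by (auto simp: B_def)
    qed
    define f where "f t = \<phi> (y + t *\<^sub>R v) + \<phi> (y - t *\<^sub>R v)" for t
    define f' where "f' t = (g (y + t *\<^sub>R v) - g (y - t *\<^sub>R v)) \<bullet> v" for t
    have "DERIV f t :> f' t" if t: "0 \<le> t" "t \<le> 1" for t
    proof -
      have 1: "((\<lambda>t. \<phi> (y + t *\<^sub>R v)) has_derivative (\<lambda>h. g (y + t *\<^sub>R v) \<bullet> (h *\<^sub>R v))) (at t)"
        by (rule has_derivative_compose[of "\<lambda>t. y + t *\<^sub>R v" "\<lambda>h. h *\<^sub>R v", OF _ g])
          (use in_B[OF t] B in \<open>auto intro!: derivative_eq_intros\<close>)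
      have 2: "((\<lambda>t. \<phi> (y - t *\<^sub>R v)) has_derivative (\<lambda>h. g (y - t *\<^sub>R v) \<bullet> (- (h *\<^sub>R v)))) (at t)"
        by (rule has_derivative_compose[of "\<lambda>t. y - t *\<^sub>R v" "\<lambda>h. - (h *\<^sub>R v)", OF _ g])
          (use in_B[OF t] B in \<open>auto intro!: derivative_eq_intros\<close>)
      have "(f has_derivative (\<lambda>h. g (y + t *\<^sub>R v) \<bullet> (h *\<^sub>R v) + g (y - t *\<^sub>R v) \<bullet> (- (h *\<^sub>R v)))) (at t)"
        unfolding f_def[abs_def] using 1 2 by (rule has_derivative_add)
      also have "(\<lambda>h. g (y + t *\<^sub>R v) \<bullet> (h *\<^sub>R v) + g (y - t *\<^sub>R v) \<bullet> (- (h *\<^sub>R v))) = (*) (f' t)"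
        by (auto simp: f'_def inner_diff_left algebra_simps)
      finally show ?thesis by (simp add: has_field_derivative_def)
    qed
    then obtain t where t: "0 < t" "t < 1" "f 1 - f 0 = (1 - 0) * f' t"
      using MVT2[of 0 1 f f'] by auto
    have "\<bar>f' t\<bar> \<le> norm (g (y + t *\<^sub>R v) - g (y - t *\<^sub>R v)) * norm v"
      unfolding f'_def by (rule Cauchy_Schwarz_ineq2)
    also have "\<dots> \<le> (K * norm ((y + t *\<^sub>R v) - (y - t *\<^sub>R v))) * norm v"
      using t in_B[of t] by (intro mult_right_mono lip) auto
    also have "(y + t *\<^sub>R v) - (y - t *\<^sub>R v) = (2 * t) *\<^sub>R v" by (simp add: algebra_simps flip: scaleR_add_left)
    also have "K * norm ((2 * t) *\<^sub>R v) * norm v = 2 * K * (norm v)\<^sup>2 * t" using t by (simp add: power2_eq_square)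
    also have "\<dots> \<le> 2 * K * (norm v)\<^sup>2 * 1" using t K by (intro mult_left_mono) auto
    finally have "\<bar>f' t\<bar> \<le> 2 * K * (norm v)\<^sup>2" by simp
    moreover have "second_diff \<phi> y v = f 1 - f 0" by (simp add: second_diff_def f_def)
    ultimately show "\<bar>second_diff \<phi> y v\<bar> \<le> 2 * K * (norm v)\<^sup>2" using t(3) by simp
  qed (use K in auto)
qed

text \<open>The approximants maximised later include lower semicontinuous ones, whose maxima need
  not be attained; hence the error \<open>\<eta>\<close>.\<close>

lemma near_maximum_exists:
  fixes F :: "'a \<Rightarrow> real"
  assumes "A \<noteq> {}" "\<And>x. x \<in> A \<Longrightarrow> F x \<le> b" "0 < \<eta>"
  obtains y where "y \<in> A" "\<And>x. x \<in> A \<Longrightarrow> F x \<le> F y + \<eta>"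
proof -
  have bdd: "bdd_above (F ` A)" using assms(2) by (rule bdd_aboveI2)
  have "Sup (F ` A) - \<eta> < Sup (F ` A)" using assms(3) by simp
  then obtain y where y: "y \<in> A" "Sup (F ` A) - \<eta> < F y"
    using less_cSup_iff[of "F ` A"] assms(1) bdd by auto
  show ?thesis
  proof (rule that[OF y(1)])
    fix x assume "x \<in> A"
    then have "F x \<le> Sup (F ` A)" using bdd by (auto intro: cSup_upper)
    with y(2) show "F x \<le> F y + \<eta>" by simp
  qed
qed



text \<open>Strictness at \<open>x0\<close> forces near-maximisers of \<open>z j - \<phi>\<close> to
  converge there: by comparison with a recovery sequence any limit point is again a maximum of the
  relaxed limit minus \<open>\<phi>\<close>.\<close>

lemma relaxed_contact_points:
  fixes z :: "nat \<Rightarrow> 'a::euclidean_space \<Rightarrow> real" and \<eta> :: "nat \<Rightarrow> real"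
  assumes z: "\<And>j y. \<bar>z j y\<bar> \<le> S" and r: "0 < r" and cont: "continuous_on (cball x0 r) \<phi>"
    and touch: "\<And>x. x \<in> cball x0 r \<Longrightarrow> x \<noteq> x0 \<Longrightarrow> upper_limit z x - \<phi> x < upper_limit z x0 - \<phi> x0"
    and \<eta>: "\<And>j. 0 < \<eta> j" "\<eta> \<longlonglongrightarrow> 0"
  obtains a p where "filterlim a at_top sequentially" "p \<longlonglongrightarrow> x0" "(\<lambda>i. z (a i) (p i)) \<longlonglongrightarrow> upper_limit z x0"
    "\<And>i x :: 'a. x \<in> cball x0 r \<Longrightarrow> z (a i) x - \<phi> x \<le> z (a i) (p i) - \<phi> (p i) + \<eta> (a i)"
proof -
  obtain J Y where J: "\<forall>i. i \<le> J i" and Y: "Y \<longlonglongrightarrow> x0" and zY: "(\<lambda>i. z (J i) (Y i)) \<longlonglongrightarrow> upper_limit z x0"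
    by (rule upper_limit_recovery[of z S x0, OF z])
  have J_top: "filterlim J at_top sequentially" using J by (rule filterlim_at_top_ge_ident)
  have "bounded (\<phi> ` cball x0 r)" by (intro compact_imp_bounded compact_continuous_image cont) simp
  then obtain b where "\<forall>x\<in>cball x0 r. \<bar>\<phi> x\<bar> \<le> b" unfolding bounded_iff by auto
  then have b: "\<bar>\<phi> x\<bar> \<le> b" if "x \<in> cball x0 r" for x using that by blast
  have "\<exists>y. y \<in> cball x0 r \<and> (\<forall>x\<in>cball x0 r. z (J i) x - \<phi> x \<le> z (J i) y - \<phi> y + \<eta> (J i))" for i
  proof -
    have "z (J i) x - \<phi> x \<le> S + b" if "x \<in> cball x0 r" for x using z[of "J i" x] b[OF that] by (simp add: abs_le_iff)
    then show ?thesis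
      using near_maximum_exists[of "cball x0 r" "\<lambda>x. z (J i) x - \<phi> x" "S + b" "\<eta> (J i)"] r \<eta>(1)[of "J i"]
      by (metis centre_in_cball empty_iff less_imp_le)
  qed
  then obtain y where y: "\<And>i. y i \<in> cball x0 r"
    and y_max: "\<And>i x. x \<in> cball x0 r \<Longrightarrow> z (J i) x - \<phi> x \<le> z (J i) (y i) - \<phi> (y i) + \<eta> (J i)" by metis
  obtain l q where q: "l \<in> cball x0 r" "strict_mono (q :: nat \<Rightarrow> nat)" "(y \<circ> q) \<longlonglongrightarrow> l"
    using compact_cball[of x0 r] y unfolding compact_def by metis
  have yq: "(\<lambda>i. y (q i)) \<longlonglongrightarrow> l" using q(3) by (simp add: o_def)
  have Yq: "(\<lambda>i. Y (q i)) \<longlonglongrightarrow> x0" using LIMSEQ_subseq_LIMSEQ[OF Y q(2)] by (simp add: o_def)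
  have zYq: "(\<lambda>i. z (J (q i)) (Y (q i))) \<longlonglongrightarrow> upper_limit z x0" using LIMSEQ_subseq_LIMSEQ[OF zY q(2)] by (simp add: o_def)
  have q_top: "filterlim q at_top sequentially" using q(2) by (rule filterlim_subseq)
  have Jq: "filterlim (\<lambda>i. J (q i)) at_top sequentially" using J_top q_top by (rule filterlim_compose)
  have \<eta>q: "(\<lambda>i. \<eta> (J (q i))) \<longlonglongrightarrow> 0" using filterlim_compose[OF \<eta>(2) Jq] .
  have \<phi>y: "(\<lambda>i. \<phi> (y (q i))) \<longlonglongrightarrow> \<phi> l"
    by (rule continuous_on_tendsto_compose[OF cont yq q(1)]) (use y in auto)
  have Y_in: "\<forall>\<^sub>F i in sequentially. Y (q i) \<in> cball x0 r"
    using tendstoD[OF Yq r] by eventually_elim (simp add: dist_commute)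
  have \<phi>Y: "(\<lambda>i. \<phi> (Y (q i))) \<longlonglongrightarrow> \<phi> x0"
    by (rule continuous_on_tendsto_compose[OF cont Yq _ Y_in]) (use r in simp)
  define lo where "lo i = z (J (q i)) (Y (q i)) - \<phi> (Y (q i)) + \<phi> (y (q i)) - \<eta> (J (q i))" for i
  have lo: "lo \<longlonglongrightarrow> upper_limit z x0 - \<phi> x0 + \<phi> l - 0"
    unfolding lo_def by (intro tendsto_intros zYq \<phi>Y \<phi>y \<eta>q)
  have lo_le: "\<forall>\<^sub>F i in sequentially. lo i \<le> z (J (q i)) (y (q i))"
    using Y_in
  proof eventually_elim
    case (elim i)
    then show ?case using y_max[of "Y (q i)" "q i"] by (simp add: lo_def)
  qed
  have "upper_limit z x0 - \<phi> x0 + \<phi> l \<le> upper_limit z l"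
  proof (rule ccontr)
    assume "\<not> ?thesis"
    then obtain c where c: "upper_limit z l < c" "c < upper_limit z x0 - \<phi> x0 + \<phi> l - 0"
      using dense[of "upper_limit z l" "upper_limit z x0 - \<phi> x0 + \<phi> l"] by auto
    have "\<forall>\<^sub>F i in sequentially. False"
      using upper_limit_sequence[OF z c(1) Jq yq] order_tendstoD(1)[OF lo c(2)] lo_le by eventually_elim auto
    then show False by simp
  qed
  then have l: "l = x0" using touch[OF q(1)] by force
  have "(\<lambda>i. z (J (q i)) (y (q i))) \<longlonglongrightarrow> upper_limit z x0"
  proof (rule order_tendstoI)
    fix t assume "t < upper_limit z x0"
    then have "\<forall>\<^sub>F i in sequentially. t < lo i" using order_tendstoD(1)[OF lo] l by simp
    then show "\<forall>\<^sub>F i in sequentially. t < z (J (q i)) (y (q i))"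
      using lo_le by eventually_elim auto
  qed (rule upper_limit_sequence[OF z _ Jq yq[unfolded l]])
  then show ?thesis using that[OF Jq] yq l y_max by blast
qed

context fractional_order
begin

text \<open>The closed set \<open>\<E>\<close> lets one argument serve both signs: with all frames
  it bounds the supremum from below, with a single frame and negated data it gives the supersolution
  inequality frame by frame. The conclusion offers minorants \<open>L i\<close> in place of an
  operator value, so that either use can continue from it.\<close>

lemma relaxed_limit_subsolution:
  fixes z :: "nat \<Rightarrow> 'a::euclidean_space \<Rightarrow> real" and \<E> :: "(nat \<Rightarrow> 'a) set"
  assumes z: "\<And>j y. \<bar>z j y\<bar> \<le> S" and meas: "\<And>j. z j \<in> borel_measurable borel"
    and h: "\<And>j. 0 < h j" "h \<longlonglongrightarrow> 0" and \<Omega>: "open \<Omega>"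
    and frames: "\<And>e. e \<in> \<E> \<Longrightarrow> frame k e"
    and closed: "\<And>E e. (\<And>j :: nat. E j \<in> \<E>) \<Longrightarrow> (\<And>i. i < k \<Longrightarrow> (\<lambda>j. E j i) \<longlonglongrightarrow> e i) \<Longrightarrow> e \<in> \<E>"
    and eq: "\<And>j y. y \<in> \<Omega> \<Longrightarrow> \<exists>e\<in>\<E>. - c j \<le> (\<Sum>i<k. far (h j) (z j) y (e i)) + m * z j y"
    and c: "c \<longlonglongrightarrow> c0"
    and x0: "x0 \<in> \<Omega>" and \<rho>: "0 < \<rho>" and \<phi>: "C2_on (ball x0 \<rho>) \<phi>"
    and touch: "\<And>x. x \<in> ball x0 \<rho> \<Longrightarrow> upper_limit z x - \<phi> x \<le> upper_limit z x0 - \<phi> x0"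
    and \<kappa>: "0 < \<kappa>"
  obtains e L where "e \<in> \<E>" "\<And>i. i < k \<Longrightarrow> integrable levy (L i)"
    "\<And>i \<tau>. i < k \<Longrightarrow> 0 < \<tau> \<Longrightarrow> \<tau> < \<rho> \<Longrightarrow> L i \<tau> \<le> second_diff \<phi> x0 (\<tau> *\<^sub>R e i)"
    "\<And>i \<tau>. i < k \<Longrightarrow> \<rho> \<le> \<tau> \<Longrightarrow> L i \<tau> \<le> second_diff (upper_limit z) x0 (\<tau> *\<^sub>R e i)"
    "- c0 - \<kappa> \<le> (\<Sum>i<k. integral\<^sup>L levy (L i)) + m * upper_limit z x0"
proof -
  define Z where "Z = upper_limit z"
  have Z_meas [measurable]: "Z \<in> borel_measurable borel"
    unfolding Z_def by (rule usc_borel[OF usc_upper_limit[OF z]])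
  have Z_bd: "\<bar>Z x\<bar> \<le> S" for x unfolding Z_def by (rule upper_limit_abs_le[OF z])
  have S: "0 \<le> S" using z[of 0 x0] by linarith
  obtain K where K: "0 \<le> K" "\<And>y v. dist y x0 < \<rho> / 3 \<Longrightarrow> norm v < \<rho> / 3 \<Longrightarrow> \<bar>second_diff \<phi> y v\<bar> \<le> K * (norm v)\<^sup>2"
    using C2_on_second_diff_bound[OF \<phi> \<rho>] by blast
  define r where "r = \<rho> / 3"
  have r: "0 < r" using \<rho> by (simp add: r_def)
  \<comment> \<open>The added paraboloid makes the contact strict and costs
    \<open>2 * \<gamma> * near r\<close> in each direction; this choice keeps the total within
    \<open>\<kappa>\<close>.\<close>
  define \<gamma> where "\<gamma> = \<kappa> / (2 * (real k * near r + 1))"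
  have den: "0 < real k * near r + 1" using near_nonneg[of r] by (intro add_nonneg_pos) auto
  have \<gamma>: "0 < \<gamma>" using \<kappa> den by (simp add: \<gamma>_def)
  \<comment> \<open>The value 0 outside the ball makes \<open>\<psi>\<close> Borel, since
    \<open>\<phi>\<close> is unconstrained there.\<close>
  define \<psi> where "\<psi> x = (if x \<in> ball x0 \<rho> then \<phi> x + \<gamma> * (norm (x - x0))\<^sup>2 else 0)" for x
  have cont_\<phi>: "continuous_on (ball x0 \<rho>) \<phi>" using \<phi> by (rule C2_on_continuous)
  have cont_\<psi>: "continuous_on (ball x0 \<rho>) \<psi>"
  proof (rule continuous_on_eq)
    show "continuous_on (ball x0 \<rho>) (\<lambda>x. \<phi> x + \<gamma> * (norm (x - x0))\<^sup>2)" by (intro continuous_intros cont_\<phi>)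
  qed (simp add: \<psi>_def)
  have [measurable]: "\<psi> \<in> borel_measurable borel"
  proof -
    have "(\<lambda>x. indicator (ball x0 \<rho>) x *\<^sub>R \<psi> x) \<in> borel_measurable borel"
      by (rule borel_measurable_continuous_on_indicator[OF _ cont_\<psi>]) simp
    also have "(\<lambda>x. indicator (ball x0 \<rho>) x *\<^sub>R \<psi> x) = \<psi>" by (auto simp: indicator_def \<psi>_def)
    finally show ?thesis .
  qed
  have \<psi>_at: "isCont \<psi> x" if "x \<in> ball x0 \<rho>" for x
    using cont_\<psi> that by (simp add: continuous_on_eq_continuous_at)
  have sd_\<psi>: "second_diff \<psi> y (\<tau> *\<^sub>R \<xi>) = second_diff \<phi> y (\<tau> *\<^sub>R \<xi>) + 2 * \<gamma> * \<tau>\<^sup>2"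
    if "dist y x0 < r" "0 < \<tau>" "\<tau> < r" "norm \<xi> = 1" for y \<tau> \<xi>
  proof -
    have "dist y x0 < \<rho>" using that(1) \<rho> by (simp add: r_def)
    moreover have "dist (y + \<tau> *\<^sub>R \<xi>) x0 < \<rho>" "dist (y - \<tau> *\<^sub>R \<xi>) x0 < \<rho>"
      using that norm_triangle_ineq[of "y - x0" "\<tau> *\<^sub>R \<xi>"] norm_triangle_ineq4[of "y - x0" "\<tau> *\<^sub>R \<xi>"] \<rho>
      by (auto simp: r_def dist_norm algebra_simps)
    ultimately have "second_diff \<psi> y (\<tau> *\<^sub>R \<xi>) = second_diff \<phi> y (\<tau> *\<^sub>R \<xi>)
        + second_diff (\<lambda>p. \<gamma> / 2 * ((norm (p - x0))\<^sup>2 + (norm (p - x0))\<^sup>2)) y (\<tau> *\<^sub>R \<xi>)"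
      by (simp add: second_diff_def \<psi>_def dist_commute distrib_left)
    then show ?thesis by (simp only: second_diff_paraboloid[OF that(4)])
  qed
  \<comment> \<open>Replacing \<open>z\<close> by the test function at a near maximum costs
    \<open>2 * \<eta> j\<close> on jumps beyond \<open>h j\<close>, hence
    \<open>2 * \<eta> j * tail (h j)\<close> after integration. Since \<open>tail (h j)\<close>
    tends to infinity, \<open>\<eta>\<close> has to compensate for it.\<close>
  define \<eta> where "\<eta> j = inverse (real (Suc j)) / (1 + tail (h j))" for j
  have t1: "0 < 1 + tail (h j)" for j using tail_pos[OF h(1)[of j]] by simp
  have \<eta>_pos: "0 < \<eta> j" for j using t1[of j] by (simp add: \<eta>_def)
  have \<eta>_le: "\<eta> j \<le> inverse (real (Suc j))" "\<eta> j * tail (h j) \<le> inverse (real (Suc j))" for j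
  proof -
    have "\<eta> j * (1 + tail (h j)) = inverse (real (Suc j))" using t1[of j] by (simp add: \<eta>_def)
    then have "\<eta> j + \<eta> j * tail (h j) = inverse (real (Suc j))" by (simp add: distrib_left)
    moreover have "0 \<le> \<eta> j * tail (h j)" using \<eta>_pos[of j] tail_pos[OF h(1)[of j]] by simp
    ultimately show "\<eta> j \<le> inverse (real (Suc j))" "\<eta> j * tail (h j) \<le> inverse (real (Suc j))"
      using \<eta>_pos[of j] by linarith+
  qed
  have \<eta>_lim: "\<eta> \<longlonglongrightarrow> 0"
    by (rule tendsto_sandwich[OF _ _ tendsto_const LIMSEQ_inverse_real_of_nat])
      (use \<eta>_le \<eta>_pos in \<open>auto intro!: always_eventually simp: less_imp_le\<close>)
  have sub: "cball x0 (2 * r) \<subseteq> ball x0 \<rho>" using \<rho> by (auto simp: r_def)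
  have strict: "upper_limit z x - \<psi> x < upper_limit z x0 - \<psi> x0" if "x \<in> cball x0 (2 * r)" "x \<noteq> x0" for x
  proof -
    have x: "x \<in> ball x0 \<rho>" using that sub by blast
    have "0 < \<gamma> * (norm (x - x0))\<^sup>2" using \<gamma> that by simp
    then show ?thesis using touch[OF x] x \<rho> by (simp add: \<psi>_def)
  qed
  obtain a0 p0 where a0: "filterlim a0 at_top sequentially" and p0: "p0 \<longlonglongrightarrow> x0"
    and zp0: "(\<lambda>i. z (a0 i) (p0 i)) \<longlonglongrightarrow> Z x0"
    and max0: "\<And>i x. x \<in> cball x0 (2 * r) \<Longrightarrow> z (a0 i) x - \<psi> x \<le> z (a0 i) (p0 i) - \<psi> (p0 i) + \<eta> (a0 i)"
    unfolding Z_def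
    using relaxed_contact_points[OF z _ continuous_on_subset[OF cont_\<psi> sub] strict \<eta>_pos \<eta>_lim] r by auto
  have "\<forall>\<^sub>F i in sequentially. p0 i \<in> \<Omega> \<and> dist (p0 i) x0 < r"
    using topological_tendstoD[OF p0 \<Omega> x0] tendstoD[OF p0 r] by eventually_elim simp
  then obtain N where N: "\<And>i. N \<le> i \<Longrightarrow> p0 i \<in> \<Omega> \<and> dist (p0 i) x0 < r" by (auto simp: eventually_sequentially)
  have "\<exists>e\<in>\<E>. - c (a0 (i + N)) \<le> (\<Sum>l<k. far (h (a0 (i + N))) (z (a0 (i + N))) (p0 (i + N)) (e l)) + m * z (a0 (i + N)) (p0 (i + N))" for i
    using eq N[of "i + N"] by simp
  then obtain E0 where E0: "\<And>i. E0 i \<in> \<E>"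
    "\<And>i. - c (a0 (i + N)) \<le> (\<Sum>l<k. far (h (a0 (i + N))) (z (a0 (i + N))) (p0 (i + N)) (E0 i l)) + m * z (a0 (i + N)) (p0 (i + N))"
    by metis
  obtain q e where q: "strict_mono (q :: nat \<Rightarrow> nat)" "\<And>l. l < k \<Longrightarrow> (\<lambda>i. E0 (q i) l) \<longlonglongrightarrow> e l"
    using frames_convergent_subseq[of k E0] frames[OF E0(1)] by (auto simp: frame_def)
  define w where "w i = q i + N" for i
  have w_top: "filterlim w at_top sequentially"
    unfolding w_def by (rule filterlim_at_top_mono[OF filterlim_subseq[OF q(1)]]) auto
  define a p E where "a i = a0 (w i)" and "p i = p0 (w i)" and "E i = E0 (q i)" for i
  have a_top: "filterlim a at_top sequentially" unfolding a_def by (rule filterlim_compose[OF a0 w_top])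
  have p_lim: "p \<longlonglongrightarrow> x0" unfolding p_def by (rule filterlim_compose[OF p0 w_top])
  have zp: "(\<lambda>i. z (a i) (p i)) \<longlonglongrightarrow> Z x0" unfolding a_def p_def using filterlim_compose[OF zp0 w_top] .
  have p_near: "dist (p i) x0 < r" for i using N[of "w i"] by (simp add: p_def w_def)
  have e_in: "e \<in> \<E>" by (rule closed[of "\<lambda>i. E0 (q i)"]) (use E0(1) q(2) in auto)
  have E_lim: "(\<lambda>i. E i l) \<longlonglongrightarrow> e l" if "l < k" for l using q(2)[OF that] by (simp add: E_def)
  have E_norm: "norm (E i l) = 1" "norm (e l) = 1" if "l < k" for i l
    using frames[OF E0(1)[of "q i"]] frames[OF e_in] that by (auto simp: frame_def E_def)
  have E_eq: "- c (a i) \<le> (\<Sum>l<k. far (h (a i)) (z (a i)) (p i) (E i l)) + m * z (a i) (p i)" for i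
    using E0(2)[of "q i"] by (simp add: a_def p_def E_def w_def)
  have h_lim: "(\<lambda>i. h (a i)) \<longlonglongrightarrow> 0" using filterlim_compose[OF h(2) a_top] .
  \<comment> \<open>Jumps below \<open>r\<close> are taken from \<open>\<psi>\<close>, whose second
    differences are O(\<open>\<tau>\<^sup>2\<close>) uniformly in \<open>i\<close>; this provides a
    dominating function while the truncation length tends to 0.\<close>
  define f where "f l i \<tau> = indicator {h (a i)..} \<tau> *
    (if \<tau> < r then second_diff \<psi> (p i) (\<tau> *\<^sub>R E i l) else second_diff (z (a i)) (p i) (\<tau> *\<^sub>R E i l))" for l i \<tau>
  define g where "g l \<tau> = (if \<tau> < r then second_diff \<psi> x0 (\<tau> *\<^sub>R e l) else second_diff Z x0 (\<tau> *\<^sub>R e l))" for l \<tau>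
  define B where "B = (K + 2 * \<gamma>) * max 1 (r\<^sup>2) + 4 * S / min 1 (r\<^sup>2)"
  have small: "(K + 2 * \<gamma>) * \<tau>\<^sup>2 \<le> B * min 1 (\<tau>\<^sup>2)" if "0 < \<tau>" "\<tau> < r" for \<tau>
  proof -
    have "\<tau>\<^sup>2 \<le> r\<^sup>2" using that by (intro power_mono) auto
    then have "\<tau>\<^sup>2 \<le> max 1 (r\<^sup>2) * min 1 (\<tau>\<^sup>2)"
    proof (cases "\<tau>\<^sup>2 \<le> 1")
      case True
      have "1 * \<tau>\<^sup>2 \<le> max 1 (r\<^sup>2) * \<tau>\<^sup>2" by (intro mult_right_mono) auto
      with True show ?thesis by (simp add: min_def)
    qed (simp add: min_def max_def)
    then have "(K + 2 * \<gamma>) * \<tau>\<^sup>2 \<le> (K + 2 * \<gamma>) * (max 1 (r\<^sup>2) * min 1 (\<tau>\<^sup>2))"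
      using K(1) \<gamma> by (intro mult_left_mono) auto
    moreover have "0 \<le> 4 * S / min 1 (r\<^sup>2) * min 1 (\<tau>\<^sup>2)" using S by simp
    ultimately show ?thesis unfolding B_def distrib_right mult.assoc by linarith
  qed
  have large: "indicator {r..} \<tau> * \<bar>second_diff u y v\<bar> \<le> B * min 1 (\<tau>\<^sup>2)"
    if "0 < \<tau>" "\<And>x. \<bar>u x\<bar> \<le> S" for u :: "'a \<Rightarrow> real" and y v \<tau>
  proof -
    have "\<bar>indicator {r..} \<tau> * second_diff u y (1 *\<^sub>R v)\<bar> \<le> 4 * S / min 1 (r\<^sup>2) * min 1 (\<tau>\<^sup>2)"
    proof (cases "r \<le> \<tau>")
      case True
      have "\<bar>second_diff u y v\<bar> \<le> 4 * S"
        using that(2)[of "y + v"] that(2)[of "y - v"] that(2)[of y] by (auto simp: second_diff_def)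
      from abs_le_min_square[OF r True this] True show ?thesis by simp
    qed (use S in simp)
    moreover have "0 \<le> (K + 2 * \<gamma>) * max 1 (r\<^sup>2) * min 1 (\<tau>\<^sup>2)" using K(1) \<gamma> by simp
    ultimately show ?thesis unfolding B_def distrib_right by (simp add: abs_mult)
  qed
  have sd_\<psi>_bd: "\<bar>second_diff \<psi> y (\<tau> *\<^sub>R \<xi>)\<bar> \<le> B * min 1 (\<tau>\<^sup>2)"
    if "dist y x0 < r" "0 < \<tau>" "\<tau> < r" "norm \<xi> = 1" for y \<tau> \<xi>
  proof -
    have "\<bar>second_diff \<phi> y (\<tau> *\<^sub>R \<xi>)\<bar> \<le> K * \<tau>\<^sup>2" using K(2)[of y "\<tau> *\<^sub>R \<xi>"] that by (simp add: r_def)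
    moreover have "0 \<le> 2 * \<gamma> * \<tau>\<^sup>2" using \<gamma> by simp
    ultimately have "\<bar>second_diff \<psi> y (\<tau> *\<^sub>R \<xi>)\<bar> \<le> (K + 2 * \<gamma>) * \<tau>\<^sup>2"
      unfolding sd_\<psi>[OF that] distrib_right by linarith
    also have "\<dots> \<le> B * min 1 (\<tau>\<^sup>2)" using that by (intro small) auto
    finally show ?thesis .
  qed
  have B0: "0 \<le> B" using K(1) \<gamma> S by (simp add: B_def)
  have f_meas: "f l i \<in> borel_measurable borel" for l i
    unfolding f_def[abs_def] using meas[of "a i"] by measurable
  have g_meas: "g l \<in> borel_measurable borel" for l
    unfolding g_def[abs_def] by measurable
  have f_bd: "\<bar>f l i \<tau>\<bar> \<le> B * min 1 (\<tau>\<^sup>2)" if l: "l < k" and \<tau>: "0 < \<tau>" for l i \<tau>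
  proof (cases "h (a i) \<le> \<tau>")
    case True
    show ?thesis
    proof (cases "\<tau> < r")
      case True
      then show ?thesis using sd_\<psi>_bd[OF p_near \<tau> True E_norm(1)[OF l]] \<open>h (a i) \<le> \<tau>\<close> by (simp add: f_def)
    next
      case False
      then show ?thesis using large[OF \<tau>, of "z (a i)" "p i" "\<tau> *\<^sub>R E i l"] z \<open>h (a i) \<le> \<tau>\<close> by (simp add: f_def)
    qed
  qed (use B0 in \<open>simp add: f_def\<close>)
  have g_bd: "\<bar>g l \<tau>\<bar> \<le> B * min 1 (\<tau>\<^sup>2)" if l: "l < k" and \<tau>: "0 < \<tau>" for l \<tau>
  proof (cases "\<tau> < r")
    case True
    then show ?thesis using sd_\<psi>_bd[OF _ \<tau> True E_norm(2)[OF l], of x0] r by (simp add: g_def)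
  next
    case False
    then show ?thesis using large[OF \<tau>, of Z x0 "\<tau> *\<^sub>R e l"] Z_bd by (simp add: g_def)
  qed
  \<comment> \<open>Below \<open>r\<close> this is continuity of \<open>\<psi>\<close>. Beyond
    \<open>r\<close> the relaxed limit controls the endpoints from above, and the centre, which has
    negative weight, is controlled by convergence of its values.\<close>
  have fg_lim: "\<forall>\<^sub>F i in sequentially. f l i \<tau> \<le> g l \<tau> + t" if l: "l < k" and \<tau>: "0 < \<tau>" and t: "0 < t" for l \<tau> t
  proof -
    have h_le: "\<forall>\<^sub>F i in sequentially. h (a i) < \<tau>" using order_tendstoD(2)[OF h_lim \<tau>] .
    have plus: "(\<lambda>i. p i + \<tau> *\<^sub>R E i l) \<longlonglongrightarrow> x0 + \<tau> *\<^sub>R e l" by (intro tendsto_intros p_lim E_lim l)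
    have minus: "(\<lambda>i. p i - \<tau> *\<^sub>R E i l) \<longlonglongrightarrow> x0 - \<tau> *\<^sub>R e l" by (intro tendsto_intros p_lim E_lim l)
    show ?thesis
    proof (cases "\<tau> < r")
      case True
      have in_ball: "x0 + \<tau> *\<^sub>R e l \<in> ball x0 \<rho>" "x0 - \<tau> *\<^sub>R e l \<in> ball x0 \<rho>" "x0 \<in> ball x0 \<rho>"
        using True \<tau> E_norm(2)[OF l] \<rho> by (auto simp: dist_norm r_def)
      have "(\<lambda>i. second_diff \<psi> (p i) (\<tau> *\<^sub>R E i l)) \<longlonglongrightarrow> second_diff \<psi> x0 (\<tau> *\<^sub>R e l)"
        unfolding second_diff_def
        by (intro tendsto_intros isCont_tendsto_compose[OF \<psi>_at[OF in_ball(1)] plus]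
            isCont_tendsto_compose[OF \<psi>_at[OF in_ball(2)] minus] isCont_tendsto_compose[OF \<psi>_at[OF in_ball(3)] p_lim])
      from order_tendstoD(2)[OF this, of "second_diff \<psi> x0 (\<tau> *\<^sub>R e l) + t"] t
      have "\<forall>\<^sub>F i in sequentially. second_diff \<psi> (p i) (\<tau> *\<^sub>R E i l) < second_diff \<psi> x0 (\<tau> *\<^sub>R e l) + t" by simp
      with h_le show ?thesis by eventually_elim (use True in \<open>simp add: f_def g_def\<close>)
    next
      case False
      have "\<forall>\<^sub>F i in sequentially. z (a i) (p i + \<tau> *\<^sub>R E i l) < Z (x0 + \<tau> *\<^sub>R e l) + t / 4"
        using t by (intro upper_limit_sequence[OF z _ a_top plus]) (simp add: Z_def)
      moreover have "\<forall>\<^sub>F i in sequentially. z (a i) (p i - \<tau> *\<^sub>R E i l) < Z (x0 - \<tau> *\<^sub>R e l) + t / 4"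
        using t by (intro upper_limit_sequence[OF z _ a_top minus]) (simp add: Z_def)
      moreover have "\<forall>\<^sub>F i in sequentially. Z x0 - t / 4 < z (a i) (p i)"
        using t by (intro order_tendstoD(1)[OF zp]) simp
      ultimately show ?thesis
        using h_le by eventually_elim (use False in \<open>simp add: f_def g_def second_diff_def\<close>)
    qed
  qed
  have far_le: "far (h (a i)) (z (a i)) (p i) (E i l) \<le> integral\<^sup>L levy (f l i) + 2 * inverse (real (Suc (a i)))" if l: "l < k" for l i
  proof -
    have hp: "0 < h (a i)" by (rule h(1))
    have int_f: "integrable levy (f l i)" using f_bd[OF l] by (intro integrable_levy_bound[OF f_meas])
    have Linf: "L_infty (z (a i))" using meas z by (intro L_inftyI)
    have "far (h (a i)) (z (a i)) (p i) (E i l) \<le> (\<integral>\<tau>. f l i \<tau> + 2 * \<eta> (a i) * indicator {h (a i)..} \<tau> \<partial>levy)"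
      unfolding far_def
    proof (rule integral_levy_mono[OF integrable_far[OF Linf hp]])
      show "integrable levy (\<lambda>\<tau>. f l i \<tau> + 2 * \<eta> (a i) * indicator {h (a i)..} \<tau>)"
        by (intro Bochner_Integration.integrable_add int_f integrable_mult_right integrable_tail hp)
      fix \<tau> :: real assume \<tau>: "0 < \<tau>"
      show "indicator {h (a i)..} \<tau> * second_diff (z (a i)) (p i) (\<tau> *\<^sub>R E i l)
        \<le> f l i \<tau> + 2 * \<eta> (a i) * indicator {h (a i)..} \<tau>"
      proof (cases "h (a i) \<le> \<tau> \<and> \<tau> < r")
        case True
        have "dist (p i + \<tau> *\<^sub>R E i l) x0 \<le> 2 * r" "dist (p i - \<tau> *\<^sub>R E i l) x0 \<le> 2 * r"
          using norm_triangle_ineq[of "p i - x0" "\<tau> *\<^sub>R E i l"] norm_triangle_ineq4[of "p i - x0" "\<tau> *\<^sub>R E i l"]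
            p_near[of i] True \<tau> E_norm(1)[OF l, of i] by (auto simp: dist_norm algebra_simps)
        then have "z (a i) (p i + \<tau> *\<^sub>R E i l) - \<psi> (p i + \<tau> *\<^sub>R E i l) \<le> z (a i) (p i) - \<psi> (p i) + \<eta> (a i)"
          "z (a i) (p i - \<tau> *\<^sub>R E i l) - \<psi> (p i - \<tau> *\<^sub>R E i l) \<le> z (a i) (p i) - \<psi> (p i) + \<eta> (a i)"
          unfolding a_def p_def by (auto intro!: max0 simp: dist_commute)
        then show ?thesis using True by (simp add: f_def second_diff_def)
      next
        case False
        then show ?thesis using \<eta>_pos[of "a i"] by (auto simp: f_def indicator_def)
      qed
    qed
    also have "\<dots> = integral\<^sup>L levy (f l i) + 2 * \<eta> (a i) * tail (h (a i))"
      by (subst Bochner_Integration.integral_add[OF int_f integrable_mult_right[OF integrable_tail[OF hp]]])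
        (simp only: integral_mult_right_zero integral_tail[OF hp])
    also have "2 * \<eta> (a i) * tail (h (a i)) \<le> 2 * inverse (real (Suc (a i)))" using \<eta>_le(2)[of "a i"] by simp
    finally show ?thesis by simp
  qed
  have limit: "- c0 \<le> (\<Sum>l<k. integral\<^sup>L levy (g l)) + m * Z x0"
  proof (rule field_le_epsilon)
    fix t :: real assume t: "0 < t"
    define u where "u = t / (real k + 1)"
    have u: "0 < u" using t by (simp add: u_def)
    have "\<forall>\<^sub>F i in sequentially. \<forall>l\<in>{..<k}. integral\<^sup>L levy (f l i) \<le> integral\<^sup>L levy (g l) + u"
    proof (rule eventually_ball_finite, simp, rule ballI)
      fix l assume "l \<in> {..<k}"
      then have l: "l < k" by simp
      show "\<forall>\<^sub>F i in sequentially. integral\<^sup>L levy (f l i) \<le> integral\<^sup>L levy (g l) + u"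
        by (rule integral_levy_limsup[OF f_meas g_meas f_bd[OF l] g_bd[OF l] fg_lim[OF l] u])
    qed
    then have ev: "\<forall>\<^sub>F i in sequentially. - c (a i) - real k * (2 * inverse (real (Suc (a i)))) - m * z (a i) (p i)
       \<le> (\<Sum>l<k. integral\<^sup>L levy (g l)) + real k * u"
    proof eventually_elim
      case (elim i)
      have "(\<Sum>l<k. far (h (a i)) (z (a i)) (p i) (E i l))
        \<le> (\<Sum>l<k. integral\<^sup>L levy (g l) + (u + 2 * inverse (real (Suc (a i)))))"
      proof (rule sum_mono)
        fix l assume l: "l \<in> {..<k}"
        then have "integral\<^sup>L levy (f l i) \<le> integral\<^sup>L levy (g l) + u" using elim by blast
        then show "far (h (a i)) (z (a i)) (p i) (E i l) \<le> integral\<^sup>L levy (g l) + (u + 2 * inverse (real (Suc (a i))))"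
          using far_le[of l i] l by simp
      qed
      also have "\<dots> = (\<Sum>l<k. integral\<^sup>L levy (g l)) + real k * (u + 2 * inverse (real (Suc (a i))))"
        by (simp only: sum.distrib[of "\<lambda>l. integral\<^sup>L levy (g l)"] sum_constant card_lessThan)
      finally show ?case using E_eq[of i] by (simp add: distrib_left)
    qed
    have "(\<lambda>i. - c (a i) - real k * (2 * inverse (real (Suc (a i)))) - m * z (a i) (p i))
      \<longlonglongrightarrow> - c0 - real k * (2 * 0) - m * Z x0"
      by (intro tendsto_intros filterlim_compose[OF c a_top] zp
          filterlim_compose[OF LIMSEQ_inverse_real_of_nat a_top])
    from tendsto_upperbound[OF this ev] have "- c0 - m * Z x0 \<le> (\<Sum>l<k. integral\<^sup>L levy (g l)) + real k * u" by simp
    moreover have "real k * u \<le> t"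
    proof -
      have "real k * u \<le> (real k + 1) * u" using u by simp
      also have "\<dots> = t" by (simp add: u_def)
      finally show ?thesis .
    qed
    ultimately show "- c0 \<le> (\<Sum>l<k. integral\<^sup>L levy (g l)) + m * Z x0 + t" by linarith
  qed
  \<comment> \<open>Subtracting the paraboloid again leaves \<open>\<phi>\<close> on
    \<open>(0, r)\<close> and the relaxed limit beyond; between \<open>r\<close> and
    \<open>\<rho>\<close> the contact condition bounds the latter by \<open>\<phi>\<close>.\<close>
  define L where "L l \<tau> = g l \<tau> - 2 * \<gamma> * (\<tau>\<^sup>2 * indicator {0<..<r} \<tau>)" for l \<tau>
  have g_int: "integrable levy (g l)" if "l < k" for l
    using g_bd[OF that] by (intro integrable_levy_bound[OF g_meas])
  have L_eq: "L l \<tau> = second_diff \<phi> x0 (\<tau> *\<^sub>R e l)" if "l < k" "0 < \<tau>" "\<tau> < r" for l \<tau>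
    using sd_\<psi>[OF _ that(2,3) E_norm(2)[OF that(1)], of x0] that r by (simp add: L_def g_def)
  have L_far: "L l \<tau> = second_diff Z x0 (\<tau> *\<^sub>R e l)" if "r \<le> \<tau>" for l \<tau>
    using that by (simp add: L_def g_def)
  show ?thesis
  proof (rule that[OF e_in, of L])
    show "integrable levy (L l)" if "l < k" for l
      unfolding L_def using g_int[OF that] integrable_near[OF r] by (intro Bochner_Integration.integrable_diff integrable_mult_right)
    show "L l \<tau> \<le> second_diff \<phi> x0 (\<tau> *\<^sub>R e l)" if l: "l < k" and \<tau>: "0 < \<tau>" "\<tau> < \<rho>" for l \<tau>
    proof (cases "\<tau> < r")
      case False
      have "x0 + \<tau> *\<^sub>R e l \<in> ball x0 \<rho>" "x0 - \<tau> *\<^sub>R e l \<in> ball x0 \<rho>"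
        using \<tau> E_norm(2)[OF l] by (auto simp: dist_norm)
      from touch[OF this(1)] touch[OF this(2)] False show ?thesis
        by (simp add: L_far second_diff_def Z_def)
    qed (use L_eq[OF l \<tau>(1)] in simp)
    show "L l \<tau> \<le> second_diff (upper_limit z) x0 (\<tau> *\<^sub>R e l)" if "l < k" "\<rho> \<le> \<tau>" for l \<tau>
    proof -
      have "r \<le> \<tau>" using that(2) \<rho> by (simp add: r_def)
      then show ?thesis by (simp add: L_far Z_def)
    qed
    have "(\<Sum>l<k. integral\<^sup>L levy (L l)) = (\<Sum>l<k. integral\<^sup>L levy (g l) - 2 * \<gamma> * near r)"
    proof (rule sum.cong)
      fix l assume "l \<in> {..<k}"
      then have "integrable levy (g l)" by (intro g_int) simp
      then show "integral\<^sup>L levy (L l) = integral\<^sup>L levy (g l) - 2 * \<gamma> * near r"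
        unfolding L_def
        by (subst Bochner_Integration.integral_diff[OF _ integrable_mult_right[OF integrable_near[OF r]]])
          (simp_all only: integral_mult_right_zero integral_near[OF r])
    qed simp
    also have "\<dots> = (\<Sum>l<k. integral\<^sup>L levy (g l)) - real k * (2 * \<gamma> * near r)" by (simp add: sum_subtractf)
    finally have "(\<Sum>l<k. integral\<^sup>L levy (L l)) = (\<Sum>l<k. integral\<^sup>L levy (g l)) - 2 * \<gamma> * (real k * near r)" by simp
    moreover have "2 * \<gamma> * (real k * near r) \<le> \<kappa>"
    proof -
      have "2 * \<gamma> * (real k * near r) \<le> 2 * \<gamma> * (real k * near r + 1)" using \<gamma> by (intro mult_left_mono) auto
      also have "\<dots> = \<kappa>"
      proof -
        have "2 * (\<kappa> / (2 * t)) * t = \<kappa>" if "0 < t" for t :: real using that by simp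
        then show ?thesis unfolding \<gamma>_def using den .
      qed
      finally show ?thesis .
    qed
    ultimately show "- c0 - \<kappa> \<le> (\<Sum>l<k. integral\<^sup>L levy (L l)) + m * upper_limit z x0"
      using limit unfolding Z_def by linarith
  qed
qed

end

section \<open>The truncated equation\<close>

lemma usc_sequentiallyI:
  fixes f :: "'a::metric_space \<Rightarrow> real"
  assumes "\<And>X x c. X \<longlonglongrightarrow> x \<Longrightarrow> f x < c \<Longrightarrow> \<forall>\<^sub>F j in sequentially. f (X j) < c"
  shows "usc f"
  unfolding usc_def
proof
  fix c
  show "open {x. f x < c}"
  proof (subst open_subopen, intro ballI)
    fix x assume "x \<in> {x. f x < c}"
    then have "\<forall>\<^sub>F y in nhds x. f y < c"
      unfolding eventually_nhds_iff_sequentially by (intro allI impI assms) simp_all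
    then show "\<exists>T. open T \<and> x \<in> T \<and> T \<subseteq> {x. f x < c}"
      unfolding eventually_nhds by (simp add: subset_eq)
  qed
qed

lemma usc_sum: "(\<And>i. i < k \<Longrightarrow> usc (f i)) \<Longrightarrow> usc (\<lambda>x. \<Sum>i<k. f i x)" for k :: nat
proof (induction k)
  case 0
  show ?case by (auto simp: usc_def)
next
  case (Suc k)
  then show ?case by (auto intro: usc_add)
qed

lemma usc_minus_imp_lsc_on: "usc (\<lambda>x. - v x) \<Longrightarrow> lsc_on S v"
  unfolding lsc_on_def
proof (intro ballI allI impI)
  fix x c assume "usc (\<lambda>x. - v x)" and c: "c < v x"
  then have "open {x. - v x < - c}" unfolding usc_def by blast
  then show "\<forall>\<^sub>F y in at x within S. c < v y"
    using c unfolding eventually_at_topological by (intro exI[of _ "{x. - v x < - c}"]) auto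
qed

lemma C2_on_minus:
  fixes \<phi> :: "'a::euclidean_space \<Rightarrow> real"
  assumes "C2_on S \<phi>" shows "C2_on S (\<lambda>x. - \<phi> x)"
proof -
  from assms obtain g H where "\<forall>x\<in>S. (\<phi> has_derivative (\<lambda>h. g x \<bullet> h)) (at x)"
    "\<forall>x\<in>S. (g has_derivative blinfun_apply (H x)) (at x)" "continuous_on S H"
    unfolding C2_on_def by blast
  then show ?thesis
    unfolding C2_on_def
    by (intro exI[of _ "\<lambda>x. - g x"] exI[of _ "\<lambda>x. - H x"])
      (auto intro!: derivative_eq_intros continuous_intros simp: uminus_blinfun.rep_eq)
qed

context fractional_order
begin

text \<open>\<open>far\<close> without the contribution of the centre. In this form the dependence
  on \<open>u\<close> is monotone, which \<open>far\<close> lacks because of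
  \<open>- 2 * u x\<close>.\<close>

definition average :: "real \<Rightarrow> ('a::euclidean_space \<Rightarrow> real) \<Rightarrow> 'a \<Rightarrow> 'a \<Rightarrow> real" where
  "average h u x \<xi> = far h u x \<xi> + 2 * u x * tail h"

lemma average_mono:
  assumes "L_infty u" "L_infty w" "0 < h" "\<And>x. u x \<le> w x"
  shows "average h u x \<xi> \<le> average h w x \<xi>"
proof -
  have "far h u x \<xi> \<le> far h w x \<xi> + (2 * w x - 2 * u x) * tail h"
  proof (rule far_le[OF assms(1-3)])
    fix \<tau> show "second_diff u x (\<tau> *\<^sub>R \<xi>) \<le> second_diff w x (\<tau> *\<^sub>R \<xi>) + (2 * w x - 2 * u x)"
      using assms(4)[of "x + \<tau> *\<^sub>R \<xi>"] assms(4)[of "x - \<tau> *\<^sub>R \<xi>"] by (simp add: second_diff_def)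
  qed
  then show ?thesis by (simp add: average_def left_diff_distrib)
qed

lemma average_const: "average h (\<lambda>x. c) x \<xi> = 2 * c * tail h"
  by (simp add: average_def far_def second_diff_def)

lemma average_integral:
  assumes "L_infty u" "0 < h"
  shows "average h u x \<xi> = (\<integral>\<tau>. indicator {h..} \<tau> * (u (x + \<tau> *\<^sub>R \<xi>) + u (x - \<tau> *\<^sub>R \<xi>)) \<partial>levy)"
proof -
  have "far h u x \<xi> + 2 * u x * tail h =
    (\<integral>\<tau>. indicator {h..} \<tau> * second_diff u x (\<tau> *\<^sub>R \<xi>) + 2 * u x * indicator {h..} \<tau> \<partial>levy)"
    unfolding far_def
    by (subst Bochner_Integration.integral_add[OF integrable_far[OF assms] integrable_mult_right[OF integrable_tail[OF assms(2)]]])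
      (simp only: integral_mult_right_zero integral_tail[OF assms(2)])
  also have "\<dots> = (\<integral>\<tau>. indicator {h..} \<tau> * (u (x + \<tau> *\<^sub>R \<xi>) + u (x - \<tau> *\<^sub>R \<xi>)) \<partial>levy)"
    by (intro Bochner_Integration.integral_cong) (auto simp: second_diff_def algebra_simps)
  finally show ?thesis by (simp add: average_def)
qed

text \<open>A Fatou property: averaging along lines preserves lower semicontinuity, by the one-sided
  dominated convergence applied to \<open>- u\<close>.\<close>

lemma usc_minus_average:
  assumes usc: "usc (\<lambda>x. - u x)" and u: "\<And>x. \<bar>u x\<bar> \<le> S" and h: "0 < h"
  shows "usc (\<lambda>x. - average h u x \<xi>)"
proof (rule usc_sequentiallyI)
  have "(\<lambda>x. - u x) \<in> borel_measurable borel" using usc by (rule usc_borel)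
  then have meas [measurable]: "u \<in> borel_measurable borel" by simp
  have Linf: "L_infty u" using meas u by (rule L_inftyI)
  have S: "0 \<le> S" using u[of undefined] by linarith
  fix X x c assume X: "X \<longlonglongrightarrow> x" and c: "- average h u x \<xi> < c"
  define f where "f y \<tau> = - (indicator {h..} \<tau> * (u (y + \<tau> *\<^sub>R \<xi>) + u (y - \<tau> *\<^sub>R \<xi>)))" for y \<tau>
  define e where "e = (c + average h u x \<xi>) / 2"
  have e: "0 < e" using c by (simp add: e_def)
  have f_int: "integral\<^sup>L levy (f y) = - average h u y \<xi>" for y
    unfolding f_def average_integral[OF Linf h] by simp
  have bd: "\<bar>f y \<tau>\<bar> \<le> 2 * S / min 1 (h\<^sup>2) * min 1 (\<tau>\<^sup>2)" if "0 < \<tau>" for y \<tau>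
  proof (cases "h \<le> \<tau>")
    case True
    have "\<bar>u (y + \<tau> *\<^sub>R \<xi>) + u (y - \<tau> *\<^sub>R \<xi>)\<bar> \<le> 2 * S"
      using u[of "y + \<tau> *\<^sub>R \<xi>"] u[of "y - \<tau> *\<^sub>R \<xi>"] by linarith
    from abs_le_min_square[OF h True this] True show ?thesis by (simp add: f_def)
  qed (use S in \<open>simp add: f_def\<close>)
  have "\<forall>\<^sub>F j in sequentially. integral\<^sup>L levy (f (X j)) \<le> integral\<^sup>L levy (f x) + e"
  proof (rule integral_levy_limsup[OF _ _ bd bd _ e])
    show "f y \<in> borel_measurable borel" for y unfolding f_def[abs_def] by measurable
    then show "f y \<in> borel_measurable borel" for y .
    fix \<tau> t :: real assume "0 < \<tau>" and t: "0 < t"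
    have lim: "(\<lambda>j. X j + \<tau> *\<^sub>R \<xi>) \<longlonglongrightarrow> x + \<tau> *\<^sub>R \<xi>" "(\<lambda>j. X j - \<tau> *\<^sub>R \<xi>) \<longlonglongrightarrow> x - \<tau> *\<^sub>R \<xi>"
      by (intro tendsto_intros X)+
    have "\<forall>\<^sub>F j in sequentially. - u (X j + \<tau> *\<^sub>R \<xi>) < - u (x + \<tau> *\<^sub>R \<xi>) + t / 2"
      by (rule usc_sequentially[OF usc lim(1)]) (use t in simp)
    moreover have "\<forall>\<^sub>F j in sequentially. - u (X j - \<tau> *\<^sub>R \<xi>) < - u (x - \<tau> *\<^sub>R \<xi>) + t / 2"
      by (rule usc_sequentially[OF usc lim(2)]) (use t in simp)
    ultimately show "\<forall>\<^sub>F j in sequentially. f (X j) \<tau> \<le> f x \<tau> + t"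
      by eventually_elim (use t in \<open>auto simp: f_def indicator_def\<close>)
  qed
  then show "\<forall>\<^sub>F j in sequentially. - average h u (X j) \<xi> < c"
    by eventually_elim (use c in \<open>simp add: f_int e_def\<close>)
qed

text \<open>An obstacle problem with right-hand side -1: the subsolution inequality holds throughout
  \<open>\<Omega>\<close>, the supersolution inequality off the contact set \<open>U = M\<close>.
  The error \<open>\<eta>\<close> is there because the supremum over frames may not be
  attained.\<close>

definition truncated_solution :: "nat \<Rightarrow> real \<Rightarrow> 'a::euclidean_space set \<Rightarrow> real \<Rightarrow> real \<Rightarrow> ('a \<Rightarrow> real) \<Rightarrow> bool" where
  "truncated_solution k m \<Omega> h M U \<longleftrightarrow>
     usc (\<lambda>x. - U x) \<and> (\<forall>x. 0 \<le> U x \<and> U x \<le> M \<and> (x \<notin> \<Omega> \<longrightarrow> U x = 0)) \<and>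
     (\<forall>x\<in>\<Omega>. \<forall>\<eta>>0. \<exists>e. frame k e \<and> - 1 - \<eta> \<le> (\<Sum>i<k. far h U x (e i)) + m * U x) \<and>
     (\<forall>x\<in>\<Omega>. U x < M \<longrightarrow> (\<forall>e. frame k e \<longrightarrow> (\<Sum>i<k. far h U x (e i)) + m * U x \<le> - 1))"

text \<open>
  The equation for the operator truncated to jumps of length at least \<open>h\<close> is a fixed point equation
  \<open>U = \<Phi> U\<close> with \<open>\<Phi>\<close> monotone on lower semicontinuous functions; the largest fixed point below the
  obstacle \<open>M\<close> is the supremum of all \<open>u \<le> \<Phi> u\<close>.
\<close>

lemma truncated_solution_exists:
  fixes \<Omega> :: "'a::euclidean_space set"
  assumes \<Omega>: "open \<Omega>" and k: "k \<le> DIM('a)" and h: "0 < h" and M: "0 < M" and m: "m < 2 * real k * tail h"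
  shows "\<exists>U. truncated_solution k m \<Omega> h M U"
proof -
  \<comment> \<open>With \<open>far\<close> split into \<open>average\<close> and the centre, the
    equation reads \<open>D * U x = T U x + 1\<close>; the bound on \<open>m\<close> makes
    \<open>D\<close> positive and so the map monotone.\<close>
  define D where "D = 2 * real k * tail h - m"
  have D: "0 < D" using m by (simp add: D_def)
  define fr where "fr = {e :: nat \<Rightarrow> 'a. frame k e}"
  have fr: "fr \<noteq> {}" using frame_exists[OF k] by (auto simp: fr_def)
  define T where "T u x = (SUP e\<in>fr. \<Sum>i<k. average h u x (e i))" for u and x :: 'a
  define \<Phi> where "\<Phi> u x = (if x \<in> \<Omega> then min M ((T u x + 1) / D) else 0)" for u x
  define good where "good u \<longleftrightarrow> usc (\<lambda>x. - u x) \<and> (\<forall>x. 0 \<le> u x \<and> u x \<le> M \<and> (x \<notin> \<Omega> \<longrightarrow> u x = 0))" for u :: "'a \<Rightarrow> real"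
  have abs: "\<bar>u x\<bar> \<le> M" if "good u" for u x using that by (auto simp: good_def abs_le_iff intro: order_trans[of _ 0])
  have Linf: "L_infty u" if "good u" for u
  proof (rule L_inftyI[OF _ abs[OF that]])
    have "(\<lambda>x. - u x) \<in> borel_measurable borel" using that by (intro usc_borel) (simp add: good_def)
    then show "u \<in> borel_measurable borel" by simp
  qed
  have Lconst: "L_infty (\<lambda>x::'a. c)" for c by (rule L_inftyI[of _ "\<bar>c\<bar>"]) auto
  have sum_le: "(\<Sum>i<k. average h u x (e i)) \<le> real k * (2 * M * tail h)" if "good u" for u x e
  proof -
    have "average h u x (e i) \<le> 2 * M * tail h" for i
      using average_mono[OF Linf[OF that] Lconst[of M] h, of x "e i"] that by (auto simp: good_def average_const)
    then have "(\<Sum>i<k. average h u x (e i)) \<le> (\<Sum>i<k. 2 * M * tail h)" by (intro sum_mono)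
    then show ?thesis by simp
  qed
  have bdd: "bdd_above ((\<lambda>e. \<Sum>i<k. average h u x (e i)) ` fr)" if "good u" for u x
    using sum_le[OF that] by (intro bdd_aboveI2)
  have T_ge: "(\<Sum>i<k. average h u x (e i)) \<le> T u x" if "good u" "frame k e" for u x e
    unfolding T_def using that by (intro cSUP_upper bdd) (auto simp: fr_def)
  have T_nonneg: "0 \<le> T u x" if "good u" for u x
  proof -
    obtain e :: "nat \<Rightarrow> 'a" where e: "frame k e" using fr by (auto simp: fr_def)
    have "0 \<le> average h u x (e i)" for i
      using average_mono[OF Lconst[of 0] Linf[OF that] h, of x "e i"] that by (auto simp: good_def average_const)
    then have "0 \<le> (\<Sum>i<k. average h u x (e i))" by (intro sum_nonneg)
    with T_ge[OF that e, of x] show ?thesis by linarith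
  qed
  have T_mono: "T u x \<le> T w x" if "good u" "good w" "\<And>x. u x \<le> w x" for u w x
    unfolding T_def using fr
  proof (rule cSUP_least)
    fix e assume e: "e \<in> fr"
    have "(\<Sum>i<k. average h u x (e i)) \<le> (\<Sum>i<k. average h w x (e i))"
      using that by (intro sum_mono average_mono Linf h)
    also have "\<dots> \<le> (SUP e\<in>fr. \<Sum>i<k. average h w x (e i))" using e by (intro cSUP_upper bdd that)
    finally show "(\<Sum>i<k. average h u x (e i)) \<le> (SUP e\<in>fr. \<Sum>i<k. average h w x (e i))" .
  qed
  have \<Phi>_mono: "\<Phi> u x \<le> \<Phi> w x" if "good u" "good w" "\<And>x. u x \<le> w x" for u w x
  proof (cases "x \<in> \<Omega>")
    case True
    have "(T u x + 1) / D \<le> (T w x + 1) / D" using T_mono[OF that, of x] D by (intro divide_right_mono) auto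
    from min.mono[OF order_refl[of M] this] show ?thesis using True by (simp only: \<Phi>_def if_True)
  qed (simp add: \<Phi>_def)
  have \<Phi>_good: "good (\<Phi> u)" if u: "good u" for u
    unfolding good_def
  proof (intro conjI allI impI)
    show "0 \<le> \<Phi> u x" for x using T_nonneg[OF u, of x] D M by (auto simp: \<Phi>_def)
    show "\<Phi> u x \<le> M" for x using M by (simp add: \<Phi>_def)
    show "x \<notin> \<Omega> \<Longrightarrow> \<Phi> u x = 0" for x by (simp add: \<Phi>_def)
    show "usc (\<lambda>x. - \<Phi> u x)"
      unfolding usc_def
    proof
      fix c
      show "open {x. - \<Phi> u x < c}"
      proof (cases "0 < c")
        case True
        then have "{x. - \<Phi> u x < c} = UNIV"
          using T_nonneg[OF u] D M by (auto simp: \<Phi>_def intro!: add_nonneg_pos add_pos_nonneg) (smt (verit) divide_nonneg_pos)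
        then show ?thesis by simp
      next
        case c: False
        show ?thesis
        proof (cases "M \<le> - c")
          case True
          then have "{x. - \<Phi> u x < c} = {}" using c M by (auto simp: \<Phi>_def)
          then show ?thesis by simp
        next
          case False
          have "- \<Phi> u x < c \<longleftrightarrow> x \<in> \<Omega> \<and> (\<exists>e\<in>fr. (\<Sum>i<k. - average h u x (e i)) < c * D + 1)" for x
          proof (cases "x \<in> \<Omega>")
            case True
            have "- \<Phi> u x < c \<longleftrightarrow> - c < (T u x + 1) / D" using True False by (auto simp: \<Phi>_def min_def)
            also have "\<dots> \<longleftrightarrow> - c * D - 1 < T u x" using D by (auto simp: pos_less_divide_eq)
            also have "\<dots> \<longleftrightarrow> (\<exists>e\<in>fr. - c * D - 1 < (\<Sum>i<k. average h u x (e i)))"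
              unfolding T_def by (rule less_cSUP_iff[OF fr bdd[OF u]])
            also have "\<dots> \<longleftrightarrow> (\<exists>e\<in>fr. (\<Sum>i<k. - average h u x (e i)) < c * D + 1)"
              by (intro bex_cong refl) (auto simp: sum_negf)
            finally show ?thesis using True by simp
          qed (use c in \<open>simp add: \<Phi>_def\<close>)
          then have "{x. - \<Phi> u x < c} = \<Omega> \<inter> (\<Union>e\<in>fr. {x. (\<Sum>i<k. - average h u x (e i)) < c * D + 1})" by blast
          moreover have "open {x. (\<Sum>i<k. - average h u x (e i)) < c * D + 1}" for e
          proof -
            have "usc (\<lambda>x. \<Sum>i<k. - average h u x (e i))"
              using u by (intro usc_sum usc_minus_average[OF _ abs[OF u] h]) (simp add: good_def)
            then show ?thesis unfolding usc_def by blast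
          qed
          ultimately show ?thesis using \<Omega> by (auto intro!: open_Int open_UN)
        qed
      qed
    qed
  qed
  define F where "F = {u. good u \<and> (\<forall>x. u x \<le> \<Phi> u x)}"
  have zero: "good (\<lambda>x. 0)" using M by (auto simp: good_def usc_def)
  then have zero_F: "(\<lambda>x. 0) \<in> F" using \<Phi>_good[OF zero] by (auto simp: F_def good_def)
  \<comment> \<open>Suprema preserve lower semicontinuity while infima do not, which is why the
    largest fixed point is taken. The zero function makes the family nonempty, the obstacle makes it
    bounded.\<close>
  define U where "U x = (SUP u\<in>F. u x)" for x
  have bddF: "bdd_above ((\<lambda>u. u x) ` F)" for x
    by (rule bdd_aboveI2[of _ _ M]) (auto simp: F_def good_def)
  have U_ge: "u x \<le> U x" if "u \<in> F" for u x unfolding U_def using that bddF by (intro cSUP_upper)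
  have U_le: "U x \<le> c" if "\<And>u. u \<in> F \<Longrightarrow> u x \<le> c" for x c
    unfolding U_def using zero_F that by (intro cSUP_least) auto
  have U_good: "good U"
    unfolding good_def
  proof (intro conjI allI impI)
    show "0 \<le> U x" for x using U_ge[OF zero_F] by simp
    show "U x \<le> M" for x by (rule U_le) (auto simp: F_def good_def)
    show "U x = 0" if "x \<notin> \<Omega>" for x
    proof (rule antisym)
      show "U x \<le> 0" using that by (intro U_le) (auto simp: F_def good_def)
    qed (use U_ge[OF zero_F] in simp)
    show "usc (\<lambda>x. - U x)"
      unfolding usc_def
    proof
      fix c
      have "- U x < c \<longleftrightarrow> (\<exists>u\<in>F. - u x < c)" for x
        using less_cSUP_iff[of F "\<lambda>u. u x" "- c"] zero_F bddF[of x] unfolding U_def by (auto simp: minus_less_iff)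
      then have "{x. - U x < c} = (\<Union>u\<in>F. {x. - u x < c})" by auto
      moreover have "open {x. - u x < c}" if "u \<in> F" for u
        using that unfolding F_def good_def usc_def by blast
      ultimately show "open {x. - U x < c}" by auto
    qed
  qed
  have U_le_\<Phi>: "U x \<le> \<Phi> U x" for x
  proof (rule U_le)
    fix u assume u: "u \<in> F"
    then have "u x \<le> \<Phi> u x" by (simp add: F_def)
    also have "\<dots> \<le> \<Phi> U x" using u U_ge[OF u] by (intro \<Phi>_mono U_good) (auto simp: F_def)
    finally show "u x \<le> \<Phi> U x" .
  qed
  have "\<Phi> U \<in> F"
    unfolding F_def using \<Phi>_good[OF U_good] \<Phi>_mono[OF U_good \<Phi>_good[OF U_good] U_le_\<Phi>] by blast
  then have U_eq: "U x = \<Phi> U x" for x using U_ge[of "\<Phi> U" x] U_le_\<Phi>[of x] by simp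
  have avg: "(\<Sum>i<k. average h U x (e i)) = (\<Sum>i<k. far h U x (e i)) + 2 * real k * tail h * U x" for x e
    by (simp add: average_def sum.distrib)
  have "truncated_solution k m \<Omega> h M U"
    unfolding truncated_solution_def
  proof (intro conjI ballI allI impI)
    show "usc (\<lambda>x. - U x)" "0 \<le> U x" "U x \<le> M" "x \<notin> \<Omega> \<Longrightarrow> U x = 0" for x
      using U_good by (auto simp: good_def)
    fix x assume x: "x \<in> \<Omega>"
    have UT: "U x = min M ((T U x + 1) / D)" using U_eq[of x] x by (simp add: \<Phi>_def)
    show "\<exists>e. frame k e \<and> - 1 - \<eta> \<le> (\<Sum>i<k. far h U x (e i)) + m * U x" if \<eta>: "0 < \<eta>" for \<eta> :: real
    proof -
      have "U x \<le> (T U x + 1) / D" using UT by simp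
      then have 1: "D * U x - 1 \<le> T U x" using D by (simp add: pos_le_divide_eq mult.commute)
      have "T U x - \<eta> < T U x" using \<eta> by simp
      then obtain e where e: "e \<in> fr" "T U x - \<eta> < (\<Sum>i<k. average h U x (e i))"
        unfolding T_def using less_cSUP_iff[OF fr bdd[OF U_good]] by blast
      then show ?thesis using 1 by (intro exI[of _ e]) (auto simp: fr_def avg D_def left_diff_distrib)
    qed
    show "(\<Sum>i<k. far h U x (e i)) + m * U x \<le> - 1" if "U x < M" "frame k e" for e
    proof -
      have "U x = (T U x + 1) / D" using UT that(1) by (auto simp: min_def split: if_splits)
      then have "T U x = D * U x - 1" using D by (simp add: field_simps)
      with T_ge[OF U_good that(2), of x] show ?thesis by (simp add: avg D_def left_diff_distrib)
    qed
  qed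
  then show ?thesis by blast
qed

end

section \<open>From the maximum principle to the strict inequality\<close>

context concave_level_domain
begin

text \<open>Passing to the limit is allowed to cost half of the right-hand side -1. The other half
  pays for \<open>v / (2 * M)\<close>, so \<open>v\<close> is a supersolution for
  \<open>m + 1 / (2 * M)\<close>; this is the strict gap.\<close>

lemma mu_plus_greater_of_truncated:
  assumes h: "\<And>j. 0 < h j" "h \<longlonglongrightarrow> 0" and M: "0 < M"
    and U: "\<And>j :: nat. truncated_solution k m \<Omega> (h j) M (U j)" "\<And>j x. x \<in> \<Omega> \<Longrightarrow> U j x < M"
  shows "ereal (C * m) < mu_plus s k \<Omega>"
proof -
  define z where "z j x = - U j x" for j x
  have z_bd: "\<bar>z j x\<bar> \<le> M" and z_le: "z j x \<le> 0" and z_usc: "usc (z j)" for j x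
    using U(1)[of j] by (auto simp: truncated_solution_def z_def[abs_def])
  have z_meas: "z j \<in> borel_measurable borel" for j using z_usc by (rule usc_borel)
  define v where "v x = - upper_limit z x" for x
  have v_usc: "usc (\<lambda>x. - v x)" unfolding v_def using usc_upper_limit[OF z_bd] by simp
  have v_bd: "\<bar>v x\<bar> \<le> M" for x unfolding v_def using upper_limit_abs_le[OF z_bd] by simp
  have v_Linf: "L_infty v"
  proof (rule L_inftyI[OF _ v_bd])
    have "(\<lambda>x. - v x) \<in> borel_measurable borel" using v_usc by (rule usc_borel)
    then show "v \<in> borel_measurable borel" by simp
  qed
  have v_nonneg: "0 \<le> v x" for x
    unfolding v_def using upper_limit_le[of z M 0 x 0, OF z_bd z_le] by simp
  have key: "\<exists>L. (\<forall>i<k. integrable levy (L i) \<and>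
       (\<forall>\<tau>. 0 < \<tau> \<longrightarrow> \<tau> < \<rho> \<longrightarrow> second_diff \<phi> x0 (\<tau> *\<^sub>R e i) \<le> L i \<tau>) \<and>
       (\<forall>\<tau>. \<rho> \<le> \<tau> \<longrightarrow> second_diff v x0 (\<tau> *\<^sub>R e i) \<le> L i \<tau>)) \<and>
     (\<Sum>i<k. integral\<^sup>L levy (L i)) + m * v x0 \<le> - 1 / 2"
    if x0: "x0 \<in> \<Omega>" and \<rho>: "0 < \<rho>" and \<phi>: "C2_on (ball x0 \<rho>) \<phi>"
      and touch: "\<forall>x\<in>ball x0 \<rho>. v x0 - \<phi> x0 \<le> v x - \<phi> x" and e: "frame k e" for x0 \<rho> \<phi> e
  proof -
    \<comment> \<open>The frame is held fixed, so that the inequality for \<open>- U\<close> is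
      obtained for every frame separately.\<close>
    define \<E> where "\<E> = {e' :: nat \<Rightarrow> 'a. \<forall>i<k. e' i = e i}"
    obtain e' L where e': "e' \<in> \<E>" and L: "\<And>i. i < k \<Longrightarrow> integrable levy (L i)"
      "\<And>i \<tau>. i < k \<Longrightarrow> 0 < \<tau> \<Longrightarrow> \<tau> < \<rho> \<Longrightarrow> L i \<tau> \<le> second_diff (\<lambda>x. - \<phi> x) x0 (\<tau> *\<^sub>R e' i)"
      "\<And>i \<tau>. i < k \<Longrightarrow> \<rho> \<le> \<tau> \<Longrightarrow> L i \<tau> \<le> second_diff (upper_limit z) x0 (\<tau> *\<^sub>R e' i)"
      "- (- 1) - 1 / 2 \<le> (\<Sum>i<k. integral\<^sup>L levy (L i)) + m * upper_limit z x0"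
    proof (rule relaxed_limit_subsolution[where \<E> = \<E> and k = k and m = m and \<kappa> = "1 / 2" and c = "\<lambda>_. - 1",
          OF z_bd z_meas h open_\<Omega> _ _ _ tendsto_const x0 \<rho> C2_on_minus[OF \<phi>]])
      show "frame k e'" if "e' \<in> \<E>" for e' using that e by (simp add: \<E>_def frame_def)
      show "e' \<in> \<E>" if "\<And>j :: nat. E j \<in> \<E>" "\<And>i. i < k \<Longrightarrow> (\<lambda>j. E j i) \<longlonglongrightarrow> e' i" for E e'
        using that by (auto simp: \<E>_def LIMSEQ_const_iff)
      show "\<exists>e\<in>\<E>. - (- 1) \<le> (\<Sum>i<k. far (h j) (z j) y (e i)) + m * z j y" if "y \<in> \<Omega>" for j y
      proof -
        have "(\<Sum>i<k. far (h j) (U j) y (e i)) + m * U j y \<le> - 1"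
          using U that e unfolding truncated_solution_def by blast
        then show ?thesis
          unfolding z_def[abs_def] by (intro bexI[of _ e]) (auto simp: far_minus sum_negf \<E>_def)
      qed
      show "upper_limit z x - - \<phi> x \<le> upper_limit z x0 - - \<phi> x0" if "x \<in> ball x0 \<rho>" for x
        using touch that by (force simp: v_def)
    qed (use that in auto)
    have "(\<Sum>i<k. integral\<^sup>L levy (\<lambda>\<tau>. - L i \<tau>)) = - (\<Sum>i<k. integral\<^sup>L levy (L i))" by (simp add: sum_negf)
    moreover have "second_diff \<phi> x0 (\<tau> *\<^sub>R e i) \<le> - L i \<tau>" if "i < k" "0 < \<tau>" "\<tau> < \<rho>" for i \<tau>
      using L(2)[OF that] e' that(1) by (simp add: second_diff_def \<E>_def)
    moreover have "second_diff v x0 (\<tau> *\<^sub>R e i) \<le> - L i \<tau>" if "i < k" "\<rho> \<le> \<tau>" for i \<tau>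
      using L(3)[OF that] e' that(1) by (simp add: second_diff_def \<E>_def v_def)
    ultimately show ?thesis
      using L(1,4) by (intro exI[of _ "\<lambda>i \<tau>. - L i \<tau>"]) (auto simp: v_def)
  qed
  define m' where "m' = m + 1 / (2 * M)"
  have "C * m < C * m'" using C_pos M by (simp add: m'_def)
  moreover have "ereal (C * m') \<le> mu_plus s k \<Omega>"
    unfolding mu_plus_def
  proof (rule SUP_upper, intro CollectI exI[of _ v] conjI ballI allI)
    show "L_infty v" by (rule v_Linf)
    show lsc: "lsc_on \<Omega> v" using v_usc by (rule usc_minus_imp_lsc_on)
    show "0 \<le> v x" for x by (rule v_nonneg)
    \<comment> \<open>At a zero of \<open>v \<ge> 0\<close> the constant 0 touches from below and
      makes all the second differences involved nonnegative, against the right-hand side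
      \<open>- 1 / 2\<close>.\<close>
    show "0 < v x" if x: "x \<in> \<Omega>" for x
    proof (rule ccontr)
      assume "\<not> 0 < v x"
      then have vx: "v x = 0" using v_nonneg[of x] by simp
      show False
      proof (cases "\<exists>e :: nat \<Rightarrow> 'a. frame k e")
        case True
        then obtain e :: "nat \<Rightarrow> 'a" where e: "frame k e" by blast
        have "C2_on (ball x 1) (\<lambda>p. 0)" using C2_on_paraboloid[of "ball x 1" 0 x x] by simp
        moreover have "\<forall>p\<in>ball x 1. v x - 0 \<le> v p - 0" using v_nonneg vx by simp
        ultimately obtain L where L: "\<And>i. i < k \<Longrightarrow> integrable levy (L i)"
          "\<And>i \<tau>. i < k \<Longrightarrow> 0 < \<tau> \<Longrightarrow> \<tau> < 1 \<Longrightarrow> second_diff (\<lambda>p. 0) x (\<tau> *\<^sub>R e i) \<le> L i \<tau>"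
          "\<And>i \<tau>. i < k \<Longrightarrow> 1 \<le> \<tau> \<Longrightarrow> second_diff v x (\<tau> *\<^sub>R e i) \<le> L i \<tau>"
          "(\<Sum>i<k. integral\<^sup>L levy (L i)) + m * v x \<le> - 1 / 2"
          using key[OF x zero_less_one _ _ e, of "\<lambda>p. 0"] by blast
        have "0 \<le> integral\<^sup>L levy (L i)" if i: "i < k" for i
        proof -
          have "0 \<le> L i \<tau>" if "0 < \<tau>" for \<tau>
          proof (cases "\<tau> < 1")
            case True
            then show ?thesis using L(2)[OF i that] by (simp add: second_diff_def)
          next
            case False
            have "0 \<le> second_diff v x (\<tau> *\<^sub>R e i)"
              using v_nonneg[of "x + \<tau> *\<^sub>R e i"] v_nonneg[of "x - \<tau> *\<^sub>R e i"] vx by (simp add: second_diff_def)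
            then show ?thesis using L(3)[OF i, of \<tau>] False by simp
          qed
          then have "integral\<^sup>L levy (\<lambda>\<tau>. 0) \<le> integral\<^sup>L levy (L i)" by (intro integral_levy_mono L(1) i) auto
          then show ?thesis by simp
        qed
        then have "0 \<le> (\<Sum>i<k. integral\<^sup>L levy (L i))" by (intro sum_nonneg) auto
        with L(4) vx show False by simp
      next
        case False
        then show False using U(1)[of 0] x unfolding truncated_solution_def by (meson zero_less_one)
      qed
    qed
    show "visc_supersolution (I_plus s k (C * m')) \<Omega> v"
      unfolding visc_supersolution_def
    proof (intro conjI ballI allI impI v_Linf lsc)
      fix x0 \<rho> \<phi> assume x0: "x0 \<in> \<Omega>" and \<rho>: "0 < (\<rho> :: real)" and \<phi>: "C2_on (ball x0 \<rho>) \<phi>"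
        and touch: "\<forall>x\<in>ball x0 \<rho>. v x0 - \<phi> x0 \<le> v x - \<phi> x"
      show "I_plus s k (C * m') \<rho> \<phi> v x0 \<le> 0"
      proof (rule I_plus_nonposI)
        fix e :: "nat \<Rightarrow> 'a" assume e: "frame k e"
        from key[OF x0 \<rho> \<phi> touch e] obtain L where L: "\<And>i. i < k \<Longrightarrow> integrable levy (L i)"
          "\<And>i \<tau>. i < k \<Longrightarrow> 0 < \<tau> \<Longrightarrow> \<tau> < \<rho> \<Longrightarrow> second_diff \<phi> x0 (\<tau> *\<^sub>R e i) \<le> L i \<tau>"
          "\<And>i \<tau>. i < k \<Longrightarrow> \<rho> \<le> \<tau> \<Longrightarrow> second_diff v x0 (\<tau> *\<^sub>R e i) \<le> L i \<tau>"
          "(\<Sum>i<k. integral\<^sup>L levy (L i)) + m * v x0 \<le> - 1 / 2" by blast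
        have "visc_directional s \<rho> \<phi> v x0 (e i) \<le> ereal (integral\<^sup>L levy (L i))" if "i < k" for i
          using L that \<rho> by (intro visc_directional_le) auto
        moreover have "1 / (2 * M) * v x0 \<le> 1 / 2" using v_bd[of x0] M by (simp add: field_simps abs_le_iff)
        then have "(\<Sum>i<k. integral\<^sup>L levy (L i)) + m' * v x0 \<le> 0" using L(4) unfolding m'_def distrib_right by linarith
        ultimately show "\<exists>a. (\<forall>i<k. visc_directional s \<rho> \<phi> v x0 (e i) \<le> ereal (a i)) \<and> (\<Sum>i<k. a i) + m' * v x0 \<le> 0"
          by (intro exI[of _ "\<lambda>i. integral\<^sup>L levy (L i)"]) blast
      qed
    qed
  qed
  ultimately show ?thesis by (metis ereal_less(1) ereal_less_le less_ereal.simps(1) order_less_le_trans)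
qed

text \<open>The shift \<open>2 * h * R + h\<^sup>2\<close> makes \<open>far_barrier\<close>
  available at every point of \<open>\<Omega>\<close>, so \<open>B\<close> does not depend on
  \<open>h\<close>.\<close>

lemma discrete_barrier:
  assumes k: "1 \<le> k"
  obtains B where "0 < B"
    "\<And>h u x. 0 < h \<Longrightarrow> 2 * h * R + h\<^sup>2 \<le> 1 \<Longrightarrow> L_infty u \<Longrightarrow> (\<And>x. u x \<le> 1) \<Longrightarrow> (\<And>x. x \<notin> \<Omega> \<Longrightarrow> u x \<le> 0) \<Longrightarrow>
      (\<And>x. x \<in> \<Omega> \<Longrightarrow> \<exists>e. frame k e \<and> - 2 \<le> (\<Sum>i<k. far h u x (e i)) + m * u x) \<Longrightarrow>
      u x \<le> B * barrier (2 * h * R + h\<^sup>2) x"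
proof -
  define \<beta> where "\<beta> = real k * barrier_const * (R\<^sup>2 + 1) powr (- s / 2)"
  have "0 < R\<^sup>2 + 1" by (simp add: add_nonneg_pos)
  then have \<beta>: "0 < \<beta>" using k barrier_const_pos by (simp add: \<beta>_def)
  \<comment> \<open>The 4 covers the 2 of the assumed inequality and an error of 1 from the near
    maximum, with 1 to spare.\<close>
  define B where "B = (\<bar>m\<bar> + 4) / \<beta>"
  have B: "0 < B" using \<beta> by (simp add: B_def)
  have B\<beta>: "B * \<beta> = \<bar>m\<bar> + 4" using \<beta> by (simp add: B_def)
  show ?thesis
  proof (rule that[OF B], rule ccontr)
    fix h u p assume h: "0 < h" and r1: "2 * h * R + h\<^sup>2 \<le> 1" and Linf: "L_infty u"
      and u1: "\<And>x. u x \<le> 1" and out: "\<And>x. x \<notin> \<Omega> \<Longrightarrow> u x \<le> 0"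
      and eq: "\<And>x. x \<in> \<Omega> \<Longrightarrow> \<exists>e. frame k e \<and> - 2 \<le> (\<Sum>i<k. far h u x (e i)) + m * u x"
      and p: "\<not> u p \<le> B * barrier (2 * h * R + h\<^sup>2) p"
    define r where "r = 2 * h * R + h\<^sup>2"
    define F where "F x = u x - B * barrier r x" for x
    have Fp: "0 < F p" using p by (simp add: F_def r_def)
    have F1: "F x \<le> 1" for x
    proof -
      have "0 \<le> B * barrier r x" using B barrier_nonneg by simp
      with u1[of x] show ?thesis by (simp add: F_def)
    qed
    \<comment> \<open>The first entry keeps \<open>F y\<close> positive, hence \<open>y\<close> in
      \<open>\<Omega>\<close>; the second bounds the error \<open>2 * \<eta> * tail h\<close>,
      summed over \<open>k\<close> directions, by 1.\<close>
    define \<eta> where "\<eta> = min (F p / 2) (1 / (2 * (real k * tail h + 1)))"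
    have kt: "0 \<le> real k * tail h" using tail_pos[OF h] by simp
    have \<eta>: "0 < \<eta>" using Fp kt by (simp add: \<eta>_def)
    obtain y where y: "\<And>x. F x \<le> F y + \<eta>"
      using near_maximum_exists[of UNIV F 1 \<eta>] F1 \<eta> by auto
    have "\<eta> \<le> F p / 2" by (simp add: \<eta>_def)
    then have Fy: "0 < F y" using y[of p] Fp by linarith
    have "0 \<le> B * barrier r y" using B barrier_nonneg by simp
    with Fy have uy: "0 < u y" by (simp add: F_def)
    then have y\<Omega>: "y \<in> \<Omega>" using out[of y] by force
    then obtain e where e: "frame k e" "- 2 \<le> (\<Sum>i<k. far h u y (e i)) + m * u y" using eq by blast
    have dy: "0 < d y" using y\<Omega> by (simp add: \<Omega>_eq)
    have r1': "r \<le> 1" using r1 by (simp add: r_def)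
    have BL: "L_infty (barrier r)" by (rule L_infty_barrier[OF r1'])
    have BB: "L_infty (\<lambda>x. B * barrier r x)" using BL by (rule L_infty_cmult)
    have "far h u y (e i) \<le> - (B * barrier_const * (R\<^sup>2 + 1) powr (- s / 2)) + 2 * \<eta> * tail h" if "i < k" for i
    proof -
      have "far h u y (e i) \<le> far h (\<lambda>x. B * barrier r x) y (e i) + 2 * \<eta> * tail h"
      proof (rule far_le[OF Linf BB h])
        fix \<tau> :: real
        show "second_diff u y (\<tau> *\<^sub>R e i) \<le> second_diff (\<lambda>x. B * barrier r x) y (\<tau> *\<^sub>R e i) + 2 * \<eta>"
          using y[of "y + \<tau> *\<^sub>R e i"] y[of "y - \<tau> *\<^sub>R e i"] by (simp add: second_diff_def F_def)
      qed
      moreover have "far h (\<lambda>x. B * barrier r x) y (e i) = B * far h (barrier r) y (e i)" by (rule far_cmult)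
      moreover have "far h (barrier r) y (e i) \<le> - barrier_const * (d y + r) powr (- s / 2)"
        using e(1) that dy by (intro far_barrier[OF _ r1' h _ y\<Omega>]) (auto simp: frame_def r_def)
      moreover have "(R\<^sup>2 + 1) powr (- s / 2) \<le> (d y + r) powr (- s / 2)"
      proof -
        have "0 \<le> r" using h R_pos by (simp add: r_def)
        then show ?thesis using dy d_le[of y] r1' s_pos by (intro powr_mono2') auto
      qed
      then have "B * (barrier_const * (R\<^sup>2 + 1) powr (- s / 2)) \<le> B * (barrier_const * (d y + r) powr (- s / 2))"
        using B barrier_const_pos by (intro mult_left_mono) auto
      moreover have "B * far h (barrier r) y (e i) \<le> B * (- barrier_const * (d y + r) powr (- s / 2))"
        using B calculation(3) by (intro mult_left_mono) auto
      ultimately show ?thesis by (simp add: mult.assoc)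
    qed
    then have "(\<Sum>i<k. far h u y (e i)) \<le> (\<Sum>i<k. - (B * barrier_const * (R\<^sup>2 + 1) powr (- s / 2)) + 2 * \<eta> * tail h)"
      by (intro sum_mono) auto
    also have "\<dots> = - (B * \<beta>) + 2 * \<eta> * (real k * tail h)" by (simp add: \<beta>_def algebra_simps)
    finally have "(\<Sum>i<k. far h u y (e i)) \<le> - (\<bar>m\<bar> + 4) + 2 * \<eta> * (real k * tail h)" unfolding B\<beta> .
    moreover have "2 * \<eta> * (real k * tail h) \<le> 1"
    proof -
      have "\<eta> \<le> 1 / (2 * (real k * tail h + 1))" by (simp add: \<eta>_def)
      then have "2 * \<eta> * (real k * tail h + 1) \<le> 1" using kt by (simp add: field_simps)
      then show ?thesis using \<eta> by (simp add: distrib_left)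
    qed
    moreover have "m * u y \<le> \<bar>m\<bar> * 1" using uy u1[of y] by (intro mult_le_abs_mult) auto
    ultimately show False using e(2) by linarith
  qed
qed

text \<open>The danger is that the points where the rescaled solutions equal 1 drift to the
  boundary. The discrete barrier is uniform in the truncation length, passes to the limit and keeps
  their limit point inside \<open>\<Omega>\<close>.\<close>

lemma not_maximum_principle_of_truncated:
  assumes k: "1 \<le> k" and h: "\<And>j. 0 < h j" "h \<longlonglongrightarrow> 0" "\<And>j. 2 * h j * R + (h j)\<^sup>2 \<le> 1"
    and U: "\<And>j :: nat. truncated_solution k m \<Omega> (h j) (real (Suc j)) (U j)"
    and top: "\<And>j. \<exists>x\<in>\<Omega>. \<not> U j x < real (Suc j)"
  shows "\<not> maximum_principle (I_plus s k (C * m)) \<Omega>"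
proof
  assume MP: "maximum_principle (I_plus s k (C * m)) \<Omega>"
  define t where "t j = inverse (real (Suc j))" for j
  have t: "0 < t j" "t j \<le> 1" for j by (simp_all add: t_def field_simps)
  define z where "z j x = t j * U j x" for j x
  have U_bd: "0 \<le> U j x" "U j x \<le> real (Suc j)" "x \<notin> \<Omega> \<Longrightarrow> U j x = 0" for j x
    using U[of j] by (auto simp: truncated_solution_def)
  have z_le1: "z j x \<le> 1" for j x
  proof -
    have "t j * U j x \<le> t j * real (Suc j)" using U_bd(2)[of j x] t(1)[of j] by (intro mult_left_mono) (auto intro: less_imp_le)
    then show ?thesis by (simp add: z_def t_def)
  qed
  have z_nonneg: "0 \<le> z j x" for j x using U_bd(1)[of j x] t(1)[of j] by (simp add: z_def less_imp_le)
  have z_bd: "\<bar>z j x\<bar> \<le> 1" for j x using z_le1[of j x] z_nonneg[of j x] by simp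
  have z_meas: "z j \<in> borel_measurable borel" for j
  proof -
    have "(\<lambda>x. - U j x) \<in> borel_measurable borel" using U[of j] by (intro usc_borel) (simp add: truncated_solution_def)
    then have "U j \<in> borel_measurable borel" by simp
    then show ?thesis unfolding z_def[abs_def] by measurable
  qed
  have z_eq: "\<exists>e. frame k e \<and> - (2 * t j) \<le> (\<Sum>i<k. far (h j) (z j) x (e i)) + m * z j x" if "x \<in> \<Omega>" for j x
  proof -
    have "\<forall>x\<in>\<Omega>. \<forall>\<eta>>0. \<exists>e. frame k e \<and> - 1 - \<eta> \<le> (\<Sum>i<k. far (h j) (U j) x (e i)) + m * U j x"
      using U[of j] unfolding truncated_solution_def by blast
    \<comment> \<open>The tolerance 1 is good enough, since the resulting bound -2 is multiplied by
      \<open>t j\<close>, which tends to 0.\<close>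
    then have "\<exists>e. frame k e \<and> - 1 - 1 \<le> (\<Sum>i<k. far (h j) (U j) x (e i)) + m * U j x"
      using that zero_less_one by blast
    then obtain e where e: "frame k e" "- 1 - 1 \<le> (\<Sum>i<k. far (h j) (U j) x (e i)) + m * U j x" by blast
    have "t j * (- 1 - 1) \<le> t j * ((\<Sum>i<k. far (h j) (U j) x (e i)) + m * U j x)"
      using e(2) t(1)[of j] by (intro mult_left_mono) auto
    then show ?thesis using e(1)
      by (intro exI[of _ e]) (auto simp: z_def[abs_def] far_cmult sum_distrib_left algebra_simps)
  qed
  obtain B where B: "0 < B" "\<And>h u x. 0 < h \<Longrightarrow> 2 * h * R + h\<^sup>2 \<le> 1 \<Longrightarrow> L_infty u \<Longrightarrow> (\<And>x. u x \<le> 1) \<Longrightarrow> (\<And>x. x \<notin> \<Omega> \<Longrightarrow> u x \<le> 0) \<Longrightarrow>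
      (\<And>x. x \<in> \<Omega> \<Longrightarrow> \<exists>e. frame k e \<and> - 2 \<le> (\<Sum>i<k. far h u x (e i)) + m * u x) \<Longrightarrow>
      u x \<le> B * barrier (2 * h * R + h\<^sup>2) x"
    using discrete_barrier[OF k, of m] by blast
  have z_barrier: "z j x \<le> B * barrier (2 * h j * R + (h j)\<^sup>2) x" for j x
  proof (rule B(2)[OF h(1,3)])
    show "L_infty (z j)" by (rule L_inftyI[OF z_meas z_bd])
    show "z j x \<le> 1" for x by (rule z_le1)
    show "x \<notin> \<Omega> \<Longrightarrow> z j x \<le> 0" for x using U_bd(3)[of x j] by (simp add: z_def)
    fix x assume "x \<in> \<Omega>"
    from z_eq[OF this] obtain e where e: "frame k e" "- (2 * t j) \<le> (\<Sum>i<k. far (h j) (z j) x (e i)) + m * z j x" by blast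
    then show "\<exists>e. frame k e \<and> - 2 \<le> (\<Sum>i<k. far (h j) (z j) x (e i)) + m * z j x"
      using t(2)[of j] by (intro exI[of _ e]) auto
  qed
  define Z where "Z = upper_limit z"
  have Z_usc: "usc Z" unfolding Z_def by (rule usc_upper_limit[OF z_bd])
  have Z_bd: "\<bar>Z x\<bar> \<le> 1" for x unfolding Z_def by (rule upper_limit_abs_le[OF z_bd])
  have Z_Linf: "L_infty Z" by (rule L_inftyI[OF usc_borel[OF Z_usc] Z_bd])
  have Z_barrier: "Z x \<le> B * barrier 0 x" for x
  proof -
    obtain J Y where J: "\<forall>i :: nat. i \<le> J i" and Y: "Y \<longlonglongrightarrow> x" and zY: "(\<lambda>i. z (J i) (Y i)) \<longlonglongrightarrow> Z x"
      unfolding Z_def by (rule upper_limit_recovery[of z 1 x, OF z_bd])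
    have J_top: "filterlim J at_top sequentially" using J by (rule filterlim_at_top_ge_ident)
    have hJ: "(\<lambda>i. h (J i)) \<longlonglongrightarrow> 0" using filterlim_compose[OF h(2) J_top] .
    have dY: "(\<lambda>i. d (Y i)) \<longlonglongrightarrow> d x" using Y by (rule tendsto_d)
    have "(\<lambda>i. max 0 (d (Y i) + (2 * h (J i) * R + (h (J i))\<^sup>2)) powr (s / 2))
       \<longlonglongrightarrow> max 0 (d x + (2 * 0 * R + 0\<^sup>2)) powr (s / 2)"
      using s_pos by (intro tendsto_powr' tendsto_intros tendsto_max hJ dY) auto
    then have "(\<lambda>i. B * barrier (2 * h (J i) * R + (h (J i))\<^sup>2) (Y i)) \<longlonglongrightarrow> B * barrier 0 x"
      using tendsto_mult[OF tendsto_const[of B]] by (simp add: barrier_def)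
    then show ?thesis by (rule LIMSEQ_le[OF zY]) (use z_barrier in blast)
  qed
  have out: "Z x \<le> 0" if "x \<notin> \<Omega>" for x
    using Z_barrier[of x] that by (simp add: \<Omega>_eq barrier_outside not_less)
  obtain X where X: "\<And>j. X j \<in> \<Omega>" "\<And>j. \<not> U j (X j) < real (Suc j)" using top by metis
  have zX: "z j (X j) = 1" for j
  proof -
    have "U j (X j) = real (Suc j)" using X(2)[of j] U_bd(2)[of j "X j"] by simp
    then show ?thesis by (simp add: z_def t_def)
  qed
  have "compact (closure \<Omega>)" using bounded_\<Omega> by simp
  moreover have "\<forall>j. X j \<in> closure \<Omega>" using X(1) closure_subset by blast
  ultimately obtain p q where q: "strict_mono (q :: nat \<Rightarrow> nat)" "(X \<circ> q) \<longlonglongrightarrow> p"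
    unfolding compact_def by metis
  have "1 \<le> Z p"
  proof (rule ccontr)
    assume "\<not> 1 \<le> Z p"
    then have "\<forall>\<^sub>F i in sequentially. z (q i) ((X \<circ> q) i) < 1"
      by (intro upper_limit_sequence[OF z_bd _ filterlim_subseq[OF q(1)] q(2)]) (simp add: Z_def)
    then show False by (simp add: zX)
  qed
  have p: "p \<in> \<Omega>" using out[of p] \<open>1 \<le> Z p\<close> by force
  have "visc_subsolution (I_plus s k (C * m)) \<Omega> Z"
    unfolding visc_subsolution_def
  proof (intro conjI ballI allI impI)
    show "L_infty Z" by (rule Z_Linf)
    show "usc_on \<Omega> Z" by (rule usc_imp_usc_on[OF Z_usc])
    fix x0 \<rho> \<phi> assume x0: "x0 \<in> \<Omega>" and \<rho>: "0 < (\<rho> :: real)" and \<phi>: "C2_on (ball x0 \<rho>) \<phi>"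
      and touch: "\<forall>x\<in>ball x0 \<rho>. Z x - \<phi> x \<le> Z x0 - \<phi> x0"
    show "0 \<le> I_plus s k (C * m) \<rho> \<phi> Z x0"
    proof (rule I_plus_nonnegI)
      fix \<kappa> :: real assume \<kappa>: "0 < \<kappa>"
      have c: "(\<lambda>j. 2 * t j) \<longlonglongrightarrow> 2 * 0"
        unfolding t_def by (intro tendsto_intros LIMSEQ_inverse_real_of_nat)
      obtain e L where e: "e \<in> Collect (frame k)" and L: "\<And>i. i < k \<Longrightarrow> integrable levy (L i)"
        "\<And>i \<tau>. i < k \<Longrightarrow> 0 < \<tau> \<Longrightarrow> \<tau> < \<rho> \<Longrightarrow> L i \<tau> \<le> second_diff \<phi> x0 (\<tau> *\<^sub>R e i)"
        "\<And>i \<tau>. i < k \<Longrightarrow> \<rho> \<le> \<tau> \<Longrightarrow> L i \<tau> \<le> second_diff (upper_limit z) x0 (\<tau> *\<^sub>R e i)"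
        "- (2 * 0) - \<kappa> \<le> (\<Sum>i<k. integral\<^sup>L levy (L i)) + m * upper_limit z x0"
      proof (rule relaxed_limit_subsolution[where \<E> = "Collect (frame k)" and k = k and m = m and \<kappa> = \<kappa>,
            OF z_bd z_meas h(1,2) open_\<Omega> _ _ _ c x0 \<rho> \<phi> _ \<kappa>])
        show "e \<in> Collect (frame k)" if "\<And>j :: nat. E j \<in> Collect (frame k)" "\<And>i. i < k \<Longrightarrow> (\<lambda>j. E j i) \<longlonglongrightarrow> e i" for E and e :: "nat \<Rightarrow> 'a"
          using that frame_limit[of k E e] by blast
        show "\<exists>e\<in>Collect (frame k). - (2 * t j) \<le> (\<Sum>i<k. far (h j) (z j) y (e i)) + m * z j y" if "y \<in> \<Omega>" for j y
          using z_eq[OF that] by blast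
        show "upper_limit z x - \<phi> x \<le> upper_limit z x0 - \<phi> x0" if "x \<in> ball x0 \<rho>" for x
          using touch that unfolding Z_def by blast
      qed (use that in auto)
      have "ereal (integral\<^sup>L levy (L i)) \<le> visc_directional s \<rho> \<phi> Z x0 (e i)" if "i < k" for i
        using L that \<rho> unfolding Z_def by (intro visc_directional_ge) auto
      then show "\<exists>e a. frame k e \<and> (\<forall>i<k. ereal (a i) \<le> visc_directional s \<rho> \<phi> Z x0 (e i)) \<and> - \<kappa> \<le> (\<Sum>i<k. a i) + m * Z x0"
        using e L(4) unfolding Z_def by (intro exI[of _ e] exI[of _ "\<lambda>i. integral\<^sup>L levy (L i)"]) auto
    qed
  qed
  then have "Z p \<le> 0"
    using MP p usc_imp_usc_on[OF Z_usc] Z_Linf out unfolding maximum_principle_def by blast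
  with \<open>1 \<le> Z p\<close> show False by simp
qed

text \<open>The alternative concerns one fixed choice of solutions \<open>W n M\<close>. If no
  single \<open>M\<close> works, then for each \<open>M = j + 1\<close> the obstacle is reached for
  all large \<open>n\<close>, and a diagonal choice lets \<open>M\<close> grow while the truncation
  length tends to 0.\<close>

lemma mu_plus_greater_of_maximum_principle:
  assumes k: "1 \<le> k" "k \<le> DIM('a)" and MP: "maximum_principle (I_plus s k (C * m)) \<Omega>"
  shows "ereal (C * m) < mu_plus s k \<Omega>"
proof -
  define hs where "hs n = inverse (real (Suc n))" for n
  have hs: "0 < hs n" "hs \<longlonglongrightarrow> 0" for n
    using LIMSEQ_inverse_real_of_nat by (simp_all add: hs_def[abs_def] del: of_nat_Suc)
  have "0 < \<bar>m\<bar> + 1" by simp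
  then obtain h0 where h0: "0 < h0" "tail h0 = \<bar>m\<bar> + 1" by (rule tail_surj)
  have "(\<lambda>n. 2 * hs n * R + (hs n)\<^sup>2) \<longlonglongrightarrow> 2 * 0 * R + 0\<^sup>2" by (intro tendsto_intros hs)
  from order_tendstoD(2)[OF this, of 1]
  have "\<forall>\<^sub>F n in sequentially. 2 * hs n * R + (hs n)\<^sup>2 < 1" by simp
  moreover have "\<forall>\<^sub>F n in sequentially. hs n < h0" using order_tendstoD(2)[OF hs(2) h0(1)] .
  ultimately have "\<forall>\<^sub>F n in sequentially. 2 * hs n * R + (hs n)\<^sup>2 \<le> 1 \<and> m < 2 * real k * tail (hs n)"
  proof eventually_elim
    case (elim n)
    have "1 * (\<bar>m\<bar> + 1) \<le> (2 * real k) * tail (hs n)"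
      using tail_antimono[OF hs(1)[of n], of h0] elim h0 k by (intro mult_mono) auto
    then show ?case using elim by simp
  qed
  then obtain N where N: "\<And>n. N \<le> n \<Longrightarrow> 2 * hs n * R + (hs n)\<^sup>2 \<le> 1" "\<And>n. N \<le> n \<Longrightarrow> m < 2 * real k * tail (hs n)"
    unfolding eventually_sequentially by blast
  have "\<forall>n M. \<exists>U. N \<le> n \<longrightarrow> 0 < M \<longrightarrow> truncated_solution k m \<Omega> (hs n) M U"
    using truncated_solution_exists[OF open_\<Omega> k(2) hs(1) _ N(2)] by blast
  then obtain W where W: "\<And>n M. N \<le> n \<Longrightarrow> 0 < M \<Longrightarrow> truncated_solution k m \<Omega> (hs n) M (W n M)" by metis
  have hs_sub: "(\<lambda>j. hs (f j)) \<longlonglongrightarrow> 0" if "\<And>j. j \<le> f j" for f :: "nat \<Rightarrow> nat"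
  proof -
    have "filterlim f at_top sequentially" using that by (simp add: filterlim_at_top_ge_ident)
    then show ?thesis by (rule filterlim_compose[OF hs(2)])
  qed
  show ?thesis
  proof (cases "\<exists>M>0. \<forall>j. \<exists>n. N \<le> n \<and> j \<le> n \<and> (\<forall>x\<in>\<Omega>. W n M x < M)")
    case True
    then obtain M f where M: "0 < M" and f: "\<And>j. N \<le> f j" "\<And>j. j \<le> f j" "\<And>j x. x \<in> \<Omega> \<Longrightarrow> W (f j) M x < M"
      by metis
    show ?thesis
      by (rule mu_plus_greater_of_truncated[OF hs(1) hs_sub[OF f(2)] M W[OF f(1) M] f(3)])
  next
    case False
    then have "\<forall>j. \<exists>j'. \<forall>n. N \<le> n \<longrightarrow> j' \<le> n \<longrightarrow> (\<exists>x\<in>\<Omega>. \<not> W n (real (Suc j)) x < real (Suc j))"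
      by (meson of_nat_0_less_iff zero_less_Suc)
    then obtain g where g: "\<And>j n. N \<le> n \<Longrightarrow> g j \<le> n \<Longrightarrow> \<exists>x\<in>\<Omega>. \<not> W n (real (Suc j)) x < real (Suc j)" by metis
    define f where "f j = max j (max N (g j))" for j
    have f: "j \<le> f j" "N \<le> f j" "g j \<le> f j" for j by (auto simp: f_def)
    have "\<not> maximum_principle (I_plus s k (C * m)) \<Omega>"
      by (rule not_maximum_principle_of_truncated[OF k(1) hs(1) hs_sub[OF f(1)] N(1)[OF f(2)] W[OF f(2)] g[OF f(2,3)]]) simp
    with MP show ?thesis by blast
  qed
qed

end

theorem theorem6p8:
  fixes \<Omega> :: "'a::euclidean_space set" and s :: real and k :: nat
  assumes s: "0 < s" "s < 1"
    and k: "1 \<le> k" "k \<le> DIM('a)"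
    and \<Omega>: "uniformly_convex_domain \<Omega>"
  shows "mu_plus s k \<Omega> < \<infinity>
    \<and> (\<forall>\<mu>::real. maximum_principle (I_plus s k \<mu>) \<Omega> \<longleftrightarrow> ereal \<mu> < mu_plus s k \<Omega>)
    \<and> (k < DIM('a) \<longrightarrow> (\<forall>\<mu>::real. maximum_principle (I_minus s k \<mu>) \<Omega>))"
proof -
  obtain d R where "concave_level_domain s \<Omega> d R"
    using uniformly_convex_domain_level[OF \<Omega> s] .
  then interpret concave_level_domain s \<Omega> d R .
  \<comment> \<open>The results above are stated for \<open>C * m\<close>; since
    \<open>C > 0\<close> this is every real number.\<close>
  have \<mu>: "\<mu> = C * (\<mu> / C)" for \<mu> :: real using C_pos by simp
  show ?thesis
    using mu_plus_finite[OF k] mu_plus_greater_of_maximum_principle[OF k]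
      maximum_principle_below_mu_plus[OF k(1)] maximum_principle_I_minus[OF k(1)] \<mu> by metis
qed

end
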